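(* There exist constants $\delta_{\rm ED}\in(0,1)$ and $C_{\rm ED}\ge1$, independent of the solution, of $d$ and of $\nu$, such that for every even dimension $d=2n$ ($n\ge1$) and every $0<\nu\le1$ there exist coefficient functions $\Phi^{(1)},\Phi^{(2)}$ varying on a time scale $\mathcal O(\nu^{-1/2})$ (in the sense given in the context) with the following property. Set $$\mathbb V(t,\mathbf x)=\Phi^{(1)}(t)\,\mathbf u_1(\mathbf x)+\Phi^{(2)}(t)\,\mathbf u_2(\mathbf x).$$ For every $\eta_0\in L^2(\mathbb T^d)$, the solution $\eta$ of the passive scalar equation $$\partial_t\eta+\mathbb V(t)\cdot\nabla_{\mathbf x}\eta=\nu\Delta_{\mathbf x}\eta,\qquad\eta(t=0)=\eta_0,$$ on $\mathbb T^d$ satisfies $$\|\eta(s+t,\cdot)-\overline\eta(s+t)\|_{L^2(\mathbb T^d)}\le C_{\rm ED}\,\|\eta(s,\cdot)-\overline\eta(s)\|_{L^2(\mathbb T^d)}\,e^{-\delta_{\rm ED}\nu^{1/2}t}\qquad\text{for all }s,t\in\mathbb R_+ .$$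
   Context: $\mathbb T=\mathbb R/2\pi\mathbb Z$; $\overline\eta(t)=\frac1{|\mathbb T|^d}\int_{\mathbb T^d}\eta(t,\mathbf x)\,d\mathbf x$. With $\{\mathbf e_j\}_{j=1}^d$ the canonical basis of $\mathbb R^d$ and $d=2n$, $$\mathbf u_1(\mathbf x)=\sum_{j=1}^n\sin(x_{n+j})\,\mathbf e_j,\qquad\mathbf u_2(\mathbf x)=\sum_{j=1}^n\sin(x_j)\,\mathbf e_{n+j}.$$ That $\Phi^{(1)},\Phi^{(2)}$ vary on a time scale $\mathcal O(\nu^{-1/2})$ means: they are smooth functions $[0,\infty)\to[0,1]$ and, for some constant $\delta_*\in(0,1)$ independent of $\nu$ and $d$, with $\tau=\delta_*^{-1}\nu^{-1/2}$, $\Phi^{(1)}$ vanishes outside $\bigcup_{k\in\mathbb N}\tau(6k,6k+3)$, equals $1$ on $\tau[6k+1,6k+2]$ and is monotone on $\tau[6k,6k+1]$ and on $\tau[6k+2,6k+3]$, while $\Phi^{(2)}$ vanishes outside $\bigcup_{k\in\mathbb N}\tau(6k+3,6k+6)$ and equals $1$ on $\tau[6k+4,6k+5]$ ($k=0,1,2,\dots$). *)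

theory Defs
  imports "HOL-Analysis.Analysis"
begin

text \<open>
  The dimension \<open>d\<close> is quantified inside the statement (the constants must not depend on it), so
  points of \<open>\<real>\<^sup>d\<close> are functions \<open>nat \<Rightarrow> real\<close> that are \<open>undefined\<close> outside \<open>{..<d}\<close>.  On these
  the topology of \<^typ>\<open>nat \<Rightarrow> real\<close> (product topology) is the Euclidean one.  Coordinates are
  numbered from 0: \<open>x (j - 1)\<close> is the coordinate usually written \<open>x\<^sub>j\<close>.
\<close>

definition RR :: "nat \<Rightarrow> (nat \<Rightarrow> real) set" where
  "RR d = (\<Pi>\<^sub>E i\<in>{..<d}. UNIV)"

text \<open>Lebesgue measure on the torus; functions on the torus are identified with functions on the
  fundamental cell \<open>[0, 2\<pi>)\<^sup>d\<close>.\<close>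

definition torus :: "nat \<Rightarrow> (nat \<Rightarrow> real) measure" where
  "torus d = (\<Pi>\<^sub>M i\<in>{..<d}. restrict_space lborel {0..<2 * pi})"

definition L2 :: "nat \<Rightarrow> ((nat \<Rightarrow> real) \<Rightarrow> real) set" where
  "L2 d = {f. f \<in> borel_measurable (torus d) \<and> integrable (torus d) (\<lambda>x. (f x)\<^sup>2)}"

definition L2_norm :: "nat \<Rightarrow> ((nat \<Rightarrow> real) \<Rightarrow> real) \<Rightarrow> real" where
  "L2_norm d f = sqrt (\<integral>x. (f x)\<^sup>2 \<partial>torus d)"

definition torus_mean :: "nat \<Rightarrow> ((nat \<Rightarrow> real) \<Rightarrow> real) \<Rightarrow> real" where
  "torus_mean d f = (\<integral>x. f x \<partial>torus d) / (2 * pi) ^ d"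

definition partial :: "nat \<Rightarrow> ((nat \<Rightarrow> real) \<Rightarrow> real) \<Rightarrow> (nat \<Rightarrow> real) \<Rightarrow> real" where
  "partial j f x = deriv (\<lambda>h. f (x(j := h))) (x j)"

definition laplacian :: "nat \<Rightarrow> ((nat \<Rightarrow> real) \<Rightarrow> real) \<Rightarrow> (nat \<Rightarrow> real) \<Rightarrow> real" where
  "laplacian d f x = (\<Sum>j<d. partial j (partial j f) x)"

text \<open>\<open>C\<^sup>\<infinity>(\<real>\<^sup>d)\<close>: all iterated partial derivatives, in any order, exist and are continuous.\<close>

definition smooth_on_RR :: "nat \<Rightarrow> ((nat \<Rightarrow> real) \<Rightarrow> real) \<Rightarrow> bool" where
  "smooth_on_RR d f \<longleftrightarrow>
     (\<forall>js. set js \<subseteq> {..<d} \<longrightarrow>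
        continuous_on (RR d) (foldr partial js f) \<and>
        (\<forall>x\<in>RR d. \<forall>j<d. (\<lambda>h. foldr partial js f (x(j := h))) differentiable at (x j)))"

text \<open>\<open>C\<^sup>\<infinity>\<close> functions on the torus, as smooth functions on \<open>\<real>\<^sup>d\<close> that are \<open>2\<pi>\<close>-periodic in each
  coordinate.\<close>

definition smooth_periodic :: "nat \<Rightarrow> ((nat \<Rightarrow> real) \<Rightarrow> real) \<Rightarrow> bool" where
  "smooth_periodic d f \<longleftrightarrow>
     smooth_on_RR d f \<and> (\<forall>x\<in>RR d. \<forall>j<d. f (x(j := x j + 2 * pi)) = f x)"

text \<open>
  Weak solutions in \<open>C([0,\<infinity>); L\<^sup>2)\<close> of
  \<open>\<partial>\<^sub>t \<eta> + V(t) \<cdot> \<nabla>\<eta> = \<nu> \<Delta>\<eta>\<close>, \<open>\<eta>(0) = \<eta>\<^sub>0\<close>: the equation is multiplied by a smooth \<open>\<phi>\<close>,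
  integrated over the torus and over \<open>[0,t]\<close>, and all space derivatives are moved onto the test
  function, which gives \<open>\<integral> \<eta> (div (V \<phi>) + \<nu> \<Delta>\<phi>)\<close> on the right-hand side.
  Only the values of \<open>\<eta>\<close> at times \<open>t \<ge> 0\<close> matter.
\<close>

definition passive_scalar_solution ::
  "nat \<Rightarrow> real \<Rightarrow> (real \<Rightarrow> (nat \<Rightarrow> real) \<Rightarrow> nat \<Rightarrow> real) \<Rightarrow> ((nat \<Rightarrow> real) \<Rightarrow> real) \<Rightarrow>
   (real \<Rightarrow> (nat \<Rightarrow> real) \<Rightarrow> real) \<Rightarrow> bool" where
  "passive_scalar_solution d \<nu> V \<eta>0 \<eta> \<longleftrightarrow>
     (\<forall>t\<ge>0. \<eta> t \<in> L2 d) \<and>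
     (\<forall>s\<ge>0. ((\<lambda>t. L2_norm d (\<lambda>x. \<eta> t x - \<eta> s x)) \<longlongrightarrow> 0) (at s within {0..})) \<and>
     (AE x in torus d. \<eta> 0 x = \<eta>0 x) \<and>
     (\<forall>\<phi>. smooth_periodic d \<phi> \<longrightarrow> (\<forall>t\<ge>0.
        ((\<lambda>s. \<integral>x. \<eta> s x * ((\<Sum>j<d. partial j (\<lambda>y. V s y j * \<phi> y) x) + \<nu> * laplacian d \<phi> x)
            \<partial>torus d)
         has_integral ((\<integral>x. \<eta> t x * \<phi> x \<partial>torus d) - (\<integral>x. \<eta>0 x * \<phi> x \<partial>torus d))) {0..t}))"

definition basis_vec :: "nat \<Rightarrow> nat \<Rightarrow> real" where
  "basis_vec j i = (if i = j then 1 else 0)"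

definition u1 :: "nat \<Rightarrow> (nat \<Rightarrow> real) \<Rightarrow> nat \<Rightarrow> real" where
  "u1 n x i = (\<Sum>j<n. sin (x (n + j)) * basis_vec j i)"

definition u2 :: "nat \<Rightarrow> (nat \<Rightarrow> real) \<Rightarrow> nat \<Rightarrow> real" where
  "u2 n x i = (\<Sum>j<n. sin (x j) * basis_vec (n + j) i)"

definition velocity ::
  "nat \<Rightarrow> (real \<Rightarrow> real) \<Rightarrow> (real \<Rightarrow> real) \<Rightarrow> real \<Rightarrow> (nat \<Rightarrow> real) \<Rightarrow> nat \<Rightarrow> real" where
  "velocity n \<Phi>1 \<Phi>2 t x i = \<Phi>1 t * u1 n x i + \<Phi>2 t * u2 n x i"

text \<open>Smoothness on \<open>[0,\<infinity>)\<close>, one-sided at 0; \<open>D k\<close> is the \<open>k\<close>-th derivative.\<close>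

definition smooth_on_halfline :: "(real \<Rightarrow> real) \<Rightarrow> bool" where
  "smooth_on_halfline f \<longleftrightarrow>
     (\<exists>D :: nat \<Rightarrow> real \<Rightarrow> real. D 0 = f \<and>
        (\<forall>k. \<forall>t\<ge>0. (D k has_real_derivative D (Suc k) t) (at t within {0..})))"

definition vary_on_time_scale ::
  "real \<Rightarrow> real \<Rightarrow> (real \<Rightarrow> real) \<Rightarrow> (real \<Rightarrow> real) \<Rightarrow> bool" where
  "vary_on_time_scale \<delta> \<nu> \<Phi>1 \<Phi>2 \<longleftrightarrow>
     (let \<tau> = 1 / (\<delta> * sqrt \<nu>) in
        smooth_on_halfline \<Phi>1 \<and> smooth_on_halfline \<Phi>2 \<and>
        (\<forall>t\<ge>0. \<Phi>1 t \<in> {0..1} \<and> \<Phi>2 t \<in> {0..1}) \<and>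
        (\<forall>t\<ge>0. t \<notin> (\<Union>k::nat. {\<tau> * (6 * real k) <..< \<tau> * (6 * real k + 3)}) \<longrightarrow> \<Phi>1 t = 0) \<and>
        (\<forall>k::nat. \<forall>t\<in>{\<tau> * (6 * real k + 1) .. \<tau> * (6 * real k + 2)}. \<Phi>1 t = 1) \<and>
        (\<forall>k::nat. \<forall>I\<in>{{\<tau> * (6 * real k) .. \<tau> * (6 * real k + 1)},
                       {\<tau> * (6 * real k + 2) .. \<tau> * (6 * real k + 3)}}.
           mono_on I \<Phi>1 \<or> antimono_on I \<Phi>1) \<and>
        (\<forall>t\<ge>0. t \<notin> (\<Union>k::nat. {\<tau> * (6 * real k + 3) <..< \<tau> * (6 * real k + 6)}) \<longrightarrow> \<Phi>2 t = 0) \<and>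
        (\<forall>k::nat. \<forall>t\<in>{\<tau> * (6 * real k + 4) .. \<tau> * (6 * real k + 5)}. \<Phi>2 t = 1))"

end

theory Submission
  imports Defs "HOL-Computational_Algebra.Polynomial" "HOL-Library.Function_Algebras"
begin

text \<open>
  On the Fourier side a shear turns the equation into nearest-neighbour transport: while only
  \<open>u\<^sub>1\<close> is active the frequencies \<open>m\<^sub>1, \<dots>, m\<^sub>n\<close> are frozen, and on each slice with these
  frequencies fixed the transport operator is bounded and antisymmetric, so the energy decreases by
  dissipation alone.  On a slice with some \<open>m\<^sub>j \<noteq> 0\<close> consider the correlations
  \<open>\<Sum>\<^sub>l sin ((2 z + q) h) a\<^sub>l a\<^sub>l\<^sub>+\<^sub>q\<close> along the direction \<open>z = m\<^sub>n\<^sub>+\<^sub>j\<close>, summed over odd \<open>q\<close> with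
  alternating Fejer weights up to range \<open>1 / h\<close>.  Their transport derivative is \<open>m\<^sub>j sin h\<close> times
  the energy, up to terms controlled by the dissipation when \<open>h\<close> is a small multiple of
  \<open>\<nu>\<^sup>1\<^sup>/\<^sup>4\<close>, whereas the correlations themselves are at most the energy times \<open>1 / h\<close>.  Hence a
  plateau of length a large multiple of \<open>\<nu>\<^sup>-\<^sup>1\<^sup>/\<^sup>2\<close> quarters the energy of these slices, uniformly in
  \<open>m\<close> and \<open>n\<close>.  Modes at rest in one phase move in the other, so every period halves the energy of
  the nonzero modes, and Parseval's identity carries this over to \<open>L\<^sup>2\<close>.
\<close>

section \<open>Smooth alternating cutoffs\<close>

text \<open>View a slice as a function f(y) of the position dual to z. The shear rotates f(y) with a
  speed containing m_j sin y, so the product of f(y + h) with the conjugate of f(y - h) rotates with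
  speed 2 m_j sin h cos y; the correlations are imaginary parts of its Fourier coefficients. A
  single odd q is not enough: cos y changes sign and vanishes at the critical points of the shear.
  The alternating sum over odd q is a Fejer regularisation of 1 / (2 cos y), which cancels this
  factor up to a small average. In time T the mixing gains h T against correlations of size 1 / h,
  which asks for T of order h^-2, and dissipation spoils h^2 / \<nu> of that time, which ties h to
  the fourth root of \<nu>. The obstacle to a direct computation is that the dissipation rates are
  unbounded on the lattice, so infinite sums cannot simply be differentiated in time. All identities
  are integrated in time over finite truncations, where only a boundary flux is lost; it tends to 0
  by dominated convergence. The sine profile gives the coupling real coefficients, so cosine and
  sine coefficients of the solution obey two separate copies of one real system.\<close>

definition flat_exp :: "real poly \<Rightarrow> real \<Rightarrow> real" where
  "flat_exp p x = (if 0 < x then poly p (1 / x) * exp (- 1 / x) else 0)"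

lemma poly_times_exp_minus_tendsto_0:
  "((\<lambda>u::real. poly p u * exp (- u)) \<longlongrightarrow> 0) at_top"
proof -
  have "((\<lambda>u::real. coeff p i * (u ^ i / exp u)) \<longlongrightarrow> coeff p i * 0) at_top" for i
    by (intro tendsto_intros tendsto_power_div_exp_0)
  then have "((\<lambda>u::real. \<Sum>i\<le>degree p. coeff p i * (u ^ i / exp u)) \<longlongrightarrow> (\<Sum>i\<le>degree p. coeff p i * 0)) at_top"
    by (intro tendsto_sum)
  then show ?thesis
    by (simp add: poly_altdef sum_distrib_right exp_minus divide_inverse mult.assoc)
qed

text \<open>With u = 1 / x the derivative of p(u) exp(-u) in x is u^2 (p(u) - p'(u)) exp(-u), so the
  polynomial parameter closes the family under differentiation. At 0 the exponential beats every
  polynomial in u, and one formula serves on the whole line.\<close>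

lemma has_real_derivative_flat_exp:
  "(flat_exp p has_real_derivative flat_exp ([:0, 0, 1:] * (p - pderiv p)) x) (at x)"
proof -
  consider "x > 0" | "x < 0" | "x = 0" by linarith
  then show ?thesis
  proof cases
    case 1
    have "((\<lambda>x. poly p (1 / x) * exp (- 1 / x)) has_real_derivative
        flat_exp ([:0, 0, 1:] * (p - pderiv p)) x) (at x)"
      using 1 unfolding flat_exp_def
      by (auto intro!: derivative_eq_intros DERIV_chain2[OF poly_DERIV] simp: field_simps power2_eq_square)
    moreover have "\<forall>\<^sub>F y in nhds x. flat_exp p y = poly p (1 / y) * exp (- 1 / y)"
      using eventually_nhds_in_open[of "{0<..}" x] 1
      by (auto simp: flat_exp_def elim!: eventually_mono)
    ultimately show ?thesis
      by (subst DERIV_cong_ev[OF refl _ refl])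
  next
    case 2
    have "\<forall>\<^sub>F y in nhds x. flat_exp p y = 0"
      using eventually_nhds_in_open[of "{..<0}" x] 2
      by (auto simp: flat_exp_def elim!: eventually_mono)
    then show ?thesis
      using 2 by (subst DERIV_cong_ev[OF refl _ refl]) (auto simp: flat_exp_def)
  next
    case 3
    have "((\<lambda>h. flat_exp p h / h) \<longlongrightarrow> 0) (at_right 0)"
    proof -
      \<comment> \<open>Dividing by h multiplies the polynomial in 1 / h by its variable, hence
        \<open>pCons 0 p\<close>.\<close>
      have "((\<lambda>h::real. poly (pCons 0 p) (inverse h) * exp (- inverse h)) \<longlongrightarrow> 0) (at_right 0)"
        by (rule filterlim_compose[OF poly_times_exp_minus_tendsto_0 filterlim_inverse_at_top_right])
      then show ?thesis
        by (rule Lim_transform_eventually)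
          (auto simp: flat_exp_def eventually_at_filter field_simps)
    qed
    moreover have "((\<lambda>h. flat_exp p h / h) \<longlongrightarrow> 0) (at_left 0)"
      by (rule Lim_transform_eventually[OF tendsto_const])
        (auto simp: flat_exp_def eventually_at_filter)
    ultimately have "((\<lambda>h. flat_exp p h / h) \<longlongrightarrow> 0) (at 0)"
      by (simp add: filterlim_split_at)
    then show ?thesis
      using 3 by (simp add: DERIV_def flat_exp_def)
  qed
qed

lemmas has_real_derivative_flat_exp_compose = DERIV_chain2[OF has_real_derivative_flat_exp]

text \<open>Let v(x) be \<open>exp 1 * flat_exp 1 x\<close>, which is 0 for x <= 0 and normalised by
  v(1) = 1; the step is 1 - v(1 - v(x)). Composition replaces the usual quotient of flat functions:
  once v(x) reaches 1, the argument of the outer v is at most 0 and the outer v vanishes.\<close>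

definition smooth_step :: "real \<Rightarrow> real" where
  "smooth_step x = 1 - exp 1 * flat_exp 1 (1 - exp 1 * flat_exp 1 x)"

lemma exp_1_flat_exp: "exp 1 * flat_exp 1 x = (if 0 < x then exp (1 - 1 / x) else 0)"
  by (simp add: flat_exp_def flip: exp_add)

lemma mono_flat_exp: "x \<le> y \<Longrightarrow> exp 1 * flat_exp 1 x \<le> exp 1 * flat_exp 1 y"
  unfolding exp_1_flat_exp by (auto simp: frac_le)

lemma mono_smooth_step: "mono smooth_step"
proof (rule monoI)
  fix x y :: real assume "x \<le> y"
  then have "1 - exp 1 * flat_exp 1 y \<le> 1 - exp 1 * flat_exp 1 x"
    using mono_flat_exp by simp
  from mono_flat_exp[OF this] show "smooth_step x \<le> smooth_step y"
    by (simp add: smooth_step_def)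
qed

lemma smooth_step_eq_0: "x \<le> 0 \<Longrightarrow> smooth_step x = 0"
  by (simp add: smooth_step_def exp_1_flat_exp)

lemma smooth_step_eq_1: "1 \<le> x \<Longrightarrow> smooth_step x = 1"
  by (simp add: smooth_step_def exp_1_flat_exp)

lemma smooth_step_bounds: "0 \<le> smooth_step x" "smooth_step x \<le> 1"
  using monoD[OF mono_smooth_step, of "min x 0" x] monoD[OF mono_smooth_step, of x "max x 1"]
  by (auto simp: smooth_step_eq_0 smooth_step_eq_1)

text \<open>An algebra closed under differentiation that contains \<open>smooth_step (c * sin (w * t))\<close>;
  this gives all derivatives at once.\<close>

inductive_set step_sin_algebra :: "real \<Rightarrow> real \<Rightarrow> (real \<Rightarrow> real) set" for c w where
  const: "(\<lambda>t. r) \<in> step_sin_algebra c w"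
| sin: "(\<lambda>t. sin (w * t)) \<in> step_sin_algebra c w"
| cos: "(\<lambda>t. cos (w * t)) \<in> step_sin_algebra c w"
| inner: "(\<lambda>t. flat_exp p (c * sin (w * t))) \<in> step_sin_algebra c w"
| outer: "(\<lambda>t. flat_exp p (1 - exp 1 * flat_exp 1 (c * sin (w * t)))) \<in> step_sin_algebra c w"
| add: "f \<in> step_sin_algebra c w \<Longrightarrow> g \<in> step_sin_algebra c w \<Longrightarrow> (\<lambda>t. f t + g t) \<in> step_sin_algebra c w"
| mult: "f \<in> step_sin_algebra c w \<Longrightarrow> g \<in> step_sin_algebra c w \<Longrightarrow> (\<lambda>t. f t * g t) \<in> step_sin_algebra c w"

lemma step_sin_algebra_derivative:
  assumes "f \<in> step_sin_algebra c w"
  shows "\<exists>f'\<in>step_sin_algebra c w. \<forall>t. (f has_real_derivative f' t) (at t)"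
  using assms
proof induction
  case (const r)
  show ?case by (rule bexI[OF _ step_sin_algebra.const[of 0]]) auto
next
  case sin
  have "(\<lambda>t. w * cos (w * t)) \<in> step_sin_algebra c w"
    by (intro step_sin_algebra.intros)
  then show ?case by (rule bexI[rotated]) (auto intro!: derivative_eq_intros)
next
  case cos
  have "(\<lambda>t. - w * sin (w * t)) \<in> step_sin_algebra c w"
    by (intro step_sin_algebra.intros)
  then show ?case by (rule bexI[rotated]) (auto intro!: derivative_eq_intros)
next
  case (inner p)
  have "(\<lambda>t. flat_exp ([:0, 0, 1:] * (p - pderiv p)) (c * sin (w * t)) * (c * w * cos (w * t)))
      \<in> step_sin_algebra c w"
    by (intro step_sin_algebra.intros)
  then show ?case
    by (rule bexI[rotated])
      (auto simp del: mult_pCons_left intro!: has_real_derivative_flat_exp_compose derivative_eq_intros)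
next
  case (outer p)
  let ?v' = "\<lambda>t. flat_exp ([:0, 0, 1:] * (1 - pderiv 1)) (c * sin (w * t)) * (c * w * cos (w * t))"
  let ?f' = "\<lambda>t. flat_exp ([:0, 0, 1:] * (p - pderiv p)) (1 - exp 1 * flat_exp 1 (c * sin (w * t))) *
      (- exp 1 * ?v' t)"
  have "((\<lambda>t. flat_exp 1 (c * sin (w * t))) has_real_derivative ?v' t) (at t)" for t
    by (rule has_real_derivative_flat_exp_compose) (auto intro!: derivative_eq_intros)
  from DERIV_diff[OF DERIV_const DERIV_cmult[OF this]]
  have "((\<lambda>t. 1 - exp 1 * flat_exp 1 (c * sin (w * t))) has_real_derivative - exp 1 * ?v' t) (at t)" for t
    by (rule DERIV_cong) (simp only: diff_0 mult_minus_left)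
  then have "((\<lambda>t. flat_exp p (1 - exp 1 * flat_exp 1 (c * sin (w * t)))) has_real_derivative ?f' t) (at t)" for t
    by (rule has_real_derivative_flat_exp_compose)
  moreover have "?f' \<in> step_sin_algebra c w"
    by (intro step_sin_algebra.intros)
  ultimately show ?case by (intro bexI[of _ ?f'] allI)
next
  case (add f g)
  then obtain f' g' where "f' \<in> step_sin_algebra c w" "g' \<in> step_sin_algebra c w"
    "\<forall>t. (f has_real_derivative f' t) (at t)" "\<forall>t. (g has_real_derivative g' t) (at t)"
    by blast
  then show ?case
    by (intro bexI[of _ "\<lambda>t. f' t + g' t"]) (auto intro!: derivative_intros step_sin_algebra.intros)
next
  case (mult f g)
  then obtain f' g' where "f' \<in> step_sin_algebra c w" "g' \<in> step_sin_algebra c w"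
    "\<forall>t. (f has_real_derivative f' t) (at t)" "\<forall>t. (g has_real_derivative g' t) (at t)"
    by blast
  with mult.hyps show ?case
    by (intro bexI[of _ "\<lambda>t. f' t * g t + g' t * f t"])
      (auto intro!: derivative_eq_intros step_sin_algebra.intros)
qed

lemma smooth_on_halfline_step_sin_algebra:
  assumes "f \<in> step_sin_algebra c w"
  shows "smooth_on_halfline f"
proof -
  \<comment> \<open>A choice of derivative that stays inside the algebra; its iterates are the
    higher derivatives.\<close>
  obtain d where d: "\<And>g. g \<in> step_sin_algebra c w \<Longrightarrow>
      d g \<in> step_sin_algebra c w \<and> (\<forall>t. (g has_real_derivative d g t) (at t))"
    using step_sin_algebra_derivative[of _ c w] by metis
  have "(d ^^ k) f \<in> step_sin_algebra c w" for k
    using assms d by (induction k) auto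
  then show ?thesis
    unfolding smooth_on_halfline_def using d
    by (intro exI[of _ "\<lambda>k. (d ^^ k) f"]) (auto intro: has_field_derivative_at_within)
qed

lemma smooth_on_halfline_smooth_step_sin: "smooth_on_halfline (\<lambda>t. smooth_step (c * sin (w * t)))"
proof -
  have "(\<lambda>t. 1 + (- exp 1) * flat_exp 1 (1 - exp 1 * flat_exp 1 (c * sin (w * t)))) \<in> step_sin_algebra c w"
    by (intro step_sin_algebra.intros)
  then show ?thesis
    unfolding smooth_step_def using smooth_on_halfline_step_sin_algebra by (simp add: algebra_simps)
qed

section \<open>The periodic schedule of the two amplitudes\<close>

lemma sin_periodic_6: "sin (pi / (3 * \<tau>) * (\<tau> * (6 * real k + r))) = sin (pi / 3 * r)" if "\<tau> \<noteq> 0"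
proof -
  have "pi / (3 * \<tau>) * (\<tau> * (6 * real k + r)) = pi / 3 * r + 2 * pi * real k"
    using that by (simp add: field_simps)
  then show ?thesis
    using sin.plus_of_nat[of "pi / 3 * r" k] by (simp add: mult.commute mult.left_commute)
qed

lemma two_over_sqrt_3_sin:
  assumes "1 \<le> r" "r \<le> (2::real)"
  shows "1 \<le> 2 / sqrt 3 * sin (pi / 3 * r)"
proof -
  have "sqrt 3 / 2 \<le> sin (pi / 3 * r)"
  \<comment> \<open>The sine peaks at r = 3 / 2; beyond it the reflection x to pi - x returns to the
    increasing branch.\<close>
  proof (cases "r \<le> 3 / 2")
    case True
    then have "sin (pi / 3) \<le> sin (pi / 3 * r)"
      using assms pi_gt_zero order_trans[of "- (pi / 2)" 0 "pi / 3 * r"]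
      by (subst sin_mono_le_eq) (auto simp: field_simps)
    then show ?thesis by (simp add: sin_60)
  next
    case False
    then have "sin (pi / 3) \<le> sin (pi - pi / 3 * r)"
      using assms pi_gt_zero by (subst sin_mono_le_eq) (auto simp: field_simps)
    then show ?thesis by (simp add: sin_60)
  qed
  then show ?thesis by (simp add: field_simps)
qed

text \<open>\<open>smooth_step (2 / sqrt 3 * sin x)\<close> is \<open>1\<close> exactly where \<open>sin x \<ge> sqrt 3 / 2\<close>, which is the middle
  third of the half-period on which the sine is positive.\<close>

lemma vary_on_time_scale_exists:
  assumes "0 < \<delta>" "0 < \<nu>"
  obtains \<Phi>1 \<Phi>2 where "vary_on_time_scale \<delta> \<nu> \<Phi>1 \<Phi>2"
proof -
  define \<tau> where "\<tau> = 1 / (\<delta> * sqrt \<nu>)"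
  \<comment> \<open>With this frequency the sine has period 6 \<tau> and is positive on the first
    half of it; the opposite sign of the amplitude gives \<open>\<Phi>2\<close> the second
    half.\<close>
  define w where "w = pi / (3 * \<tau>)"
  define c :: real where "c = 2 / sqrt 3"
  define \<Phi>1 where "\<Phi>1 = (\<lambda>t. smooth_step (c * sin (w * t)))"
  define \<Phi>2 where "\<Phi>2 = (\<lambda>t. smooth_step (- c * sin (w * t)))"
  have \<tau>: "\<tau> > 0" using assms by (simp add: \<tau>_def)
  have c: "c > 0" by (simp add: c_def)
  have w_eq: "sin (w * (\<tau> * (6 * real k + r))) = sin (pi / 3 * r)" for k r
    unfolding w_def using \<tau> by (intro sin_periodic_6) simp
  have locate: "\<exists>k::nat. \<exists>r. 0 \<le> r \<and> r < 6 \<and> t = \<tau> * (6 * real k + r)" if "t \<ge> 0" for t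
  proof -
    define q where "q = t / \<tau> / 6"
    have "0 \<le> q" "t = \<tau> * (6 * q)" using that \<tau> by (simp_all add: q_def)
    moreover have "real (nat \<lfloor>q\<rfloor>) \<le> q" "q < real (nat \<lfloor>q\<rfloor>) + 1"
      using \<open>0 \<le> q\<close> by linarith+
    ultimately show ?thesis
      by (intro exI[of _ "nat \<lfloor>q\<rfloor>"] exI[of _ "6 * (q - real (nat \<lfloor>q\<rfloor>))"]) (auto simp: algebra_simps)
  qed
  have shift: "\<exists>r. t = \<tau> * (6 * real k + r) \<and> u \<le> r \<and> r \<le> v"
    if "t \<in> {\<tau> * (6 * real k + u)..\<tau> * (6 * real k + v)}" for t k u v
  proof (intro exI conjI)
    show eq: "t = \<tau> * (6 * real k + (t / \<tau> - 6 * real k))" using \<tau> by simp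
    show "u \<le> t / \<tau> - 6 * real k" "t / \<tau> - 6 * real k \<le> v"
      using that \<tau> by (auto simp: field_simps)
  qed
  have "vary_on_time_scale \<delta> \<nu> \<Phi>1 \<Phi>2"
    unfolding vary_on_time_scale_def Let_def \<tau>_def[symmetric]
  proof (intro conjI allI ballI impI)
    show "smooth_on_halfline \<Phi>1" "smooth_on_halfline \<Phi>2"
      unfolding \<Phi>1_def \<Phi>2_def by (rule smooth_on_halfline_smooth_step_sin)+
  next
    fix t :: real show "\<Phi>1 t \<in> {0..1}" "\<Phi>2 t \<in> {0..1}"
      by (auto simp: \<Phi>1_def \<Phi>2_def smooth_step_bounds)
  next
    fix t :: real assume t: "0 \<le> t" "t \<notin> (\<Union>k::nat. {\<tau> * (6 * real k) <..< \<tau> * (6 * real k + 3)})"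
    obtain k r where r: "0 \<le> r" "r < 6" "t = \<tau> * (6 * real k + r)" using locate t by blast
    have "r = 0 \<or> 3 \<le> r"
      using t(2) r \<tau> by (auto simp: not_less dest: spec[of _ k])
    then have "sin (pi / 3 * r) \<le> 0"
    proof
      assume "3 \<le> r"
      then show ?thesis using r pi_gt_zero by (intro sin_le_zero) (auto simp: field_simps)
    qed simp
    then show "\<Phi>1 t = 0"
      using c by (auto simp: \<Phi>1_def r w_eq mult_nonneg_nonpos intro!: smooth_step_eq_0)
  next
    fix t :: real assume t: "0 \<le> t" "t \<notin> (\<Union>k::nat. {\<tau> * (6 * real k + 3) <..< \<tau> * (6 * real k + 6)})"
    obtain k r where r: "0 \<le> r" "r < 6" "t = \<tau> * (6 * real k + r)" using locate t by blast
    have "r \<le> 3"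
      using t(2) r \<tau> by (auto simp: not_less dest: spec[of _ k])
    then have "0 \<le> sin (pi / 3 * r)"
      using r pi_gt_zero by (intro sin_ge_zero) (auto simp: field_simps)
    then show "\<Phi>2 t = 0"
      using c by (auto simp: \<Phi>2_def r w_eq intro!: smooth_step_eq_0)
  next
    fix k :: nat and t assume "t \<in> {\<tau> * (6 * real k + 1) .. \<tau> * (6 * real k + 2)}"
    from shift[OF this] obtain r where "t = \<tau> * (6 * real k + r)" "1 \<le> r" "r \<le> 2" by blast
    then show "\<Phi>1 t = 1"
      using two_over_sqrt_3_sin[of r] by (auto simp: \<Phi>1_def w_eq c_def intro!: smooth_step_eq_1)
  next
    fix k :: nat and t assume "t \<in> {\<tau> * (6 * real k + 4) .. \<tau> * (6 * real k + 5)}"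
    from shift[OF this] obtain r where r: "t = \<tau> * (6 * real k + r)" "4 \<le> r" "r \<le> 5" by blast
    have "sin (pi / 3 * r) = - sin (pi / 3 * (r - 3))"
      by (simp add: right_diff_distrib sin_diff)
    then show "\<Phi>2 t = 1"
      using two_over_sqrt_3_sin[of "r - 3"] r by (auto simp: \<Phi>2_def w_eq c_def intro!: smooth_step_eq_1)
  next
    fix k :: nat and I
    assume "I \<in> {{\<tau> * (6 * real k) .. \<tau> * (6 * real k + 1)}, {\<tau> * (6 * real k + 2) .. \<tau> * (6 * real k + 3)}}"
    \<comment> \<open>The summand 0 brings the first interval into the form that
      \<open>shift\<close> expects.\<close>
    then consider "I = {\<tau> * (6 * real k + 0) .. \<tau> * (6 * real k + 1)}"
      | "I = {\<tau> * (6 * real k + 2) .. \<tau> * (6 * real k + 3)}" by auto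
    then show "mono_on I \<Phi>1 \<or> antimono_on I \<Phi>1"
    proof cases
      case 1
      have "mono_on I \<Phi>1"
      proof (rule mono_onI)
        fix s t assume st: "s \<in> I" "t \<in> I" "s \<le> t"
        obtain r q where r: "s = \<tau> * (6 * real k + r)" "0 \<le> r" "r \<le> 1"
          and q: "t = \<tau> * (6 * real k + q)" "0 \<le> q" "q \<le> 1"
          using st shift 1 by metis
        have "r \<le> q" using st(3) r q \<tau> by simp
        then have "sin (pi / 3 * r) \<le> sin (pi / 3 * q)"
          using r q pi_gt_zero order_trans[of "- (pi / 2)" 0 "pi / 3 * r"] order_trans[of "- (pi / 2)" 0 "pi / 3 * q"]
          by (subst sin_mono_le_eq) (auto simp: field_simps)
        then show "\<Phi>1 s \<le> \<Phi>1 t"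
          using c by (auto simp: \<Phi>1_def r q w_eq intro!: monoD[OF mono_smooth_step])
      qed
      then show ?thesis ..
    next
      case 2
      have "antimono_on I \<Phi>1"
      proof (rule monotone_onI)
        fix s t assume st: "s \<in> I" "t \<in> I" "s \<le> t"
        obtain r q where r: "s = \<tau> * (6 * real k + r)" "2 \<le> r" "r \<le> 3"
          and q: "t = \<tau> * (6 * real k + q)" "2 \<le> q" "q \<le> 3"
          using st shift 2 by metis
        have "r \<le> q" using st(3) r q \<tau> by simp
        then have "sin (pi - pi / 3 * q) \<le> sin (pi - pi / 3 * r)"
          using r q pi_gt_zero by (subst sin_mono_le_eq) (auto simp: field_simps)
        then show "\<Phi>1 t \<le> \<Phi>1 s"
          using c by (auto simp: \<Phi>1_def r q w_eq intro!: monoD[OF mono_smooth_step])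
      qed
      then show ?thesis ..
    qed
  qed
  then show ?thesis by (rule that)
qed

lemma smooth_on_halfline_continuous: "smooth_on_halfline f \<Longrightarrow> continuous_on {0..} f"
  unfolding smooth_on_halfline_def by (metis DERIV_continuous_on atLeast_iff)

section \<open>Transport with dissipation on a lattice\<close>

lemma countable_exhaustion:
  assumes "countable A"
  obtains F :: "nat \<Rightarrow> 'a set" where "\<And>N. finite (F N)" "\<And>N. F N \<subseteq> A"
    "filterlim F (finite_subsets_at_top A) sequentially"
proof
  define F where "F N = {x \<in> A. to_nat_on A x < N}" for N
  show fin: "finite (F N)" for N
  proof (rule finite_imageD)
    show "finite (to_nat_on A ` F N)" by (rule finite_subset[of _ "{..<N}"]) (auto simp: F_def)
    show "inj_on (to_nat_on A) (F N)"
      using inj_on_to_nat_on[OF assms] by (rule inj_on_subset) (auto simp: F_def)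
  qed
  show sub: "F N \<subseteq> A" for N by (auto simp: F_def)
  show "filterlim F (finite_subsets_at_top A) sequentially"
    unfolding filterlim_finite_subsets_at_top
  proof (intro allI impI)
    fix X assume X: "finite X \<and> X \<subseteq> A"
    then have "X \<subseteq> F N" if "N > Max (insert 0 (to_nat_on A ` X))" for N
      using that by (auto simp: F_def)
    then show "\<forall>\<^sub>F N in sequentially. finite (F N) \<and> X \<subseteq> F N \<and> F N \<subseteq> A"
      using fin sub by (auto intro!: eventually_mono[OF eventually_gt_at_top])
  qed
qed

lemma has_sum_diff:
  fixes f g :: "'a \<Rightarrow> real"
  assumes "(f has_sum x) A" "(g has_sum y) A"
  shows "((\<lambda>l. f l - g l) has_sum (x - y)) A"
  using has_sum_add[OF assms(1) has_sum_uminusI[OF assms(2)]] by simp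

lemma has_sum_sum:
  fixes f :: "'b \<Rightarrow> 'a \<Rightarrow> real"
  assumes "\<And>i. i \<in> I \<Longrightarrow> (f i has_sum s i) A"
  shows "((\<lambda>l. \<Sum>i\<in>I. f i l) has_sum (\<Sum>i\<in>I. s i)) A"
  using assms by (induction I rule: infinite_finite_induct) (auto intro: has_sum_add)

text \<open>Infinite sums are limits along the net of finite subsets, whereas dominated convergence
  needs sequences; an exhaustion from \<open>countable_exhaustion\<close> translates one into the
  other.\<close>

lemma has_sum_imp_LIMSEQ:
  assumes "(f has_sum s) A" "filterlim F (finite_subsets_at_top A) sequentially"
  shows "(\<lambda>N. sum f (F N)) \<longlonglongrightarrow> s"
  using assms unfolding has_sum_def by (rule filterlim_compose)

text \<open>Truncation errors tend to 0 only pointwise in time; a bound uniform in N carries this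
  over to their time integrals.\<close>

lemma integral_LIMSEQ_0:
  fixes R :: "nat \<Rightarrow> real \<Rightarrow> real"
  assumes "\<And>N. continuous_on {s..t} (R N)"
    and "\<And>N r. r \<in> {s..t} \<Longrightarrow> \<bar>R N r\<bar> \<le> C"
    and "\<And>r. r \<in> {s..t} \<Longrightarrow> (\<lambda>N. R N r) \<longlonglongrightarrow> 0"
  shows "(\<lambda>N. integral {s..t} (R N)) \<longlonglongrightarrow> 0"
  using dominated_convergence(2)[of R "{s..t}" "\<lambda>_. C" "\<lambda>_. 0"] assms
  by (auto intro: integrable_continuous_real)

section \<open>Translations that preserve an index set\<close>

definition periods :: "'i::ab_group_add set \<Rightarrow> 'i set" where
  "periods \<Lambda> = {v. \<forall>l. l + v \<in> \<Lambda> \<longleftrightarrow> l \<in> \<Lambda>}"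

lemma periodsD: "v \<in> periods \<Lambda> \<Longrightarrow> l + v \<in> \<Lambda> \<longleftrightarrow> l \<in> \<Lambda>"
  by (simp add: periods_def)

lemma zero_in_periods [simp]: "0 \<in> periods \<Lambda>"
  by (simp add: periods_def)

lemma add_in_periods: "u \<in> periods \<Lambda> \<Longrightarrow> v \<in> periods \<Lambda> \<Longrightarrow> u + v \<in> periods \<Lambda>"
  by (simp add: periods_def flip: add.assoc)

lemma uminus_in_periods: "v \<in> periods \<Lambda> \<Longrightarrow> - v \<in> periods \<Lambda>"
  using periodsD[of v \<Lambda> "_ + - v"] by (auto simp: periods_def)

lemma bij_betw_periods:
  assumes "v \<in> periods \<Lambda>"
  shows "bij_betw (\<lambda>l. l + v) \<Lambda> \<Lambda>"
  using periodsD[OF assms] periodsD[OF uminus_in_periods[OF assms]]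
  by (intro bij_betwI[where g = "\<lambda>l. l - v"]) auto

lemma has_sum_shift:
  assumes "v \<in> periods \<Lambda>"
  shows "((\<lambda>l. f (l + v)) has_sum S) \<Lambda> \<longleftrightarrow> (f has_sum S) \<Lambda>"
  by (rule has_sum_reindex_bij_betw[OF bij_betw_periods[OF assms]])

lemma sum_shift:
  fixes v :: "'i::ab_group_add"
  shows "(\<Sum>l\<in>H. f (l + v)) = (\<Sum>l\<in>(\<lambda>l. l + v) ` H. f l)"
  by (subst sum.reindex) (auto simp: inj_on_def)

lemma sum_shift_le:
  fixes f :: "'i::ab_group_add \<Rightarrow> real"
  assumes "v \<in> periods \<Lambda>" "H \<subseteq> \<Lambda>" "finite H"
    and "\<And>H. finite H \<Longrightarrow> H \<subseteq> \<Lambda> \<Longrightarrow> sum f H \<le> K"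
  shows "(\<Sum>l\<in>H. f (l + v)) \<le> K"
  unfolding sum_shift using assms periodsD[OF assms(1)] by (intro assms(4)) auto

lemma abs_mult_le_sum_squares: "\<bar>x * y\<bar> \<le> (x\<^sup>2 + y\<^sup>2) / (2::real)"
proof -
  have "0 \<le> (\<bar>x\<bar> - \<bar>y\<bar>)\<^sup>2" by simp
  then show ?thesis by (simp add: power2_diff abs_mult)
qed

text \<open>Square summability is invariant under shifts, and a product is dominated by the two
  squares. The bounded weights \<open>c\<close> will be sines and cosines of the phase.\<close>

lemma summable_on_shift_product:
  fixes x :: "'i::ab_group_add \<Rightarrow> real"
  assumes x: "(\<lambda>l. (x l)\<^sup>2) summable_on \<Lambda>" and uv: "u \<in> periods \<Lambda>" "v \<in> periods \<Lambda>"
    and c: "\<And>l. \<bar>c l\<bar> \<le> 1"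
  shows "(\<lambda>l. c l * (x (l + u) * x (l + v))) summable_on \<Lambda>"
proof (rule abs_summable_summable, rule summable_on_comparison_test)
  have "(\<lambda>l. (x (l + w))\<^sup>2) summable_on \<Lambda>" if "w \<in> periods \<Lambda>" for w
    using has_sum_shift[OF that, of "\<lambda>l. (x l)\<^sup>2"] x by (auto simp: summable_on_def)
  then show "(\<lambda>l. (x (l + u))\<^sup>2 + (x (l + v))\<^sup>2) summable_on \<Lambda>"
    using uv by (intro summable_on_add)
  fix l
  have "\<bar>c l\<bar> * \<bar>x (l + u) * x (l + v)\<bar> \<le> 1 * \<bar>x (l + u) * x (l + v)\<bar>"
    by (intro mult_right_mono c) auto
  also have "\<dots> \<le> ((x (l + u))\<^sup>2 + (x (l + v))\<^sup>2) / 2"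
    using abs_mult_le_sum_squares by simp
  also have "\<dots> \<le> (x (l + u))\<^sup>2 + (x (l + v))\<^sup>2"
    by simp
  finally show "norm (c l * (x (l + u) * x (l + v))) \<le> (x (l + u))\<^sup>2 + (x (l + v))\<^sup>2"
    by (simp add: abs_mult)
qed auto

lemma sum_shift_product_bound:
  fixes x :: "'i::ab_group_add \<Rightarrow> real"
  assumes "u \<in> periods \<Lambda>" "v \<in> periods \<Lambda>" "finite H" "H \<subseteq> \<Lambda>"
    and K: "\<And>H. finite H \<Longrightarrow> H \<subseteq> \<Lambda> \<Longrightarrow> (\<Sum>l\<in>H. (x l)\<^sup>2) \<le> K"
  shows "(\<Sum>l\<in>H. \<bar>x (l + u) * x (l + v)\<bar>) \<le> K"
proof -
  have "(\<Sum>l\<in>H. \<bar>x (l + u) * x (l + v)\<bar>) \<le> (\<Sum>l\<in>H. ((x (l + u))\<^sup>2 + (x (l + v))\<^sup>2) / 2)"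
    by (intro sum_mono abs_mult_le_sum_squares)
  also have "\<dots> = ((\<Sum>l\<in>H. (x (l + u))\<^sup>2) + (\<Sum>l\<in>H. (x (l + v))\<^sup>2)) / 2"
    by (simp add: sum.distrib flip: sum_divide_distrib)
  also have "\<dots> \<le> (K + K) / 2"
    using assms by (intro divide_right_mono add_mono sum_shift_le[where f = "\<lambda>l. (x l)\<^sup>2"]) auto
  finally show ?thesis by simp
qed

text \<open>The same bound serves every finite set, and so it yields the dominating constants when
  truncated sums are integrated in time.\<close>

lemma sum_mult_shift_product_bound:
  fixes x :: "'i::ab_group_add \<Rightarrow> real"
  assumes "u \<in> periods \<Lambda>" "v \<in> periods \<Lambda>" "finite H" "H \<subseteq> \<Lambda>" "\<And>l. \<bar>c l\<bar> \<le> 1"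
    and K: "\<And>H. finite H \<Longrightarrow> H \<subseteq> \<Lambda> \<Longrightarrow> (\<Sum>l\<in>H. (x l)\<^sup>2) \<le> K"
  shows "\<bar>\<Sum>l\<in>H. c l * (x (l + u) * x (l + v))\<bar> \<le> K"
proof -
  have "\<bar>\<Sum>l\<in>H. c l * (x (l + u) * x (l + v))\<bar> \<le> (\<Sum>l\<in>H. \<bar>c l * (x (l + u) * x (l + v))\<bar>)"
    by (rule sum_abs)
  also have "\<dots> \<le> (\<Sum>l\<in>H. \<bar>x (l + u) * x (l + v)\<bar>)"
    using assms(5) by (intro sum_mono) (simp add: abs_mult mult_left_le_one_le)
  also have "\<dots> \<le> K"
    by (rule sum_shift_product_bound) (use assms in auto)
  finally show ?thesis .
qed

locale lattice_flow =
  fixes \<Lambda> :: "'i::ab_group_add set" and I :: "'j set" and e :: "'j \<Rightarrow> 'i" and \<kappa> :: "'j \<Rightarrow> real"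
    and lam :: "'i \<Rightarrow> real" and \<nu> :: real and \<phi> :: "real \<Rightarrow> real" and a :: "real \<Rightarrow> 'i \<Rightarrow> real"
    and t0 t1 K :: real
  assumes countable: "countable \<Lambda>" and finite_I: "finite I"
    and e_period: "i \<in> I \<Longrightarrow> e i \<in> periods \<Lambda>"
    and lam_nonneg: "0 \<le> lam l" and \<nu>_nonneg: "0 \<le> \<nu>"
    and \<phi>_cont: "continuous_on {t0..t1} \<phi>"
    and ode: "t \<in> {t0..t1} \<Longrightarrow> l \<in> \<Lambda> \<Longrightarrow>
      ((\<lambda>t. a t l) has_real_derivative
        - \<nu> * lam l * a t l - \<phi> t / 2 * (\<Sum>i\<in>I. \<kappa> i * (a t (l - e i) - a t (l + e i))))
        (at t within {t0..t1})"
    and square_bound: "t \<in> {t0..t1} \<Longrightarrow> finite H \<Longrightarrow> H \<subseteq> \<Lambda> \<Longrightarrow> (\<Sum>l\<in>H. (a t l)\<^sup>2) \<le> K"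
begin

definition energy :: "real \<Rightarrow> real" where
  "energy t = (\<Sum>\<^sub>\<infinity>l\<in>\<Lambda>. (a t l)\<^sup>2)"

lemma square_summable: "t \<in> {t0..t1} \<Longrightarrow> (\<lambda>l. (a t l)\<^sup>2) summable_on \<Lambda>"
  using square_bound by (intro nonneg_bdd_above_summable_on) (auto intro!: bdd_aboveI)

lemma sum_le_energy: "t \<in> {t0..t1} \<Longrightarrow> finite H \<Longrightarrow> H \<subseteq> \<Lambda> \<Longrightarrow> (\<Sum>l\<in>H. (a t l)\<^sup>2) \<le> energy t"
  unfolding energy_def by (intro finite_sum_le_infsum square_summable) auto

lemma energy_has_sum: "t \<in> {t0..t1} \<Longrightarrow> ((\<lambda>l. (a t l)\<^sup>2) has_sum energy t) \<Lambda>"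
  unfolding energy_def by (intro has_sum_infsum square_summable)

lemma energy_nonneg: "0 \<le> energy t"
  unfolding energy_def by (intro infsum_nonneg) auto

lemma continuous_on_coeff: "l \<in> \<Lambda> \<Longrightarrow> continuous_on {t0..t1} (\<lambda>t. a t l)"
  by (rule DERIV_continuous_on) (rule ode)

lemma neg_e_period: "i \<in> I \<Longrightarrow> - e i \<in> periods \<Lambda>"
  by (intro uminus_in_periods e_period)

lemma shift_mem: "l \<in> \<Lambda> \<Longrightarrow> i \<in> I \<Longrightarrow> l + e i \<in> \<Lambda>" "l \<in> \<Lambda> \<Longrightarrow> i \<in> I \<Longrightarrow> l - e i \<in> \<Lambda>"
  using periodsD[OF e_period] periodsD[OF neg_e_period] by auto

text \<open>The antisymmetric coupling only moves energy between neighbours, so on a finite set just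
  the flux through its boundary survives, and it tends to 0 along an exhaustion. As
  \<open>lam\<close> is unbounded, the dissipation is kept on a fixed finite set; its terms outside
  are nonnegative and are dropped.\<close>

lemma energy_inequality:
  assumes st: "t0 \<le> s" "s \<le> t" "t \<le> t1" and H: "finite H" "H \<subseteq> \<Lambda>"
  shows "energy t + 2 * \<nu> * integral {s..t} (\<lambda>r. \<Sum>l\<in>H. lam l * (a r l)\<^sup>2) \<le> energy s"
proof -
  obtain F where F: "\<And>N. finite (F N)" "\<And>N. F N \<subseteq> \<Lambda>"
    "filterlim F (finite_subsets_at_top \<Lambda>) sequentially"
    using countable_exhaustion[OF countable] by metis
  \<comment> \<open>The boundary flux. The factors 1 and the shifts by 0 give it the shape of
    \<open>sum_mult_shift_product_bound\<close>.\<close>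
  define R where "R N r = - \<phi> r * (\<Sum>i\<in>I. \<kappa> i *
      ((\<Sum>l\<in>F N. 1 * (a r (l + 0) * a r (l + - e i))) - (\<Sum>l\<in>F N. 1 * (a r (l + 0) * a r (l + e i)))))" for N r
  define S where "S N r = (\<Sum>l\<in>F N. (a r l)\<^sup>2)" for N r
  define D where "D X r = (\<Sum>l\<in>X. lam l * (a r l)\<^sup>2)" for X r
  have sub: "{s..t} \<subseteq> {t0..t1}" using st by auto
  have cont: "continuous_on {s..t} (\<lambda>r. a r l)" if "l \<in> \<Lambda>" for l
    using continuous_on_subset[OF continuous_on_coeff[OF that] sub] .
  have contD: "continuous_on {s..t} (D X)" if "X \<subseteq> \<Lambda>" for X
    unfolding D_def using that by (intro continuous_intros cont) auto
  have contR: "continuous_on {s..t} (R N)" for N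
    unfolding R_def
    by (intro continuous_intros cont continuous_on_subset[OF \<phi>_cont sub])
      (auto intro: shift_mem subsetD[OF F(2)])
  have deriv: "(S N has_real_derivative - (2 * \<nu>) * D (F N) r + R N r) (at r within {s..t})"
    if "r \<in> {s..t}" for N r
  proof -
    have "(S N has_real_derivative (\<Sum>l\<in>F N. 2 * a r l * (- \<nu> * lam l * a r l -
       \<phi> r / 2 * (\<Sum>i\<in>I. \<kappa> i * (a r (l - e i) - a r (l + e i)))))) (at r within {s..t})"
      unfolding S_def
    proof (rule DERIV_sum)
      fix l assume "l \<in> F N"
      then have "l \<in> \<Lambda>" "r \<in> {t0..t1}" using F(2) that sub by auto
      from DERIV_power[OF has_field_derivative_subset[OF ode[OF this(2,1)] sub], of 2]
      show "((\<lambda>r. (a r l)\<^sup>2) has_real_derivative 2 * a r l * (- \<nu> * lam l * a r l -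
         \<phi> r / 2 * (\<Sum>i\<in>I. \<kappa> i * (a r (l - e i) - a r (l + e i))))) (at r within {s..t})"
        by (rule DERIV_cong) simp
    qed
    moreover have "(\<Sum>l\<in>F N. 2 * a r l * (- \<nu> * lam l * a r l -
       \<phi> r / 2 * (\<Sum>i\<in>I. \<kappa> i * (a r (l - e i) - a r (l + e i))))) = - (2 * \<nu>) * D (F N) r + R N r"
    proof -
      have "R N r = - \<phi> r * (\<Sum>i\<in>I. \<Sum>l\<in>F N. \<kappa> i * (a r l * (a r (l - e i) - a r (l + e i))))"
        unfolding R_def by (simp add: sum_subtractf sum_distrib_left right_diff_distrib)
      also have "\<dots> = - \<phi> r * (\<Sum>l\<in>F N. \<Sum>i\<in>I. \<kappa> i * (a r l * (a r (l - e i) - a r (l + e i))))"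
        by (subst sum.swap) simp
      also have "\<dots> = (\<Sum>l\<in>F N. - \<phi> r * a r l * (\<Sum>i\<in>I. \<kappa> i * (a r (l - e i) - a r (l + e i))))"
        by (simp add: sum_distrib_left mult_ac)
      finally have "R N r = (\<Sum>l\<in>F N. - \<phi> r * a r l * (\<Sum>i\<in>I. \<kappa> i * (a r (l - e i) - a r (l + e i))))" .
      moreover have "2 * x * (- \<nu> * y * x - p / 2 * b) = - (2 * \<nu>) * (y * x\<^sup>2) + - p * x * b" for x y p b
        by (simp add: algebra_simps power2_eq_square)
      ultimately show ?thesis
        by (simp only: D_def sum.distrib sum_distrib_left[of "- (2 * \<nu>)"])
    qed
    ultimately show ?thesis by simp
  qed
  have "bounded (\<phi> ` {s..t})"
    by (intro compact_imp_bounded compact_continuous_image continuous_on_subset[OF \<phi>_cont sub] compact_Icc)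
  then obtain B where B: "\<And>r. r \<in> {s..t} \<Longrightarrow> \<bar>\<phi> r\<bar> \<le> B"
    unfolding bounded_iff real_norm_def by blast
  have ev: "eventually (\<lambda>N. S N t + 2 * \<nu> * integral {s..t} (D H) \<le> S N s + integral {s..t} (R N)) sequentially"
  proof -
    have "eventually (\<lambda>N. finite (F N) \<and> H \<subseteq> F N \<and> F N \<subseteq> \<Lambda>) sequentially"
      using F(3) H unfolding filterlim_finite_subsets_at_top by blast
    then have "eventually (\<lambda>N. H \<subseteq> F N) sequentially"
      by (rule eventually_mono) simp
    then show ?thesis
    proof eventually_elim
      case (elim N)
      have "((\<lambda>r. - (2 * \<nu>) * D (F N) r + R N r) has_integral S N t - S N s) {s..t}"
        using deriv st
        by (intro fundamental_theorem_of_calculus) (auto simp: has_real_derivative_iff_has_vector_derivative)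
      moreover have "(D (F N) has_integral integral {s..t} (D (F N))) {s..t}"
        "(R N has_integral integral {s..t} (R N)) {s..t}"
        using contD[OF F(2)] contR by (auto intro!: integrable_integral integrable_continuous_real)
      then have "((\<lambda>r. - (2 * \<nu>) * D (F N) r + R N r) has_integral
          - (2 * \<nu>) * integral {s..t} (D (F N)) + integral {s..t} (R N)) {s..t}"
        by (intro has_integral_add has_integral_mult_right)
      ultimately have "S N t - S N s = - (2 * \<nu>) * integral {s..t} (D (F N)) + integral {s..t} (R N)"
        by (rule has_integral_unique)
      moreover have "integral {s..t} (D H) \<le> integral {s..t} (D (F N))"
        using contD[OF F(2)] contD[OF H(2)] elim F(1) lam_nonneg
        by (intro integral_le integrable_continuous_real) (auto simp: D_def intro!: sum_mono2)
      then have "2 * \<nu> * integral {s..t} (D H) \<le> 2 * \<nu> * integral {s..t} (D (F N))"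
        using \<nu>_nonneg by (intro mult_left_mono) auto
      ultimately show ?case by simp
    qed
  qed
  have limS: "(\<lambda>N. S N r) \<longlonglongrightarrow> energy r" if "r \<in> {t0..t1}" for r
    unfolding S_def by (rule has_sum_imp_LIMSEQ[OF energy_has_sum[OF that] F(3)])
  have limR: "(\<lambda>N. integral {s..t} (R N)) \<longlonglongrightarrow> 0"
  proof (rule integral_LIMSEQ_0[OF contR])
    fix N r assume r: "r \<in> {s..t}"
    with sub have r': "r \<in> {t0..t1}" by auto
    have "\<bar>\<Sum>i\<in>I. \<kappa> i * ((\<Sum>l\<in>F N. 1 * (a r (l + 0) * a r (l + - e i))) - (\<Sum>l\<in>F N. 1 * (a r (l + 0) * a r (l + e i))))\<bar>
       \<le> (\<Sum>i\<in>I. \<bar>\<kappa> i\<bar> * (K + K))"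
    proof (rule order_trans[OF sum_abs sum_mono])
      fix i assume i: "i \<in> I"
      have "\<bar>\<Sum>l\<in>F N. 1 * (a r (l + 0) * a r (l + - e i))\<bar> \<le> K"
        "\<bar>\<Sum>l\<in>F N. 1 * (a r (l + 0) * a r (l + e i))\<bar> \<le> K"
        by (rule sum_mult_shift_product_bound[OF zero_in_periods neg_e_period[OF i] F(1,2) _ square_bound[OF r']]
           sum_mult_shift_product_bound[OF zero_in_periods e_period[OF i] F(1,2) _ square_bound[OF r']]; simp)+
      then show "\<bar>\<kappa> i * ((\<Sum>l\<in>F N. 1 * (a r (l + 0) * a r (l + - e i))) - (\<Sum>l\<in>F N. 1 * (a r (l + 0) * a r (l + e i))))\<bar>
        \<le> \<bar>\<kappa> i\<bar> * (K + K)"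
        unfolding abs_mult by (intro mult_left_mono) linarith+
    qed
    then show "\<bar>R N r\<bar> \<le> B * (\<Sum>i\<in>I. \<bar>\<kappa> i\<bar> * (K + K))"
      unfolding R_def abs_mult abs_minus_cancel using B[OF r] by (intro mult_mono) auto
  next
    fix r assume r: "r \<in> {s..t}"
    with sub have r': "r \<in> {t0..t1}" by auto
    have "(\<lambda>N. R N r) \<longlonglongrightarrow> - \<phi> r * (\<Sum>i\<in>I. \<kappa> i *
       ((\<Sum>\<^sub>\<infinity>l\<in>\<Lambda>. 1 * (a r (l + 0) * a r (l + - e i))) - (\<Sum>\<^sub>\<infinity>l\<in>\<Lambda>. 1 * (a r (l + 0) * a r (l + e i)))))"
      unfolding R_def
      by (intro tendsto_intros has_sum_imp_LIMSEQ[OF _ F(3)] has_sum_infsum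
        summable_on_shift_product square_summable[OF r'] e_period neg_e_period) auto
    \<comment> \<open>On the whole lattice, translation by \<open>e i\<close> identifies inflow and
      outflow.\<close>
    moreover have "(\<Sum>\<^sub>\<infinity>l\<in>\<Lambda>. 1 * (a r (l + 0) * a r (l + - e i))) = (\<Sum>\<^sub>\<infinity>l\<in>\<Lambda>. 1 * (a r (l + 0) * a r (l + e i)))"
      if "i \<in> I" for i
      using infsum_reindex_bij_betw[OF bij_betw_periods[OF e_period[OF that]],
          of "\<lambda>l. a r l * a r (l - e i)"] by (simp add: mult.commute)
    ultimately show "(\<lambda>N. R N r) \<longlonglongrightarrow> 0" by simp
  qed
  have "energy t + 2 * \<nu> * integral {s..t} (D H) \<le> energy s + 0"
    using st by (intro tendsto_le[OF sequentially_bot tendsto_add[OF limS limR]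
      tendsto_add[OF limS tendsto_const] ev]) auto
  then show ?thesis by (simp add: D_def[abs_def])
qed

lemma energy_antimono:
  assumes "t0 \<le> s" "s \<le> t" "t \<le> t1"
  shows "energy t \<le> energy s"
  using energy_inequality[OF assms, of "{}"] by simp

text \<open>The initial energy pays for all dissipation, with one bound for every finite set;
  translates of a truncation are therefore covered as well.\<close>

lemma dissipation_bound:
  assumes "t0 \<le> t1" "finite H" "H \<subseteq> \<Lambda>"
  shows "2 * \<nu> * integral {t0..t1} (\<lambda>r. \<Sum>l\<in>H. lam l * (a r l)\<^sup>2) \<le> energy t0"
  using energy_inequality[OF order_refl assms(1) order_refl assms(2,3)] energy_nonneg[of t1] by linarith

end

section \<open>Mixing by correlations\<close>

lemma sum_inverse_1_plus_square_nat:
  assumes "0 < (b::real)"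
  shows "(\<Sum>p=1..n. 1 / (1 + b\<^sup>2 * (real p)\<^sup>2)) \<le> arctan (b * real n) / b"
proof (induction n)
  case (Suc n)
  \<comment> \<open>Integral comparison by the mean value theorem: the derivative of the arctangent
    on the step from b n to b (n + 1) is at least its value at the right end.\<close>
  have "\<exists>\<xi>>b * real n. \<xi> < b * real (Suc n) \<and>
      arctan (b * real (Suc n)) - arctan (b * real n) = (b * real (Suc n) - b * real n) * inverse (1 + \<xi>\<^sup>2)"
    using assms by (intro MVT2) (auto intro: DERIV_arctan)
  then obtain \<xi> where \<xi>: "b * real n < \<xi>" "\<xi> < b * real (Suc n)"
    "arctan (b * real (Suc n)) - arctan (b * real n) = b * inverse (1 + \<xi>\<^sup>2)"
    by (auto simp: algebra_simps)
  have "0 \<le> b * real n" using assms by simp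
  with \<xi> have "\<xi>\<^sup>2 \<le> (b * real (Suc n))\<^sup>2" by (intro power_mono) auto
  then have "1 / (1 + b\<^sup>2 * (real (Suc n))\<^sup>2) \<le> inverse (1 + \<xi>\<^sup>2)"
    unfolding power_mult_distrib inverse_eq_divide by (intro divide_left_mono) (auto simp: add_pos_nonneg)
  also have "\<dots> = arctan (b * real (Suc n)) / b - arctan (b * real n) / b"
    using \<xi>(3) assms by (simp flip: diff_divide_distrib)
  finally show ?case using Suc by simp
qed simp

lemma sum_inverse_1_plus_square_int:
  assumes "0 < (b::real)" "b \<le> 1" "finite A"
  shows "(\<Sum>p\<in>A. 1 / (1 + b\<^sup>2 * (real_of_int p)\<^sup>2)) \<le> 5 / b"
proof -
  let ?g = "\<lambda>p. 1 / (1 + b\<^sup>2 * (real_of_int p)\<^sup>2)"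
  obtain n where n: "A \<subseteq> {- int n..int n}"
  proof
    show "A \<subseteq> {- int (nat (Max (insert 0 (abs ` A))))..int (nat (Max (insert 0 (abs ` A))))}"
    proof
      fix p assume "p \<in> A"
      then have "\<bar>p\<bar> \<le> Max (insert 0 (abs ` A))" using assms(3) by (intro Max_ge) auto
      then show "p \<in> {- int (nat (Max (insert 0 (abs ` A))))..int (nat (Max (insert 0 (abs ` A))))}" by auto
    qed
  qed
  \<comment> \<open>Each half-line contributes at most (pi / 2) / b <= 2 / b and the origin 1 <= 1 /
    b, whence the constant 5.\<close>
  have half: "(\<Sum>p\<in>{1..int n}. ?g p) \<le> 2 / b"
  proof -
    have "(\<Sum>p\<in>{1..int n}. ?g p) = (\<Sum>p=1..n. 1 / (1 + b\<^sup>2 * (real p)\<^sup>2))"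
      by (rule sum.reindex_bij_witness[where i = int and j = nat]) auto
    also have "\<dots> \<le> arctan (b * real n) / b"
      using assms(1) by (rule sum_inverse_1_plus_square_nat)
    also have "\<dots> \<le> 2 / b"
      using arctan_ubound[of "b * real n"] pi_less_4 assms(1) by (intro divide_right_mono) auto
    finally show ?thesis .
  qed
  have neg: "(\<Sum>p\<in>{- int n..-1}. ?g p) = (\<Sum>p\<in>{1..int n}. ?g p)"
    by (rule sum.reindex_bij_witness[where i = uminus and j = uminus]) auto
  have "(\<Sum>p\<in>A. ?g p) \<le> (\<Sum>p\<in>{- int n..int n}. ?g p)"
    using n by (intro sum_mono2) (auto intro!: divide_nonneg_pos add_pos_nonneg)
  also have "{- int n..int n} = {- int n..-1} \<union> ({0} \<union> {1..int n})" by auto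
  also have "(\<Sum>p\<in>\<dots>. ?g p) = (\<Sum>p\<in>{- int n..-1}. ?g p) + (1 + (\<Sum>p\<in>{1..int n}. ?g p))"
    by (subst sum.union_disjoint; (subst sum.union_disjoint)?) auto
  also have "\<dots> \<le> 2 / b + (1 + 2 / b)" using half neg by simp
  also have "\<dots> \<le> 5 / b" using assms by (simp add: field_simps)
  finally show ?thesis .
qed

lemma sum_inverse_weights:
  assumes "0 < (b::real)" "b \<le> 1" "inj_on f A" "finite A"
  shows "(\<Sum>m\<in>A. 1 / (1 + b\<^sup>2 * (real_of_int (f m))\<^sup>2)) \<le> 5 / b"
  using sum_inverse_1_plus_square_int[of b "f ` A"] assms by (simp add: sum.reindex)

text \<open>Summation by parts: the transport term couples neighbouring correlations, and the Fejer weights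
  turn the alternating sum into the main term \<open>C 0\<close> minus an average.\<close>

lemma alternating_fejer_sum_aux:
  fixes C :: "nat \<Rightarrow> real"
  assumes "0 < M"
  shows "(\<Sum>m<L. (-1) ^ m * (1 - real m / real M) * (C (Suc m) + C m)) =
    C 0 - (\<Sum>m=1..L. (-1) ^ m * C m) / real M - (-1) ^ L * (1 - real L / real M) * C L"
proof (induction L)
  case (Suc L)
  show ?case
    unfolding sum.lessThan_Suc Suc.IH by (simp add: algebra_simps add_divide_distrib diff_divide_distrib)
qed simp

lemma alternating_fejer_sum:
  fixes C :: "nat \<Rightarrow> real"
  assumes "0 < M"
  shows "(\<Sum>m<M. (-1) ^ m * (1 - real m / real M) * (C (Suc m) + C m)) =
    C 0 - (\<Sum>m=1..M. (-1) ^ m * C m) / real M"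
  using alternating_fejer_sum_aux[OF assms, of C M] assms by simp

lemma sum_affine_combination:
  fixes c c' :: real
  shows "(\<Sum>l\<in>H. c * (f l + g l) + c' * (p l + q l)) = c * (sum f H + sum g H) + c' * (sum p H + sum q H)"
  unfolding sum.distrib[of "\<lambda>l. c * (f l + g l)"] sum_distrib_left[symmetric] sum.distrib[of f g] sum.distrib[of p q] ..

lemma cos_ge_one_minus_square: "1 - x\<^sup>2 / 2 \<le> cos (x::real)"
proof -
  have "cos x = 1 - 2 * (sin (x / 2))\<^sup>2"
    using cos_double_sin[of "x / 2"] by simp
  moreover have "\<bar>sin (x / 2)\<bar>\<^sup>2 \<le> \<bar>x / 2\<bar>\<^sup>2"
    by (intro power_mono abs_sin_x_le_abs_x) auto
  ultimately show ?thesis by (simp add: power_divide)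
qed

lemma sin_ge_half: "0 \<le> x \<Longrightarrow> x \<le> 1 \<Longrightarrow> x / 2 \<le> sin (x::real)"
proof -
  assume x: "0 \<le> x" "x \<le> 1"
  have "sin 0 - 0 / 2 \<le> sin x - x / 2"
  proof (rule DERIV_nonneg_imp_nondecreasing[OF x(1)])
    fix y assume y: "0 \<le> y" "y \<le> x"
    then have "y\<^sup>2 \<le> 1" using x by (simp add: power_le_one)
    then have "0 \<le> cos y - 1 / 2" using cos_ge_one_minus_square[of y] by simp
    moreover have "((\<lambda>x. sin x - x / 2) has_real_derivative cos y - 1 / 2) (at y)"
      by (auto intro!: derivative_eq_intros)
    ultimately show "\<exists>D. ((\<lambda>x. sin x - x / 2) has_real_derivative D) (at y) \<and> 0 \<le> D" by blast
  qed
  then show ?thesis by simp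
qed

text \<open>One coupled direction is singled out: \<open>u q\<close> is q steps along
  \<open>e j\<close>, \<open>z\<close> is the coordinate in that direction, and along it
  \<open>lam\<close> varies as the square of \<open>z\<close>. The bound on
  \<open>\<kappa> j\<close> is that of a nonzero integer frequency; it makes the mixing rate uniform
  in the frequency.\<close>

locale lattice_mixing = lattice_flow +
  fixes j and u :: "int \<Rightarrow> 'a" and z :: "'a \<Rightarrow> int"
  assumes j: "j \<in> I" and \<phi>_1: "t \<in> {t0..t1} \<Longrightarrow> \<phi> t = 1"
    and u_add: "u (p + q) = u p + u q" and u_1: "u 1 = e j"
    and z_u: "z (l + u q) = z l + q"
    and z_e: "i \<in> I \<Longrightarrow> i \<noteq> j \<Longrightarrow> z (l + e i) = z l"
    and lam_u: "lam (l + u q) = lam l + (of_int (z l + q))\<^sup>2 - (of_int (z l))\<^sup>2"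
    and z_le_lam: "(of_int (z l))\<^sup>2 \<le> lam l"
    and \<kappa>_ge_1: "1 \<le> \<bar>\<kappa> j\<bar>"
begin

section \<open>Correlations and the transport commutator\<close>

lemma u_0 [simp]: "u 0 = 0"
  using u_add[of 0 0] by simp

lemma u_period: "u q \<in> periods \<Lambda>"
proof (induction q rule: int_induct[where k = 0])
  case (step1 i)
  then show ?case using e_period[OF j] by (simp add: u_add u_1 add_in_periods)
next
  case (step2 i)
  have "u (i - 1) + u 1 = u i" by (simp flip: u_add)
  then have "u (i - 1) = u i + - e j" by (simp add: u_1 eq_diff_eq)
  then show ?case using add_in_periods[OF step2(2) neg_e_period[OF j]] by simp
qed simp

text \<open>The phase 2 z + q is the sum of the indices of the two factors and q their difference.
  Summed over l, this is the imaginary part of the coefficient with frequency -q of f(y + h) times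
  the conjugate of f(y - h), where f has the coefficients \<open>x\<close> along
  \<open>z\<close>.\<close>

definition sin_corr :: "real \<Rightarrow> int \<Rightarrow> ('a \<Rightarrow> real) \<Rightarrow> 'a \<Rightarrow> real" where
  "sin_corr h q x l = sin (of_int (2 * z l + q) * h) * (x l * x (l + u q))"

definition cos_corr :: "real \<Rightarrow> int \<Rightarrow> ('a \<Rightarrow> real) \<Rightarrow> 'a \<Rightarrow> real" where
  "cos_corr h q x l = cos (of_int (2 * z l + q) * h) * (x l * x (l + u q))"

definition transport :: "('a \<Rightarrow> real) \<Rightarrow> 'a \<Rightarrow> real" where
  "transport x l = (\<Sum>i\<in>I. \<kappa> i * (x (l - e i) - x (l + e i)))"

lemma cos_corr_has_sum:
  assumes "(\<lambda>l. (x l)\<^sup>2) summable_on \<Lambda>"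
  shows "(cos_corr h q x has_sum infsum (cos_corr h q x) \<Lambda>) \<Lambda>"
  using summable_on_shift_product[OF assms zero_in_periods u_period, of "\<lambda>l. cos (of_int (2 * z l + q) * h)" q]
  by (intro has_sum_infsum) (simp add: cos_corr_def[abs_def])

text \<open>Only the shift in direction \<open>j\<close> moves the phase \<open>2 z + q\<close>; the other shifts cancel by antisymmetry.\<close>

lemma transport_commutator_shift:
  assumes x: "(\<lambda>l. (x l)\<^sup>2) summable_on \<Lambda>" and i: "i \<in> I"
  shows "((\<lambda>l. sin (of_int (2 * z l + q) * h) *
      ((x (l - e i) - x (l + e i)) * x (l + u q) + x l * (x (l + u q - e i) - x (l + u q + e i)))) has_sum
      (if i = j then 2 * sin h * (infsum (cos_corr h (q + 1) x) \<Lambda> + infsum (cos_corr h (q - 1) x) \<Lambda>) else 0)) \<Lambda>"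
proof -
  define s where "s l = sin (of_int (2 * z l + q) * h)" for l
  have s_le: "\<bar>s l\<bar> \<le> 1" for l by (simp add: s_def)
  define f1 where "f1 l = s l * (x (l + - e i) * x (l + u q))" for l
  define f2 where "f2 l = s l * (x (l + e i) * x (l + u q))" for l
  define f3 where "f3 l = s l * (x (l + 0) * x (l + (u q + - e i)))" for l
  define f4 where "f4 l = s l * (x (l + 0) * x (l + (u q + e i)))" for l
  note per = e_period[OF i] neg_e_period[OF i] u_period zero_in_periods add_in_periods[OF u_period e_period[OF i]]
    add_in_periods[OF u_period neg_e_period[OF i]]
  have sums: "(f1 has_sum infsum f1 \<Lambda>) \<Lambda>" "(f2 has_sum infsum f2 \<Lambda>) \<Lambda>"
    "(f3 has_sum infsum f3 \<Lambda>) \<Lambda>" "(f4 has_sum infsum f4 \<Lambda>) \<Lambda>"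
    unfolding f1_def f2_def f3_def f4_def
    by (intro has_sum_infsum summable_on_shift_product x per s_le)+
  have total: "((\<lambda>l. f1 l - f2 l + f3 l - f4 l) has_sum
      (infsum f1 \<Lambda> - infsum f2 \<Lambda> + infsum f3 \<Lambda> - infsum f4 \<Lambda>)) \<Lambda>"
    by (intro has_sum_add has_sum_diff sums)
  \<comment> \<open>Reindexing leaves x l as a factor of every product, so that the sine is
    differenced instead: a summation by parts.\<close>
  have sums': "((\<lambda>l. f1 (l + e i)) has_sum infsum f1 \<Lambda>) \<Lambda>" "((\<lambda>l. f2 (l + - e i)) has_sum infsum f2 \<Lambda>) \<Lambda>"
    using sums by (simp_all only: has_sum_shift[OF e_period[OF i]] has_sum_shift[OF neg_e_period[OF i]])
  have "((\<lambda>l. f1 (l + e i) - f2 (l + - e i) + f3 l - f4 l) has_sum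
      (infsum f1 \<Lambda> - infsum f2 \<Lambda> + infsum f3 \<Lambda> - infsum f4 \<Lambda>)) \<Lambda>"
    by (intro has_sum_add has_sum_diff sums sums')
  also have "(\<lambda>l. f1 (l + e i) - f2 (l + - e i) + f3 l - f4 l) =
      (\<lambda>l. (s (l + e i) - s l) * (x l * x (l + (u q + e i))) + (s l - s (l - e i)) * (x l * x (l + (u q - e i))))"
    by (auto simp: f1_def f2_def f3_def f4_def algebra_simps)
  finally have A: "((\<lambda>l. (s (l + e i) - s l) * (x l * x (l + (u q + e i))) + (s l - s (l - e i)) * (x l * x (l + (u q - e i)))) has_sum
      (infsum f1 \<Lambda> - infsum f2 \<Lambda> + infsum f3 \<Lambda> - infsum f4 \<Lambda>)) \<Lambda>" .
  have "infsum f1 \<Lambda> - infsum f2 \<Lambda> + infsum f3 \<Lambda> - infsum f4 \<Lambda> =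
    (if i = j then 2 * sin h * (infsum (cos_corr h (q + 1) x) \<Lambda> + infsum (cos_corr h (q - 1) x) \<Lambda>) else 0)"
  proof (cases "i = j")
    case False
    have s1: "s (l + e i) = s l" for l using z_e[OF i False] by (simp add: s_def)
    moreover have "s (l - e i) = s l" for l using s1[of "l - e i"] by simp
    ultimately show ?thesis
      using has_sum_unique[OF A has_sum_0] False by simp
  next
    case True
    have z1: "z (l + e i) = z l + 1" for l using z_u[of l 1] True by (simp add: u_1)
    have z2: "z (l - e i) = z l - 1" for l using z1[of "l - e i"] by simp
    have uq: "u q + e i = u (q + 1)" "u q - e i = u (q - 1)"
      using u_add[of q 1] u_add[of "q - 1" 1] True by (simp_all add: u_1)
    \<comment> \<open>A step along \<open>e j\<close> raises 2 z + q by 2, so the two phases lie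
      symmetrically about the phase of q + 1 or of q - 1.\<close>
    have sin_diff: "sin (y + h) - sin (y - h) = 2 * sin h * cos y" for y
      by (simp add: sin_add sin_diff)
    have s1: "s (l + e i) - s l = 2 * sin h * cos (of_int (2 * z l + (q + 1)) * h)" for l
      using sin_diff[of "of_int (2 * z l + (q + 1)) * h"] by (simp add: s_def z1 algebra_simps)
    have s2: "s l - s (l - e i) = 2 * sin h * cos (of_int (2 * z l + (q - 1)) * h)" for l
      using sin_diff[of "of_int (2 * z l + (q - 1)) * h"] by (simp add: s_def z2 algebra_simps)
    have "((\<lambda>l. 2 * sin h * cos_corr h (q + 1) x l + 2 * sin h * cos_corr h (q - 1) x l) has_sum
        (2 * sin h * infsum (cos_corr h (q + 1) x) \<Lambda> + 2 * sin h * infsum (cos_corr h (q - 1) x) \<Lambda>)) \<Lambda>"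
      by (intro has_sum_add has_sum_cmult_right cos_corr_has_sum x)
    moreover have "(s (l + e i) - s l) * (x l * x (l + (u q + e i))) + (s l - s (l - e i)) * (x l * x (l + (u q - e i))) =
        2 * sin h * cos_corr h (q + 1) x l + 2 * sin h * cos_corr h (q - 1) x l" for l
      unfolding s1 s2 uq cos_corr_def by simp
    ultimately show ?thesis
      using has_sum_unique[OF A] True by (simp add: algebra_simps)
  qed
  moreover have "(\<lambda>l. f1 l - f2 l + f3 l - f4 l) = (\<lambda>l. sin (of_int (2 * z l + q) * h) *
      ((x (l - e i) - x (l + e i)) * x (l + u q) + x l * (x (l + u q - e i) - x (l + u q + e i))))"
    by (auto simp: f1_def f2_def f3_def f4_def s_def algebra_simps)
  ultimately show ?thesis using total by simp
qed

lemma transport_commutator: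
  assumes x: "(\<lambda>l. (x l)\<^sup>2) summable_on \<Lambda>"
  shows "((\<lambda>l. sin (of_int (2 * z l + q) * h) * (transport x l * x (l + u q) + x l * transport x (l + u q))) has_sum
     2 * \<kappa> j * sin h * (infsum (cos_corr h (q + 1) x) \<Lambda> + infsum (cos_corr h (q - 1) x) \<Lambda>)) \<Lambda>"
proof -
  let ?S = "infsum (cos_corr h (q + 1) x) \<Lambda> + infsum (cos_corr h (q - 1) x) \<Lambda>"
  have "((\<lambda>l. \<Sum>i\<in>I. \<kappa> i * (sin (of_int (2 * z l + q) * h) *
      ((x (l - e i) - x (l + e i)) * x (l + u q) + x l * (x (l + u q - e i) - x (l + u q + e i))))) has_sum
      (\<Sum>i\<in>I. \<kappa> i * (if i = j then 2 * sin h * ?S else 0))) \<Lambda>"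
    by (intro has_sum_sum has_sum_cmult_right transport_commutator_shift x)
  moreover have "(\<Sum>i\<in>I. \<kappa> i * (if i = j then 2 * sin h * ?S else 0)) = 2 * \<kappa> j * sin h * ?S"
    using finite_I j by (simp add: if_distrib[of "\<lambda>v. \<kappa> _ * v"] sum.delta cong: if_cong)
  moreover have "(\<Sum>i\<in>I. \<kappa> i * (sin (of_int (2 * z l + q) * h) *
      ((x (l - e i) - x (l + e i)) * x (l + u q) + x l * (x (l + u q - e i) - x (l + u q + e i))))) =
      sin (of_int (2 * z l + q) * h) * (transport x l * x (l + u q) + x l * transport x (l + u q))" for l
    unfolding transport_def
    by (simp add: sum_distrib_left sum_distrib_right flip: sum.distrib) (simp add: algebra_simps)
  ultimately show ?thesis by simp
qed

definition fejer :: "nat \<Rightarrow> nat \<Rightarrow> real" where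
  "fejer M m = (-1) ^ m * (1 - real m / real M)"

lemma abs_fejer_le_1: "m \<le> M \<Longrightarrow> \<bar>fejer M m\<bar> \<le> 1"
  by (cases "M = 0") (auto simp: fejer_def abs_mult)

definition corr :: "real \<Rightarrow> nat \<Rightarrow> ('a \<Rightarrow> real) \<Rightarrow> 'a \<Rightarrow> real" where
  "corr h M x l = (\<Sum>m<M. fejer M m * sin_corr h (2 * int m + 1) x l)"

text \<open>What \<open>alternating_fejer_sum\<close> leaves of the cosine correlations: the energy
  density, damped by cos(2 z h), less an average of M correlations with even q.\<close>

definition main_term :: "real \<Rightarrow> nat \<Rightarrow> ('a \<Rightarrow> real) \<Rightarrow> 'a \<Rightarrow> real" where
  "main_term h M x l = cos_corr h 0 x l - (\<Sum>m=1..M. (-1) ^ m * cos_corr h (2 * int m) x l) / real M"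

definition transport_term :: "real \<Rightarrow> nat \<Rightarrow> ('a \<Rightarrow> real) \<Rightarrow> 'a \<Rightarrow> real" where
  "transport_term h M x l = (\<Sum>m<M. fejer M m * (sin (of_int (2 * z l + (2 * int m + 1)) * h) *
     (transport x l * x (l + u (2 * int m + 1)) + x l * transport x (l + u (2 * int m + 1)))))"

definition diffusion_term :: "real \<Rightarrow> nat \<Rightarrow> ('a \<Rightarrow> real) \<Rightarrow> 'a \<Rightarrow> real" where
  "diffusion_term h M x l = (\<Sum>m<M. fejer M m * (sin (of_int (2 * z l + (2 * int m + 1)) * h) *
     ((lam l + lam (l + u (2 * int m + 1))) * (x l * x (l + u (2 * int m + 1))))))"

text \<open>The two expressions agree only after summation over the lattice. Term by term they
  differ by a flux, which is the error on a truncation.\<close>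

lemma transport_term_minus_main_term_has_sum:
  assumes x: "(\<lambda>l. (x l)\<^sup>2) summable_on \<Lambda>" and M: "0 < M"
  shows "((\<lambda>l. transport_term h M x l - 2 * \<kappa> j * sin h * main_term h M x l) has_sum 0) \<Lambda>"
proof -
  define C where "C m = infsum (cos_corr h (2 * int m) x) \<Lambda>" for m
  let ?V = "C 0 - (\<Sum>m=1..M. (-1) ^ m * C m) / real M"
  have C: "(cos_corr h (2 * int m) x has_sum C m) \<Lambda>" for m
    unfolding C_def by (rule cos_corr_has_sum[OF x])
  have "((\<lambda>l. cos_corr h (2 * int 0) x l - inverse (real M) * (\<Sum>m=1..M. (-1) ^ m * cos_corr h (2 * int m) x l)) has_sum
      (C 0 - inverse (real M) * (\<Sum>m=1..M. (-1) ^ m * C m))) \<Lambda>"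
    by (intro has_sum_diff has_sum_cmult_right has_sum_sum C)
  then have main: "(main_term h M x has_sum ?V) \<Lambda>"
    by (simp add: main_term_def[abs_def] divide_inverse mult.commute)
  have "((\<lambda>l. transport_term h M x l) has_sum
      (\<Sum>m<M. fejer M m * (2 * \<kappa> j * sin h * (C (Suc m) + C m)))) \<Lambda>"
    unfolding transport_term_def
  proof (intro has_sum_sum has_sum_cmult_right)
    fix m :: nat
    have "2 * int m + 1 + 1 = 2 * int (Suc m)" "2 * int m + 1 - 1 = 2 * int m" by auto
    then show "((\<lambda>l. sin (of_int (2 * z l + (2 * int m + 1)) * h) *
       (transport x l * x (l + u (2 * int m + 1)) + x l * transport x (l + u (2 * int m + 1))))
       has_sum 2 * \<kappa> j * sin h * (C (Suc m) + C m)) \<Lambda>"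
      using transport_commutator[OF x, of "2 * int m + 1" h] unfolding C_def by simp
  qed
  also have "(\<Sum>m<M. fejer M m * (2 * \<kappa> j * sin h * (C (Suc m) + C m))) =
      2 * \<kappa> j * sin h * (\<Sum>m<M. fejer M m * (C (Suc m) + C m))"
    by (simp add: sum_distrib_left mult_ac)
  also have "(\<Sum>m<M. fejer M m * (C (Suc m) + C m)) = ?V"
    unfolding fejer_def by (rule alternating_fejer_sum[OF M])
  finally have "((\<lambda>l. transport_term h M x l - 2 * \<kappa> j * sin h * main_term h M x l) has_sum
     (2 * \<kappa> j * sin h * ?V - 2 * \<kappa> j * sin h * ?V)) \<Lambda>"
    by (intro has_sum_diff has_sum_cmult_right main)
  then show ?thesis by simp
qed

section \<open>Bounds on finite truncations\<close>

lemma sum_transport_product_bound: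
  assumes "w \<in> periods \<Lambda>" "v \<in> periods \<Lambda>" "finite H" "H \<subseteq> \<Lambda>" "\<And>l. \<bar>c l\<bar> \<le> 1"
    and B: "\<And>H. finite H \<Longrightarrow> H \<subseteq> \<Lambda> \<Longrightarrow> (\<Sum>l\<in>H. (x l)\<^sup>2) \<le> B"
  shows "\<bar>\<Sum>l\<in>H. c l * (transport x (l + w) * x (l + v))\<bar> \<le> (\<Sum>i\<in>I. \<bar>\<kappa> i\<bar> * (2 * B))"
proof -
  have "(\<Sum>l\<in>H. c l * (transport x (l + w) * x (l + v))) =
     (\<Sum>l\<in>H. \<Sum>i\<in>I. \<kappa> i * (c l * (x (l + (w + - e i)) * x (l + v)) - c l * (x (l + (w + e i)) * x (l + v))))"
    unfolding transport_def by (simp add: sum_distrib_left sum_distrib_right algebra_simps)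
  also have "\<dots> = (\<Sum>i\<in>I. \<kappa> i * ((\<Sum>l\<in>H. c l * (x (l + (w + - e i)) * x (l + v))) -
      (\<Sum>l\<in>H. c l * (x (l + (w + e i)) * x (l + v)))))"
    by (subst sum.swap) (simp add: sum_distrib_left flip: sum_subtractf)
  also have "\<bar>\<dots>\<bar> \<le> (\<Sum>i\<in>I. \<bar>\<kappa> i\<bar> * (2 * B))"
  proof (rule order_trans[OF sum_abs sum_mono])
    fix i assume i: "i \<in> I"
    have "\<bar>\<Sum>l\<in>H. c l * (x (l + (w + - e i)) * x (l + v))\<bar> \<le> B"
      "\<bar>\<Sum>l\<in>H. c l * (x (l + (w + e i)) * x (l + v))\<bar> \<le> B"
      by (rule sum_mult_shift_product_bound[OF add_in_periods[OF assms(1) neg_e_period[OF i]] assms(2-5) B]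
        sum_mult_shift_product_bound[OF add_in_periods[OF assms(1) e_period[OF i]] assms(2-5) B]; assumption)+
    then show "\<bar>\<kappa> i * ((\<Sum>l\<in>H. c l * (x (l + (w + - e i)) * x (l + v))) -
      (\<Sum>l\<in>H. c l * (x (l + (w + e i)) * x (l + v))))\<bar> \<le> \<bar>\<kappa> i\<bar> * (2 * B)"
      unfolding abs_mult by (intro mult_left_mono) linarith+
  qed
  finally show ?thesis .
qed

lemma cos_corr_bound:
  assumes "finite H" "H \<subseteq> \<Lambda>" and B: "\<And>H. finite H \<Longrightarrow> H \<subseteq> \<Lambda> \<Longrightarrow> (\<Sum>l\<in>H. (x l)\<^sup>2) \<le> B"
  shows "\<bar>\<Sum>l\<in>H. cos_corr h q x l\<bar> \<le> B"
  using sum_mult_shift_product_bound[OF zero_in_periods u_period assms(1,2) _ B, of "\<lambda>l. cos (of_int (2 * z l + q) * h)" q]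
  by (simp add: cos_corr_def)

lemma sin_corr_bound:
  assumes "finite H" "H \<subseteq> \<Lambda>" and B: "\<And>H. finite H \<Longrightarrow> H \<subseteq> \<Lambda> \<Longrightarrow> (\<Sum>l\<in>H. (x l)\<^sup>2) \<le> B"
  shows "\<bar>\<Sum>l\<in>H. sin_corr h q x l\<bar> \<le> B"
  using sum_mult_shift_product_bound[OF zero_in_periods u_period assms(1,2) _ B, of "\<lambda>l. sin (of_int (2 * z l + q) * h)" q]
  by (simp add: sin_corr_def)

lemma corr_bound:
  assumes "finite H" "H \<subseteq> \<Lambda>" and B: "\<And>H. finite H \<Longrightarrow> H \<subseteq> \<Lambda> \<Longrightarrow> (\<Sum>l\<in>H. (x l)\<^sup>2) \<le> B"
  shows "\<bar>\<Sum>l\<in>H. corr h M x l\<bar> \<le> real M * B"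
proof -
  have "(\<Sum>l\<in>H. corr h M x l) = (\<Sum>m<M. fejer M m * (\<Sum>l\<in>H. sin_corr h (2 * int m + 1) x l))"
    unfolding corr_def by (subst sum.swap) (simp add: sum_distrib_left)
  also have "\<bar>\<dots>\<bar> \<le> (\<Sum>m<M. 1 * B)"
  proof (rule order_trans[OF sum_abs sum_mono])
    fix m assume "m \<in> {..<M}"
    then show "\<bar>fejer M m * (\<Sum>l\<in>H. sin_corr h (2 * int m + 1) x l)\<bar> \<le> 1 * B"
      unfolding abs_mult by (intro mult_mono abs_fejer_le_1 sin_corr_bound[OF assms]) auto
  qed
  finally show ?thesis by simp
qed

lemma remainder_bound:
  assumes H: "finite H" "H \<subseteq> \<Lambda>" and B: "\<And>H. finite H \<Longrightarrow> H \<subseteq> \<Lambda> \<Longrightarrow> (\<Sum>l\<in>H. (x l)\<^sup>2) \<le> B"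
  shows "\<bar>\<Sum>l\<in>H. transport_term h M x l - c * main_term h M x l\<bar> \<le>
     real M * (2 * (\<Sum>i\<in>I. \<bar>\<kappa> i\<bar> * (2 * B))) + \<bar>c\<bar> * (B + real M * B)"
proof -
  define Z where "Z = (\<Sum>i\<in>I. \<bar>\<kappa> i\<bar> * (2 * B))"
  have B0: "0 \<le> B" using B[of "{}"] by simp
  have "(\<Sum>l\<in>H. transport_term h M x l) = (\<Sum>m<M. fejer M m *
      ((\<Sum>l\<in>H. sin (of_int (2 * z l + (2 * int m + 1)) * h) * (transport x (l + 0) * x (l + u (2 * int m + 1)))) +
       (\<Sum>l\<in>H. sin (of_int (2 * z l + (2 * int m + 1)) * h) * (transport x (l + u (2 * int m + 1)) * x (l + 0)))))"
    unfolding transport_term_def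
    by (subst sum.swap) (simp add: sum_distrib_left algebra_simps flip: sum.distrib)
  also have "\<bar>\<dots>\<bar> \<le> (\<Sum>m<M. 1 * (Z + Z))"
  proof (rule order_trans[OF sum_abs sum_mono])
    fix m assume m: "m \<in> {..<M}"
    let ?q = "2 * int m + 1"
    let ?s = "\<lambda>l. sin (of_int (2 * z l + ?q) * h)"
    have "\<bar>\<Sum>l\<in>H. ?s l * (transport x (l + 0) * x (l + u ?q))\<bar> \<le> Z"
      unfolding Z_def by (rule sum_transport_product_bound[OF zero_in_periods u_period H abs_sin_le_one B])
    moreover have "\<bar>\<Sum>l\<in>H. ?s l * (transport x (l + u ?q) * x (l + 0))\<bar> \<le> Z"
      unfolding Z_def by (rule sum_transport_product_bound[OF u_period zero_in_periods H abs_sin_le_one B])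
    ultimately have sum_le: "\<bar>(\<Sum>l\<in>H. ?s l * (transport x (l + 0) * x (l + u ?q))) +
        (\<Sum>l\<in>H. ?s l * (transport x (l + u ?q) * x (l + 0)))\<bar> \<le> Z + Z"
      by (rule order_trans[OF abs_triangle_ineq add_mono])
    have "\<bar>fejer M m\<bar> \<le> 1" using m by (intro abs_fejer_le_1) auto
    from this sum_le show "\<bar>fejer M m * ((\<Sum>l\<in>H. ?s l * (transport x (l + 0) * x (l + u ?q))) +
        (\<Sum>l\<in>H. ?s l * (transport x (l + u ?q) * x (l + 0))))\<bar> \<le> 1 * (Z + Z)"
      unfolding abs_mult[of "fejer M m"] by (rule mult_mono) auto
  qed
  also have "(\<Sum>m<M. 1 * (Z + Z)) = real M * (2 * Z)" by simp
  finally have T: "\<bar>\<Sum>l\<in>H. transport_term h M x l\<bar> \<le> real M * (2 * Z)" .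
  have "(\<Sum>l\<in>H. main_term h M x l) = (\<Sum>l\<in>H. cos_corr h 0 x l) -
      (\<Sum>m=1..M. (-1) ^ m / real M * (\<Sum>l\<in>H. cos_corr h (2 * int m) x l))"
    unfolding main_term_def sum_subtractf sum_distrib_left sum_divide_distrib
    by (subst sum.swap) simp
  also have "\<bar>\<dots>\<bar> \<le> B + (\<Sum>m=1..M. 1 * B)"
  proof (rule order_trans[OF abs_triangle_ineq4 add_mono[OF cos_corr_bound[OF H B] order_trans[OF sum_abs sum_mono]]])
    fix m assume "m \<in> {1..M}"
    then have "\<bar>(-1) ^ m / real M\<bar> \<le> 1" by (simp add: power_abs)
    then show "\<bar>(-1) ^ m / real M * (\<Sum>l\<in>H. cos_corr h (2 * int m) x l)\<bar> \<le> 1 * B"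
      unfolding abs_mult by (intro mult_mono cos_corr_bound[OF H B]) auto
  qed
  also have "B + (\<Sum>m=1..M. 1 * B) = B + real M * B" by simp
  finally have X: "\<bar>\<Sum>l\<in>H. main_term h M x l\<bar> \<le> B + real M * B" .
  have "(\<Sum>l\<in>H. transport_term h M x l - c * main_term h M x l) =
     (\<Sum>l\<in>H. transport_term h M x l) - c * (\<Sum>l\<in>H. main_term h M x l)"
    by (simp add: sum_subtractf sum_distrib_left)
  also have "\<bar>\<dots>\<bar> \<le> real M * (2 * Z) + \<bar>c\<bar> * (B + real M * B)"
    using mult_left_mono[OF X, of "\<bar>c\<bar>"] T by (simp add: abs_mult order_trans[OF abs_triangle_ineq4])
  finally show ?thesis by (simp only: Z_def)
qed

text \<open>A plain Young inequality would pair \<open>lam l\<close> with y^2, which the dissipation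
  does not control. Splitting L + L' into twice the minimum plus the difference lets each square
  keep its own weight. The difference is one of two squares of frequencies at distance at most 2 M,
  hence linear in the frequencies, and \<open>\<mu>\<close> divides it between dissipation and
  energy.\<close>

lemma diffusion_pair:
  assumes "0 \<le> q" "q \<le> 2 * int M" "0 < \<mu>"
  shows "\<bar>(lam l + lam (l + u q)) * (x * y)\<bar> \<le>
    (1 + real M * \<mu>) * (lam l * x\<^sup>2 + lam (l + u q) * y\<^sup>2) + real M / \<mu> * (x\<^sup>2 + y\<^sup>2)"
proof -
  define p r where "p = \<bar>real_of_int (z l)\<bar>" and "r = \<bar>real_of_int (z l + q)\<bar>"
  define L L' where "L = lam l" and "L' = lam (l + u q)"
  have "0 \<le> L" "0 \<le> L'" by (simp_all add: L_def L'_def lam_nonneg)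
  moreover have "p\<^sup>2 \<le> L" "r\<^sup>2 \<le> L'" "L' - L = r\<^sup>2 - p\<^sup>2"
    unfolding L_def L'_def p_def r_def power2_abs
    using z_le_lam[of l] z_le_lam[of "l + u q", unfolded z_u] by (simp_all only: lam_u[of l q])
  ultimately have L: "0 \<le> L" "0 \<le> L'" "p\<^sup>2 \<le> L" "r\<^sup>2 \<le> L'" "L' - L = r\<^sup>2 - p\<^sup>2"
    by auto
  have pr: "0 \<le> p" "0 \<le> r" "\<bar>r - p\<bar> \<le> 2 * real M"
    using assms by (auto simp: p_def r_def)
  have "\<bar>L' - L\<bar> = \<bar>r - p\<bar> * (r + p)"
    using pr by (simp add: L(5) power2_eq_square square_diff_square_factored abs_mult)
  also have "\<dots> \<le> 2 * real M * (r + p)" using pr by (intro mult_right_mono) auto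
  finally have \<delta>: "\<bar>L' - L\<bar> \<le> 2 * real M * (r + p)" .
  have young: "2 * (s * \<bar>v * w\<bar>) \<le> \<mu> * (s\<^sup>2 * v\<^sup>2) + w\<^sup>2 / \<mu>" for s v w :: real
  proof -
    have "0 \<le> (\<mu> * (s * \<bar>v\<bar>) - \<bar>w\<bar>)\<^sup>2" by simp
    then have "\<mu> * (2 * (s * \<bar>v * w\<bar>)) \<le> \<mu> * (\<mu> * (s\<^sup>2 * v\<^sup>2) + w\<^sup>2 / \<mu>)"
      using assms by (simp add: power2_diff power_mult_distrib abs_mult distrib_left mult_ac power2_eq_square[of \<mu>])
    then show ?thesis using assms by simp
  qed
  have "\<bar>(L + L') * (x * y)\<bar> = (2 * min L L' + \<bar>L' - L\<bar>) * \<bar>x * y\<bar>"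
    using L by (auto simp: abs_mult)
  also have "\<dots> \<le> min L L' * (x\<^sup>2 + y\<^sup>2) + 2 * real M * (r + p) * \<bar>x * y\<bar>"
    using mult_left_mono[OF abs_mult_le_sum_squares[of x y], of "2 * min L L'"] mult_right_mono[OF \<delta>, of "\<bar>x * y\<bar>"] L
    by (simp add: distrib_right)
  also have "min L L' * (x\<^sup>2 + y\<^sup>2) \<le> L * x\<^sup>2 + L' * y\<^sup>2"
    by (simp add: distrib_left add_mono mult_right_mono)
  also have "2 * real M * (r + p) * \<bar>x * y\<bar> = real M * (2 * (r * \<bar>y * x\<bar>) + 2 * (p * \<bar>x * y\<bar>))"
    by (simp add: algebra_simps)
  also have "\<dots> \<le> real M * ((\<mu> * (r\<^sup>2 * y\<^sup>2) + x\<^sup>2 / \<mu>) + (\<mu> * (p\<^sup>2 * x\<^sup>2) + y\<^sup>2 / \<mu>))"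
    by (intro mult_left_mono add_mono young) auto
  also have "\<dots> \<le> real M * ((\<mu> * (L' * y\<^sup>2) + x\<^sup>2 / \<mu>) + (\<mu> * (L * x\<^sup>2) + y\<^sup>2 / \<mu>))"
    using L assms by (intro mult_left_mono add_mono mult_right_mono) auto
  finally show ?thesis
    by (simp add: L_def L'_def algebra_simps add_divide_distrib)
qed

text \<open>Translates of H remain in the bound because \<open>dissipation_bound\<close> can be
  applied to each of them separately.\<close>

lemma diffusion_term_bound:
  assumes H: "finite H" "H \<subseteq> \<Lambda>" and \<mu>: "0 < \<mu>" and B: "\<And>H. finite H \<Longrightarrow> H \<subseteq> \<Lambda> \<Longrightarrow> (\<Sum>l\<in>H. (x l)\<^sup>2) \<le> B"
  shows "\<bar>\<Sum>l\<in>H. diffusion_term h M x l\<bar> \<le> (\<Sum>m<M. (1 + real M * \<mu>) *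
     ((\<Sum>l\<in>H. lam l * (x l)\<^sup>2) + (\<Sum>l\<in>(\<lambda>l. l + u (2 * int m + 1)) ` H. lam l * (x l)\<^sup>2)) + real M / \<mu> * (2 * B))"
proof -
  have lin: "(\<Sum>l\<in>H. (1 + real M * \<mu>) * (lam l * (x l)\<^sup>2 + lam (l + u (2 * int m + 1)) * (x (l + u (2 * int m + 1)))\<^sup>2)
      + real M / \<mu> * ((x l)\<^sup>2 + (x (l + u (2 * int m + 1)))\<^sup>2)) = (1 + real M * \<mu>) *
     ((\<Sum>l\<in>H. lam l * (x l)\<^sup>2) + (\<Sum>l\<in>(\<lambda>l. l + u (2 * int m + 1)) ` H. lam l * (x l)\<^sup>2)) +
     real M / \<mu> * ((\<Sum>l\<in>H. (x l)\<^sup>2) + (\<Sum>l\<in>H. (x (l + u (2 * int m + 1)))\<^sup>2))" for m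
  proof -
    have shift: "(\<Sum>l\<in>H. lam (l + u (2 * int m + 1)) * (x (l + u (2 * int m + 1)))\<^sup>2) =
      (\<Sum>l\<in>(\<lambda>l. l + u (2 * int m + 1)) ` H. lam l * (x l)\<^sup>2)"
      by (rule sum_shift[where f = "\<lambda>l. lam l * (x l)\<^sup>2"])
    show ?thesis
      unfolding shift[symmetric] by (rule sum_affine_combination)
  qed
  define g where "g m l = fejer M m * (sin (of_int (2 * z l + (2 * int m + 1)) * h) *
     ((lam l + lam (l + u (2 * int m + 1))) * (x l * x (l + u (2 * int m + 1)))))" for m l
  define G where "G m = (1 + real M * \<mu>) *
     ((\<Sum>l\<in>H. lam l * (x l)\<^sup>2) + (\<Sum>l\<in>(\<lambda>l. l + u (2 * int m + 1)) ` H. lam l * (x l)\<^sup>2)) + real M / \<mu> * (2 * B)" for m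
  have bound: "\<bar>\<Sum>l\<in>H. g m l\<bar> \<le> G m" if m: "m < M" for m
  proof -
    let ?q = "2 * int m + 1"
    have g_le: "\<bar>g m l\<bar> \<le> (1 + real M * \<mu>) * (lam l * (x l)\<^sup>2 + lam (l + u ?q) * (x (l + u ?q))\<^sup>2)
      + real M / \<mu> * ((x l)\<^sup>2 + (x (l + u ?q))\<^sup>2)" for l
    proof -
      have "\<bar>fejer M m * sin (of_int (2 * z l + ?q) * h)\<bar> \<le> 1 * 1"
        unfolding abs_mult using m by (intro mult_mono abs_fejer_le_1) auto
      then have "\<bar>fejer M m * sin (of_int (2 * z l + ?q) * h)\<bar> * \<bar>(lam l + lam (l + u ?q)) * (x l * x (l + u ?q))\<bar> \<le>
         1 * \<bar>(lam l + lam (l + u ?q)) * (x l * x (l + u ?q))\<bar>"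
        by (intro mult_right_mono) auto
      then have "\<bar>g m l\<bar> \<le> \<bar>(lam l + lam (l + u ?q)) * (x l * x (l + u ?q))\<bar>"
        by (simp only: g_def abs_mult mult.assoc mult_1)
      moreover have "\<bar>(lam l + lam (l + u ?q)) * (x l * x (l + u ?q))\<bar> \<le> (1 + real M * \<mu>) * (lam l * (x l)\<^sup>2 + lam (l + u ?q) * (x (l + u ?q))\<^sup>2)
        + real M / \<mu> * ((x l)\<^sup>2 + (x (l + u ?q))\<^sup>2)"
        using m by (intro diffusion_pair[OF _ _ \<mu>]) auto
      ultimately show ?thesis by (rule order_trans)
    qed
    have "(\<Sum>l\<in>H. (x (l + u ?q))\<^sup>2) \<le> B"
      by (rule sum_shift_le[where f = "\<lambda>l. (x l)\<^sup>2", OF u_period H(2,1) B])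
    then have "(\<Sum>l\<in>H. (x l)\<^sup>2) + (\<Sum>l\<in>H. (x (l + u ?q))\<^sup>2) \<le> 2 * B"
      using B[OF H] by simp
    then have "real M / \<mu> * ((\<Sum>l\<in>H. (x l)\<^sup>2) + (\<Sum>l\<in>H. (x (l + u ?q))\<^sup>2)) \<le> real M / \<mu> * (2 * B)"
      using \<mu> by (intro mult_left_mono) auto
    then have "(\<Sum>l\<in>H. (1 + real M * \<mu>) * (lam l * (x l)\<^sup>2 + lam (l + u ?q) * (x (l + u ?q))\<^sup>2)
        + real M / \<mu> * ((x l)\<^sup>2 + (x (l + u ?q))\<^sup>2)) \<le> G m"
      unfolding lin[of m] G_def by (rule add_left_mono)
    moreover have "\<bar>\<Sum>l\<in>H. g m l\<bar> \<le> (\<Sum>l\<in>H. (1 + real M * \<mu>) * (lam l * (x l)\<^sup>2 + lam (l + u ?q) * (x (l + u ?q))\<^sup>2)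
        + real M / \<mu> * ((x l)\<^sup>2 + (x (l + u ?q))\<^sup>2))"
      by (rule order_trans[OF sum_abs sum_mono[OF g_le]])
    ultimately show ?thesis by simp
  qed
  have "(\<Sum>l\<in>H. diffusion_term h M x l) = (\<Sum>m<M. \<Sum>l\<in>H. g m l)"
    unfolding diffusion_term_def g_def by (rule sum.swap)
  moreover have "\<bar>\<Sum>m<M. \<Sum>l\<in>H. g m l\<bar> \<le> (\<Sum>m<M. G m)"
    using bound by (intro order_trans[OF sum_abs sum_mono]) auto
  ultimately show ?thesis unfolding G_def by simp
qed

lemma sum_swap_weighted_le:
  fixes f :: "'x \<Rightarrow> real"
  assumes "\<And>l. l \<in> H \<Longrightarrow> 0 \<le> f l" "\<And>l. l \<in> H \<Longrightarrow> (\<Sum>m\<in>A. g m l) \<le> c"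
  shows "(\<Sum>m\<in>A. \<Sum>l\<in>H. f l * g m l) \<le> (\<Sum>l\<in>H. f l * c)"
proof -
  have "(\<Sum>m\<in>A. \<Sum>l\<in>H. f l * g m l) = (\<Sum>l\<in>H. f l * (\<Sum>m\<in>A. g m l))"
    by (subst sum.swap) (simp add: sum_distrib_left)
  also have "\<dots> \<le> (\<Sum>l\<in>H. f l * c)"
    using assms by (intro sum_mono mult_left_mono)
  finally show ?thesis .
qed

definition weight :: "real \<Rightarrow> int \<Rightarrow> real" where
  "weight b p = 1 + b\<^sup>2 * (of_int p)\<^sup>2"

lemma weight_pos: "0 < weight b p"
  by (simp add: weight_def add_pos_nonneg)

lemma sum_weight_le:
  assumes "finite H" "H \<subseteq> \<Lambda>" and B: "\<And>H. finite H \<Longrightarrow> H \<subseteq> \<Lambda> \<Longrightarrow> (\<Sum>l\<in>H. (x l)\<^sup>2) \<le> B"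
  shows "(\<Sum>l\<in>H. weight b (z l) * (x l)\<^sup>2) \<le> B + b\<^sup>2 * (\<Sum>l\<in>H. lam l * (x l)\<^sup>2)"
proof -
  have "(\<Sum>l\<in>H. weight b (z l) * (x l)\<^sup>2) = (\<Sum>l\<in>H. (x l)\<^sup>2) + b\<^sup>2 * (\<Sum>l\<in>H. (of_int (z l))\<^sup>2 * (x l)\<^sup>2)"
    by (simp add: weight_def sum.distrib sum_distrib_left algebra_simps)
  also have "\<dots> \<le> B + b\<^sup>2 * (\<Sum>l\<in>H. lam l * (x l)\<^sup>2)"
    using assms by (intro add_mono mult_left_mono sum_mono mult_right_mono z_le_lam) auto
  finally show ?thesis .
qed

text \<open>Schur's test with the weight \<open>1 + b\<^sup>2 z\<^sup>2\<close>, the lattice form of the one-dimensional Sobolev inequality.\<close>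

lemma schur_bound:
  assumes H: "finite H" "H \<subseteq> \<Lambda>" and b: "0 < b" "b \<le> 1"
    and B: "\<And>H. finite H \<Longrightarrow> H \<subseteq> \<Lambda> \<Longrightarrow> (\<Sum>l\<in>H. (x l)\<^sup>2) \<le> B"
  shows "(\<Sum>m=1..M. \<Sum>l\<in>H. \<bar>x l * x (l + u (2 * int m))\<bar>) \<le> 5 / (2 * b) * (2 * B + b\<^sup>2 *
     ((\<Sum>l\<in>H. lam l * (x l)\<^sup>2) + (\<Sum>l\<in>(\<Union>m\<in>{1..M}. (\<lambda>l. l + u (2 * int m)) ` H). lam l * (x l)\<^sup>2)))"
proof -
  define H' where "H' = (\<Union>m\<in>{1..M}. (\<lambda>l. l + u (2 * int m)) ` H)"
  have H': "finite H'" "H' \<subseteq> \<Lambda>"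
    using H periodsD[OF u_period] by (auto simp: H'_def)
  let ?w = "\<lambda>l. weight b (z l)"
  have "(\<Sum>m=1..M. \<Sum>l\<in>H. \<bar>x l * x (l + u (2 * int m))\<bar>) \<le>
    (\<Sum>m=1..M. \<Sum>l\<in>H. (?w l * (x l)\<^sup>2 * (1 / weight b (z l + 2 * int m)) +
       ?w (l + u (2 * int m)) * (x (l + u (2 * int m)))\<^sup>2 * (1 / weight b (z (l + u (2 * int m)) - 2 * int m))) / 2)"
  proof (intro sum_mono)
    fix m l
    define v w where "v = ?w l" and "w = weight b (z l + 2 * int m)"
    have vw: "0 < v" "0 < w" by (auto simp: v_def w_def weight_pos)
    define y where "y = x (l + u (2 * int m))"
    \<comment> \<open>Weighted Young inequality: each square carries its own weight and the
      reciprocal of the other one, and only the reciprocals are summed over m.\<close>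
    have "\<bar>x l * y\<bar> = \<bar>(x l * sqrt (v / w)) * (y * sqrt (w / v))\<bar>"
      using vw by (simp add: real_sqrt_divide)
    also have "\<dots> \<le> ((x l * sqrt (v / w))\<^sup>2 + (y * sqrt (w / v))\<^sup>2) / 2"
      by (rule abs_mult_le_sum_squares)
    also have "\<dots> = (v * (x l)\<^sup>2 * (1 / w) + w * y\<^sup>2 * (1 / v)) / 2"
      using vw by (simp add: power_mult_distrib mult_ac)
    finally show "\<bar>x l * x (l + u (2 * int m))\<bar> \<le> (?w l * (x l)\<^sup>2 * (1 / weight b (z l + 2 * int m)) +
       ?w (l + u (2 * int m)) * (x (l + u (2 * int m)))\<^sup>2 * (1 / weight b (z (l + u (2 * int m)) - 2 * int m))) / 2"
      by (simp add: v_def w_def y_def z_u)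
  qed
  also have "\<dots> = ((\<Sum>m=1..M. \<Sum>l\<in>H. ?w l * (x l)\<^sup>2 * (1 / weight b (z l + 2 * int m))) +
      (\<Sum>m=1..M. \<Sum>l\<in>H. ?w (l + u (2 * int m)) * (x (l + u (2 * int m)))\<^sup>2 * (1 / weight b (z (l + u (2 * int m)) - 2 * int m)))) / 2"
    by (simp only: sum.distrib sum_divide_distrib[symmetric])
  also have "\<dots> \<le> ((\<Sum>l\<in>H. ?w l * (x l)\<^sup>2 * (5 / b)) + (\<Sum>l\<in>H'. ?w l * (x l)\<^sup>2 * (5 / b))) / 2"
  proof (intro divide_right_mono add_mono)
    have inj: "inj_on (\<lambda>m. p + 2 * int m) {1..M}" "inj_on (\<lambda>m. p - 2 * int m) {1..M}" for p
      by (auto simp: inj_on_def)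
    show "(\<Sum>m=1..M. \<Sum>l\<in>H. ?w l * (x l)\<^sup>2 * (1 / weight b (z l + 2 * int m))) \<le> (\<Sum>l\<in>H. ?w l * (x l)\<^sup>2 * (5 / b))"
    proof (rule sum_swap_weighted_le)
      fix l show "(\<Sum>m=1..M. 1 / weight b (z l + 2 * int m)) \<le> 5 / b"
        unfolding weight_def by (rule sum_inverse_weights[OF b inj(1)]) simp
    qed (intro mult_nonneg_nonneg less_imp_le[OF weight_pos] zero_le_power2)
    have "(\<Sum>m=1..M. \<Sum>l\<in>H. ?w (l + u (2 * int m)) * (x (l + u (2 * int m)))\<^sup>2 * (1 / weight b (z (l + u (2 * int m)) - 2 * int m)))
       = (\<Sum>m=1..M. \<Sum>l\<in>(\<lambda>l. l + u (2 * int m)) ` H. ?w l * (x l)\<^sup>2 * (1 / weight b (z l - 2 * int m)))"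
    proof (rule sum.cong[OF refl])
      fix m show "(\<Sum>l\<in>H. ?w (l + u (2 * int m)) * (x (l + u (2 * int m)))\<^sup>2 * (1 / weight b (z (l + u (2 * int m)) - 2 * int m)))
       = (\<Sum>l\<in>(\<lambda>l. l + u (2 * int m)) ` H. ?w l * (x l)\<^sup>2 * (1 / weight b (z l - 2 * int m)))"
        by (rule sum_shift[where f = "\<lambda>l. ?w l * (x l)\<^sup>2 * (1 / weight b (z l - 2 * int m))"])
    qed
    also have "\<dots> \<le> (\<Sum>m=1..M. \<Sum>l\<in>H'. ?w l * (x l)\<^sup>2 * (1 / weight b (z l - 2 * int m)))"
      using H' by (intro sum_mono sum_mono2) (auto simp: H'_def less_imp_le[OF weight_pos])
    also have "\<dots> \<le> (\<Sum>l\<in>H'. ?w l * (x l)\<^sup>2 * (5 / b))"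
    proof (rule sum_swap_weighted_le)
      fix l show "(\<Sum>m=1..M. 1 / weight b (z l - 2 * int m)) \<le> 5 / b"
        unfolding weight_def by (rule sum_inverse_weights[OF b inj(2)]) simp
    qed (intro mult_nonneg_nonneg less_imp_le[OF weight_pos] zero_le_power2)
    finally show "(\<Sum>m=1..M. \<Sum>l\<in>H. ?w (l + u (2 * int m)) * (x (l + u (2 * int m)))\<^sup>2 * (1 / weight b (z (l + u (2 * int m)) - 2 * int m)))
       \<le> (\<Sum>l\<in>H'. ?w l * (x l)\<^sup>2 * (5 / b))" .
  qed simp
  also have "\<dots> = 5 / (2 * b) * ((\<Sum>l\<in>H. ?w l * (x l)\<^sup>2) + (\<Sum>l\<in>H'. ?w l * (x l)\<^sup>2))"
    by (simp only: sum_distrib_right[symmetric]) (simp add: algebra_simps add_divide_distrib)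
  also have "\<dots> \<le> 5 / (2 * b) * ((B + b\<^sup>2 * (\<Sum>l\<in>H. lam l * (x l)\<^sup>2)) + (B + b\<^sup>2 * (\<Sum>l\<in>H'. lam l * (x l)\<^sup>2)))"
    using b by (intro mult_left_mono add_mono sum_weight_le H H' B) auto
  finally show ?thesis
    unfolding H'_def[symmetric] by (simp add: distrib_left add_ac)
qed

text \<open>The loss 2 h^2 comes from cos(2 z h) >= 1 - 2 z^2 h^2. The even correlations are
  estimated in absolute value: by \<open>schur_bound\<close> their sum grows like 1 / b rather than
  like M, so the average leaves the factor 1 / (b M).\<close>

lemma main_term_lower_bound:
  assumes H: "finite H" "H \<subseteq> \<Lambda>" and b: "0 < b" "b \<le> 1" and M: "0 < M"
    and B: "\<And>H. finite H \<Longrightarrow> H \<subseteq> \<Lambda> \<Longrightarrow> (\<Sum>l\<in>H. (x l)\<^sup>2) \<le> B"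
  shows "(\<Sum>l\<in>H. (x l)\<^sup>2) - 2 * h\<^sup>2 * (\<Sum>l\<in>H. lam l * (x l)\<^sup>2) - 5 / (2 * b * real M) * (2 * B + b\<^sup>2 *
     ((\<Sum>l\<in>H. lam l * (x l)\<^sup>2) + (\<Sum>l\<in>(\<Union>m\<in>{1..M}. (\<lambda>l. l + u (2 * int m)) ` H). lam l * (x l)\<^sup>2)))
     \<le> (\<Sum>l\<in>H. main_term h M x l)"
proof -
  have "(\<Sum>l\<in>H. \<Sum>m=1..M. (-1) ^ m * cos_corr h (2 * int m) x l) \<le> (\<Sum>l\<in>H. \<Sum>m=1..M. \<bar>x l * x (l + u (2 * int m))\<bar>)"
  proof (intro sum_mono)
    fix l m
    have "(-1) ^ m * cos_corr h (2 * int m) x l \<le> \<bar>(-1) ^ m * cos_corr h (2 * int m) x l\<bar>" by simp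
    also have "\<dots> = \<bar>cos (of_int (2 * z l + 2 * int m) * h)\<bar> * \<bar>x l * x (l + u (2 * int m))\<bar>"
      by (simp add: cos_corr_def abs_mult power_abs)
    also have "\<dots> \<le> 1 * \<bar>x l * x (l + u (2 * int m))\<bar>"
      by (intro mult_right_mono abs_cos_le_one) auto
    finally show "(-1) ^ m * cos_corr h (2 * int m) x l \<le> \<bar>x l * x (l + u (2 * int m))\<bar>" by simp
  qed
  also have "\<dots> = (\<Sum>m=1..M. \<Sum>l\<in>H. \<bar>x l * x (l + u (2 * int m))\<bar>)" by (rule sum.swap)
  also note schur_bound[OF H b B]
  finally have "(\<Sum>l\<in>H. \<Sum>m=1..M. (-1) ^ m * cos_corr h (2 * int m) x l) / real M \<le>
     5 / (2 * b) * (2 * B + b\<^sup>2 * ((\<Sum>l\<in>H. lam l * (x l)\<^sup>2) +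
      (\<Sum>l\<in>(\<Union>m\<in>{1..M}. (\<lambda>l. l + u (2 * int m)) ` H). lam l * (x l)\<^sup>2))) / real M"
    by (rule divide_right_mono) auto
  moreover have "(\<Sum>l\<in>H. (x l)\<^sup>2) - 2 * h\<^sup>2 * (\<Sum>l\<in>H. lam l * (x l)\<^sup>2) \<le> (\<Sum>l\<in>H. cos_corr h 0 x l)"
  proof -
    have "(x l)\<^sup>2 - 2 * h\<^sup>2 * (lam l * (x l)\<^sup>2) \<le> cos_corr h 0 x l" for l
    proof -
      have "1 - 2 * h\<^sup>2 * lam l \<le> 1 - 2 * h\<^sup>2 * (of_int (z l))\<^sup>2"
        using z_le_lam[of l] by (simp add: mult_left_mono)
      also have "\<dots> = 1 - (of_int (2 * z l) * h)\<^sup>2 / 2" by (simp add: power_mult_distrib)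
      also have "\<dots> \<le> cos (of_int (2 * z l) * h)" by (rule cos_ge_one_minus_square)
      finally have "(1 - 2 * h\<^sup>2 * lam l) * (x l)\<^sup>2 \<le> cos (of_int (2 * z l) * h) * (x l)\<^sup>2"
        by (rule mult_right_mono) simp
      then show ?thesis by (simp add: cos_corr_def algebra_simps power2_eq_square)
    qed
    then have "(\<Sum>l\<in>H. (x l)\<^sup>2 - 2 * h\<^sup>2 * (lam l * (x l)\<^sup>2)) \<le> (\<Sum>l\<in>H. cos_corr h 0 x l)"
      by (intro sum_mono)
    then show ?thesis by (simp add: sum_subtractf sum_distrib_left)
  qed
  ultimately show ?thesis
    by (simp add: main_term_def sum_subtractf sum_divide_distrib[symmetric])
qed

section \<open>Time integration of the correlations\<close>

lemma u_mem: "l \<in> \<Lambda> \<Longrightarrow> l + u q \<in> \<Lambda>"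
  using periodsD[OF u_period] by blast

lemma corr_has_derivative:
  assumes t: "t \<in> {t0..t1}" and l: "l \<in> \<Lambda>"
  shows "((\<lambda>t. corr h M (a t) l) has_real_derivative
     - \<nu> * diffusion_term h M (a t) l - 1 / 2 * transport_term h M (a t) l) (at t within {t0..t1})"
proof -
  define a' where "a' l = - \<nu> * lam l * a t l - 1 / 2 * transport (a t) l" for l
  have a': "((\<lambda>t. a t l) has_real_derivative a' l) (at t within {t0..t1})" if "l \<in> \<Lambda>" for l
    using ode[OF t that] \<phi>_1[OF t] by (simp add: a'_def transport_def)
  have "((\<lambda>t. corr h M (a t) l) has_real_derivative (\<Sum>m<M. fejer M m * (sin (of_int (2 * z l + (2 * int m + 1)) * h) *
     (a' l * a t (l + u (2 * int m + 1)) + a' (l + u (2 * int m + 1)) * a t l)))) (at t within {t0..t1})"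
    unfolding corr_def sin_corr_def by (intro DERIV_sum DERIV_cmult DERIV_mult a' l u_mem)
  moreover have "(\<Sum>m<M. fejer M m * (sin (of_int (2 * z l + (2 * int m + 1)) * h) *
     (a' l * a t (l + u (2 * int m + 1)) + a' (l + u (2 * int m + 1)) * a t l))) =
     - \<nu> * diffusion_term h M (a t) l - 1 / 2 * transport_term h M (a t) l"
    unfolding diffusion_term_def transport_term_def sum_distrib_left sum_subtractf[symmetric]
    by (intro sum.cong refl) (simp add: a'_def algebra_simps)
  ultimately show ?thesis by simp
qed

lemma continuous_on_transport: "l \<in> \<Lambda> \<Longrightarrow> continuous_on {t0..t1} (\<lambda>t. transport (a t) l)"
  unfolding transport_def by (intro continuous_intros continuous_on_coeff shift_mem) auto

lemma continuous_on_terms: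
  assumes "l \<in> \<Lambda>"
  shows "continuous_on {t0..t1} (\<lambda>t. corr h M (a t) l)" "continuous_on {t0..t1} (\<lambda>t. main_term h M (a t) l)"
    "continuous_on {t0..t1} (\<lambda>t. transport_term h M (a t) l)" "continuous_on {t0..t1} (\<lambda>t. diffusion_term h M (a t) l)"
  unfolding corr_def main_term_def transport_term_def diffusion_term_def sin_corr_def cos_corr_def divide_inverse
  by (intro continuous_intros continuous_on_coeff continuous_on_transport u_mem assms)+

text \<open>Integrate the derivative of the correlation sum: its boundary values are at most M times
  the energy and diffusion is paid by the total dissipation, so the time integral of the main term
  is bounded above. Its lower bound contains the final energy times the length of the interval,
  since the energy decreases. All parameters stay free and are balanced in
  \<open>mixing_decay\<close>.\<close>

lemma mixing_estimate:
  assumes t01: "t0 \<le> t1" and \<nu>: "0 < \<nu>" and h: "0 < h" "h \<le> 1" and b: "0 < b" "b \<le> 1"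
    and M: "0 < M" and \<mu>: "0 < \<mu>"
  shows "h / 2 * ((t1 - t0) * energy t1 - h\<^sup>2 * energy t0 / \<nu> -
      5 / (b * real M) * (energy t0 * (t1 - t0) + b\<^sup>2 * energy t0 / (2 * \<nu>)))
    \<le> 2 * real M * energy t0 + real M * (1 + real M * \<mu>) * energy t0 + 2 * \<nu> * (real M)\<^sup>2 * energy t0 * (t1 - t0) / \<mu>"
proof -
  obtain F where F: "\<And>N. finite (F N)" "\<And>N. F N \<subseteq> \<Lambda>"
    "filterlim F (finite_subsets_at_top \<Lambda>) sequentially"
    using countable_exhaustion[OF countable] by metis
  define B where "B = energy t0"
  define T where "T = t1 - t0"
  have B0: "0 \<le> B" by (simp add: B_def energy_nonneg)
  have T0: "0 \<le> T" using t01 by (simp add: T_def)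
  have bound: "(\<Sum>l\<in>H. (a r l)\<^sup>2) \<le> B" if "r \<in> {t0..t1}" "finite H" "H \<subseteq> \<Lambda>" for r H
    using sum_le_energy[OF that] energy_antimono[of t0 r] that(1) by (simp add: B_def)
  define D where "D H r = (\<Sum>l\<in>H. lam l * (a r l)\<^sup>2)" for H r
  have contD: "continuous_on {t0..t1} (D H)" if "H \<subseteq> \<Lambda>" for H
    unfolding D_def using that by (intro continuous_intros continuous_on_coeff) auto
  have D_int: "(D H has_integral integral {t0..t1} (D H)) {t0..t1}" if "H \<subseteq> \<Lambda>" for H
    using contD[OF that] by (intro integrable_integral integrable_continuous_real)
  have D_le: "integral {t0..t1} (D H) \<le> B / (2 * \<nu>)" if "finite H" "H \<subseteq> \<Lambda>" for H
    using dissipation_bound[OF t01 that] \<nu> by (simp add: D_def[abs_def] B_def field_simps)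
  have const_int: "((\<lambda>_. c) has_integral c * T) {t0..t1}" for c :: real
    using has_integral_const_real[of c t0 t1] t01 by (simp add: T_def mult.commute)
  define G where "G N r = (\<Sum>l\<in>F N. corr h M (a r) l)" for N r
  define X where "X N r = (\<Sum>l\<in>F N. main_term h M (a r) l)" for N r
  define Q where "Q N r = (\<Sum>l\<in>F N. diffusion_term h M (a r) l)" for N r
  define R where "R N r = (\<Sum>l\<in>F N. transport_term h M (a r) l - 2 * \<kappa> j * sin h * main_term h M (a r) l)" for N r
  define S where "S N r = (\<Sum>l\<in>F N. (a r l)\<^sup>2)" for N r
  \<comment> \<open>The shortfall of the truncated energy below the final energy. As the energy
    decreases, it tends to 0 pointwise; it is continuous and bounded, so its integral does
    too.\<close>
  define P where "P N r = max 0 (energy t1 - S N r)" for N r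
  have mem: "l \<in> \<Lambda>" if "l \<in> F N" for l N using F(2) that by auto
  have cont: "continuous_on {t0..t1} (X N)" "continuous_on {t0..t1} (Q N)" "continuous_on {t0..t1} (R N)"
    "continuous_on {t0..t1} (S N)" "continuous_on {t0..t1} (P N)" for N
    unfolding X_def Q_def R_def S_def P_def
    by (intro continuous_intros continuous_on_terms continuous_on_coeff mem; assumption)+
  have int: "(X N has_integral integral {t0..t1} (X N)) {t0..t1}" "(Q N has_integral integral {t0..t1} (Q N)) {t0..t1}"
    "(R N has_integral integral {t0..t1} (R N)) {t0..t1}" "(S N has_integral integral {t0..t1} (S N)) {t0..t1}"
    "(P N has_integral integral {t0..t1} (P N)) {t0..t1}" for N
    by (intro integrable_integral integrable_continuous_real cont)+
  have limR: "(\<lambda>N. integral {t0..t1} (R N)) \<longlonglongrightarrow> 0"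
  proof (rule integral_LIMSEQ_0[OF cont(3)])
    fix N r assume r: "r \<in> {t0..t1}"
    show "\<bar>R N r\<bar> \<le> real M * (2 * (\<Sum>i\<in>I. \<bar>\<kappa> i\<bar> * (2 * B))) + \<bar>2 * \<kappa> j * sin h\<bar> * (B + real M * B)"
      unfolding R_def by (rule remainder_bound[OF F(1,2) bound[OF r]])
  next
    fix r assume r: "r \<in> {t0..t1}"
    show "(\<lambda>N. R N r) \<longlonglongrightarrow> 0"
      unfolding R_def
      by (rule has_sum_imp_LIMSEQ[OF transport_term_minus_main_term_has_sum[OF square_summable[OF r] M] F(3)])
  qed
  have limP: "(\<lambda>N. integral {t0..t1} (P N)) \<longlonglongrightarrow> 0"
  proof (rule integral_LIMSEQ_0[OF cont(5)])
    fix N r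
    show "\<bar>P N r\<bar> \<le> energy t1"
      using energy_nonneg[of t1] sum_nonneg[of "F N" "\<lambda>l. (a r l)\<^sup>2"] by (auto simp: P_def S_def)
  next
    fix r assume r: "r \<in> {t0..t1}"
    have "(\<lambda>N. P N r) \<longlonglongrightarrow> max 0 (energy t1 - energy r)"
      unfolding P_def S_def
      by (intro tendsto_intros has_sum_imp_LIMSEQ[OF energy_has_sum[OF r] F(3)])
    moreover have "max 0 (energy t1 - energy r) = 0"
      using energy_antimono[of r t1] r by simp
    ultimately show "(\<lambda>N. P N r) \<longlonglongrightarrow> 0" by simp
  qed
  have Q_le: "\<nu> * \<bar>integral {t0..t1} (Q N)\<bar> \<le> real M * (1 + real M * \<mu>) * B + 2 * \<nu> * (real M)\<^sup>2 * B * T / \<mu>" for N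
  proof -
    define Hs where "Hs m = (\<lambda>l. l + u (2 * int m + 1)) ` F N" for m
    have Hs: "finite (Hs m)" "Hs m \<subseteq> \<Lambda>" for m
      using F(1) u_mem[OF mem] by (auto simp: Hs_def)
    define c1 c2 where "c1 = 1 + real M * \<mu>" and "c2 = real M / \<mu> * (2 * B)"
    have c1: "0 \<le> c1" using \<mu> by (simp add: c1_def)
    define V where "V = (\<Sum>m<M. c1 * (integral {t0..t1} (D (F N)) + integral {t0..t1} (D (Hs m))) + c2 * T)"
    have V_int: "((\<lambda>r. \<Sum>m<M. c1 * (D (F N) r + D (Hs m) r) + c2) has_integral V) {t0..t1}"
      unfolding V_def by (intro has_integral_sum has_integral_add has_integral_mult_right D_int F Hs const_int) auto
    have Q_bd: "\<bar>Q N r\<bar> \<le> (\<Sum>m<M. c1 * (D (F N) r + D (Hs m) r) + c2)" if r: "r \<in> {t0..t1}" for r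
      unfolding Q_def c1_def c2_def D_def Hs_def by (rule diffusion_term_bound[OF F(1,2) \<mu> bound[OF r]])
    have "integral {t0..t1} (Q N) \<le> V"
      by (rule has_integral_le[OF int(2) V_int]) (use Q_bd abs_le_D1 in blast)
    moreover have "- integral {t0..t1} (Q N) \<le> V"
      by (rule has_integral_le[OF has_integral_neg[OF int(2)] V_int]) (use Q_bd abs_le_D2 in blast)
    ultimately have "\<bar>integral {t0..t1} (Q N)\<bar> \<le> V" by simp
    also have "V \<le> (\<Sum>m<M. c1 * (B / (2 * \<nu>) + B / (2 * \<nu>)) + c2 * T)"
      unfolding V_def using c1 by (intro sum_mono add_mono mult_left_mono D_le F Hs order_refl)
    finally have "\<nu> * \<bar>integral {t0..t1} (Q N)\<bar> \<le> \<nu> * (\<Sum>m<M. c1 * (B / (2 * \<nu>) + B / (2 * \<nu>)) + c2 * T)"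
      using \<nu> by (intro mult_left_mono) auto
    also have "\<dots> = real M * (1 + real M * \<mu>) * B + 2 * \<nu> * (real M)\<^sup>2 * B * T / \<mu>"
      using \<nu> \<mu> by (simp add: c1_def c2_def field_simps power2_eq_square)
    finally show ?thesis .
  qed
  have X_ge: "T * energy t1 - integral {t0..t1} (P N) - h\<^sup>2 * B / \<nu> - 5 / (b * real M) * (B * T + b\<^sup>2 * B / (2 * \<nu>))
      \<le> integral {t0..t1} (X N)" for N
  proof -
    define H' where "H' = (\<Union>m\<in>{1..M}. (\<lambda>l. l + u (2 * int m)) ` F N)"
    have H': "finite H'" "H' \<subseteq> \<Lambda>"
      using F(1) u_mem[OF mem] by (auto simp: H'_def)
    define c where "c = 5 / (2 * b * real M)"
    have c: "0 \<le> c" using b by (simp add: c_def)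
    have "((\<lambda>r. energy t1 - P N r - 2 * h\<^sup>2 * D (F N) r - c * (2 * B + b\<^sup>2 * (D (F N) r + D H' r))) has_integral
      (energy t1 * T - integral {t0..t1} (P N) - 2 * h\<^sup>2 * integral {t0..t1} (D (F N)) -
       c * (2 * B * T + b\<^sup>2 * (integral {t0..t1} (D (F N)) + integral {t0..t1} (D H'))))) {t0..t1}"
      by (intro has_integral_diff has_integral_add has_integral_mult_right const_int int D_int F H')
    then have "energy t1 * T - integral {t0..t1} (P N) - 2 * h\<^sup>2 * integral {t0..t1} (D (F N)) -
       c * (2 * B * T + b\<^sup>2 * (integral {t0..t1} (D (F N)) + integral {t0..t1} (D H'))) \<le> integral {t0..t1} (X N)"
    proof (rule has_integral_le[OF _ int(1)])
      fix r assume r: "r \<in> {t0..t1}"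
      have "S N r - 2 * h\<^sup>2 * D (F N) r - c * (2 * B + b\<^sup>2 * (D (F N) r + D H' r)) \<le> X N r"
        unfolding S_def D_def X_def c_def H'_def
        by (rule main_term_lower_bound[OF F(1,2) b M bound[OF r]])
      moreover have "energy t1 - P N r \<le> S N r" by (simp add: P_def)
      ultimately show "energy t1 - P N r - 2 * h\<^sup>2 * D (F N) r - c * (2 * B + b\<^sup>2 * (D (F N) r + D H' r)) \<le> X N r"
        by linarith
    qed
    moreover have "2 * h\<^sup>2 * integral {t0..t1} (D (F N)) \<le> 2 * h\<^sup>2 * (B / (2 * \<nu>))"
      by (intro mult_left_mono D_le F) auto
    moreover have "c * (2 * B * T + b\<^sup>2 * (integral {t0..t1} (D (F N)) + integral {t0..t1} (D H'))) \<le>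
      c * (2 * B * T + b\<^sup>2 * (B / (2 * \<nu>) + B / (2 * \<nu>)))"
      using c by (intro mult_left_mono add_mono D_le F H' order_refl) auto
    moreover have "2 * h\<^sup>2 * (B / (2 * \<nu>)) = h\<^sup>2 * B / \<nu>" by simp
    moreover have "c * (2 * B * T + b\<^sup>2 * (B / (2 * \<nu>) + B / (2 * \<nu>))) = 5 / (b * real M) * (B * T + b\<^sup>2 * B / (2 * \<nu>))"
      using b M \<nu> by (simp add: c_def field_simps)
    ultimately show ?thesis by (simp add: mult.commute[of T])
  qed
  have ineq: "h / 2 * (T * energy t1 - integral {t0..t1} (P N) - h\<^sup>2 * B / \<nu> - 5 / (b * real M) * (B * T + b\<^sup>2 * B / (2 * \<nu>)))
      \<le> 2 * real M * B + real M * (1 + real M * \<mu>) * B + 2 * \<nu> * (real M)\<^sup>2 * B * T / \<mu> + 1 / 2 * \<bar>integral {t0..t1} (R N)\<bar>" for N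
  proof -
    have "((\<lambda>r. - \<nu> * Q N r - 1 / 2 * R N r - \<kappa> j * sin h * X N r) has_integral G N t1 - G N t0) {t0..t1}"
    proof (rule fundamental_theorem_of_calculus[OF t01])
      fix r assume r: "r \<in> {t0..t1}"
      have "(G N has_real_derivative (\<Sum>l\<in>F N. - \<nu> * diffusion_term h M (a r) l - 1 / 2 * transport_term h M (a r) l)) (at r within {t0..t1})"
        unfolding G_def by (intro DERIV_sum corr_has_derivative r mem)
      moreover have "(\<Sum>l\<in>F N. - \<nu> * diffusion_term h M (a r) l - 1 / 2 * transport_term h M (a r) l) =
          - \<nu> * Q N r - 1 / 2 * R N r - \<kappa> j * sin h * X N r"
        unfolding Q_def R_def X_def sum_distrib_left sum_subtractf[symmetric]
        by (intro sum.cong refl) (simp add: algebra_simps)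
      ultimately show "(G N has_vector_derivative - \<nu> * Q N r - 1 / 2 * R N r - \<kappa> j * sin h * X N r) (at r within {t0..t1})"
        by (simp add: has_real_derivative_iff_has_vector_derivative)
    qed
    moreover have "((\<lambda>r. - \<nu> * Q N r - 1 / 2 * R N r - \<kappa> j * sin h * X N r) has_integral
        - \<nu> * integral {t0..t1} (Q N) - 1 / 2 * integral {t0..t1} (R N) - \<kappa> j * sin h * integral {t0..t1} (X N)) {t0..t1}"
      by (intro has_integral_diff has_integral_mult_right int)
    ultimately have "G N t1 - G N t0 = - \<nu> * integral {t0..t1} (Q N) - 1 / 2 * integral {t0..t1} (R N) -
        \<kappa> j * sin h * integral {t0..t1} (X N)"
      by (rule has_integral_unique)
    moreover have "\<bar>G N r\<bar> \<le> real M * B" if "r \<in> {t0..t1}" for r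
      unfolding G_def by (rule corr_bound[OF F(1,2) bound[OF that]])
    from this[of t0] this[of t1] have "\<bar>G N t0\<bar> \<le> real M * B" "\<bar>G N t1\<bar> \<le> real M * B"
      using t01 by auto
    moreover have "\<bar>- \<nu> * integral {t0..t1} (Q N)\<bar> \<le> real M * (1 + real M * \<mu>) * B + 2 * \<nu> * (real M)\<^sup>2 * B * T / \<mu>"
      using Q_le[of N] \<nu> by (simp add: abs_mult)
    ultimately have "\<bar>\<kappa> j * sin h * integral {t0..t1} (X N)\<bar> \<le> 2 * real M * B +
       (real M * (1 + real M * \<mu>) * B + 2 * \<nu> * (real M)\<^sup>2 * B * T / \<mu>) + 1 / 2 * \<bar>integral {t0..t1} (R N)\<bar>"
      by linarith
    moreover have "h / 2 * \<bar>integral {t0..t1} (X N)\<bar> \<le> \<bar>\<kappa> j * sin h * integral {t0..t1} (X N)\<bar>"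
    proof -
      have "1 * (h / 2) \<le> \<bar>\<kappa> j\<bar> * \<bar>sin h\<bar>"
        using sin_ge_half[of h] h \<kappa>_ge_1 by (intro mult_mono) auto
      then show ?thesis
        unfolding abs_mult by (intro mult_right_mono) auto
    qed
    moreover have "h / 2 * (T * energy t1 - integral {t0..t1} (P N) - h\<^sup>2 * B / \<nu> - 5 / (b * real M) * (B * T + b\<^sup>2 * B / (2 * \<nu>)))
       \<le> h / 2 * \<bar>integral {t0..t1} (X N)\<bar>"
      using X_ge[of N] h by (intro mult_left_mono) auto
    ultimately show ?thesis by linarith
  qed
  have limit: "h / 2 * (x - 0 - c1 - c2) \<le> c3 + 1 / 2 * \<bar>0\<bar>"
    if "\<And>N. h / 2 * (x - p N - c1 - c2) \<le> c3 + 1 / 2 * \<bar>r N\<bar>" "p \<longlonglongrightarrow> 0" "r \<longlonglongrightarrow> 0"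
    for x c1 c2 c3 :: real and p r :: "nat \<Rightarrow> real"
  proof (rule LIMSEQ_le)
    show "(\<lambda>N. h / 2 * (x - p N - c1 - c2)) \<longlonglongrightarrow> h / 2 * (x - 0 - c1 - c2)"
      by (intro tendsto_mult_left tendsto_diff tendsto_const that)
    show "(\<lambda>N. c3 + 1 / 2 * \<bar>r N\<bar>) \<longlonglongrightarrow> c3 + 1 / 2 * \<bar>0\<bar>"
      by (intro tendsto_mult_left tendsto_add tendsto_const tendsto_rabs that)
  qed (use that(1) in blast)
  show ?thesis
    using limit[OF ineq limP limR] by (simp only: B_def T_def diff_zero abs_zero mult_zero_right add_0_right)
qed

text \<open>The scale \<open>\<nu>\<^sup>1\<^sup>/\<^sup>4\<close> is the width of the layer around the critical points of the shear in which
  diffusion balances mixing; correlations are taken at a small multiple of that scale.  The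
  factor \<open>10\<^sup>1\<^sup>6\<close> is a crude choice that makes all remainder terms small.\<close>

lemma mixing_decay:
  assumes \<nu>: "0 < \<nu>" "\<nu> \<le> 1" and t1: "t1 = t0 + 10 ^ 16 / sqrt \<nu>"
  shows "energy t1 \<le> energy t0 / 4"
proof -
  define b where "b = sqrt (sqrt \<nu>)"
  \<comment> \<open>The average in the main term costs 5 \<alpha> = 1 / 10 of the initial energy and
    the diffusion of the correlations 24 / (\<alpha>^3 s) = 3 / 100, with \<open>s\<close> as below.
    The remaining terms are negligible, and the total is less than 1 / 4.\<close>
  define \<alpha> :: real where "\<alpha> = 1 / 50"
  define h where "h = \<alpha> * b"
  define M where "M = nat \<lceil>1 / h\<rceil>"
  define s :: real where "s = 10 ^ 8"
  \<comment> \<open>This balances the two parts of the diffusion bound: both become multiples of s /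
    (\<alpha>^2 b), with factors 4 and 8.\<close>
  define \<mu> where "\<mu> = b * s"
  define B where "B = energy t0"
  have b: "0 < b" "b \<le> 1" using \<nu> by (simp_all add: b_def)
  have b2: "b\<^sup>2 = sqrt \<nu>" using \<nu> by (simp add: b_def)
  have "b ^ 4 = (b\<^sup>2)\<^sup>2" by (simp flip: power_mult)
  then have b4: "b ^ 4 = \<nu>" using b2 \<nu> by simp
  have h: "0 < h" "h \<le> 1" using b by (auto simp: h_def \<alpha>_def)
  have "1 \<le> 1 / h" using h by simp
  then have M: "1 / h \<le> real M" "real M \<le> 2 / h" "0 < M"
    unfolding M_def by linarith+
  have \<mu>: "0 < \<mu>" using b by (simp add: \<mu>_def s_def)
  have B0: "0 \<le> B" by (simp add: B_def energy_nonneg)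
  have T: "t1 - t0 = s\<^sup>2 / b\<^sup>2" using t1 b2 by (simp add: s_def)
  have t01: "t0 \<le> t1" using t1 \<nu> by simp
  have main: "h / 2 * (s\<^sup>2 / b\<^sup>2 * energy t1 - h\<^sup>2 * B / \<nu> -
      5 / (b * real M) * (B * (s\<^sup>2 / b\<^sup>2) + b\<^sup>2 * B / (2 * \<nu>)))
    \<le> 2 * real M * B + real M * (1 + real M * \<mu>) * B + 2 * \<nu> * (real M)\<^sup>2 * B * (s\<^sup>2 / b\<^sup>2) / \<mu>"
    using mixing_estimate[OF t01 \<nu>(1) h b M(3) \<mu>] unfolding T B_def .
  have "5 / (b * real M) \<le> 5 * \<alpha>"
  proof -
    have "1 \<le> h * real M" using M h by (simp add: field_simps)
    then show ?thesis using b M by (simp add: h_def field_simps)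
  qed
  then have w: "5 / (b * real M) * (B * (s\<^sup>2 / b\<^sup>2) + b\<^sup>2 * B / (2 * \<nu>)) \<le> 5 * \<alpha> * (B * (s\<^sup>2 / b\<^sup>2) + b\<^sup>2 * B / (2 * \<nu>))"
    using \<nu> B0 by (intro mult_right_mono) auto
  have "h / 2 * (s\<^sup>2 / b\<^sup>2 * energy t1 - h\<^sup>2 * B / \<nu> - 5 * \<alpha> * (B * (s\<^sup>2 / b\<^sup>2) + b\<^sup>2 * B / (2 * \<nu>)))
    \<le> h / 2 * (s\<^sup>2 / b\<^sup>2 * energy t1 - h\<^sup>2 * B / \<nu> -
      5 / (b * real M) * (B * (s\<^sup>2 / b\<^sup>2) + b\<^sup>2 * B / (2 * \<nu>)))"
    using w h by (intro mult_left_mono) auto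
  also note main
  also have "2 * real M * B + real M * (1 + real M * \<mu>) * B + 2 * \<nu> * (real M)\<^sup>2 * B * (s\<^sup>2 / b\<^sup>2) / \<mu> \<le>
     2 * (2 / h) * B + (2 / h) * (1 + (2 / h) * \<mu>) * B + 2 * \<nu> * (2 / h)\<^sup>2 * B * (s\<^sup>2 / b\<^sup>2) / \<mu>"
    using M B0 \<mu> \<nu> h by (intro add_mono mult_right_mono mult_left_mono divide_right_mono mult_mono power_mono) auto
  finally have "h / 2 * (s\<^sup>2 / b\<^sup>2 * energy t1 - h\<^sup>2 * B / \<nu> - 5 * \<alpha> * (B * (s\<^sup>2 / b\<^sup>2) + b\<^sup>2 * B / (2 * \<nu>)))
     \<le> 2 * (2 / h) * B + (2 / h) * (1 + (2 / h) * \<mu>) * B + 2 * \<nu> * (2 / h)\<^sup>2 * B * (s\<^sup>2 / b\<^sup>2) / \<mu>" .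
  also have "h / 2 * (s\<^sup>2 / b\<^sup>2 * energy t1 - h\<^sup>2 * B / \<nu> - 5 * \<alpha> * (B * (s\<^sup>2 / b\<^sup>2) + b\<^sup>2 * B / (2 * \<nu>))) =
     (\<alpha> / 2 * (s\<^sup>2 * energy t1 - \<alpha>\<^sup>2 * B - 5 * \<alpha> * (B * s\<^sup>2 + B / 2))) / b"
    using b unfolding h_def b4[symmetric] by (simp add: field_simps power2_eq_square power4_eq_xxxx)
  also have "2 * (2 / h) * B + (2 / h) * (1 + (2 / h) * \<mu>) * B + 2 * \<nu> * (2 / h)\<^sup>2 * B * (s\<^sup>2 / b\<^sup>2) / \<mu> =
     (6 / \<alpha> * B + 12 / \<alpha>\<^sup>2 * s * B) / b"
    using b unfolding h_def \<mu>_def b4[symmetric] by (simp add: \<alpha>_def s_def field_simps power2_eq_square power4_eq_xxxx)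
  finally have scaled: "(\<alpha> / 2 * (s\<^sup>2 * energy t1 - \<alpha>\<^sup>2 * B - 5 * \<alpha> * (B * s\<^sup>2 + B / 2))) / b \<le>
     (6 / \<alpha> * B + 12 / \<alpha>\<^sup>2 * s * B) / b" .
  have cancel: "x / b \<le> y / b \<Longrightarrow> x \<le> y" for x y
    using b by (simp add: divide_le_cancel)
  from scaled have "\<alpha> / 2 * (s\<^sup>2 * energy t1 - \<alpha>\<^sup>2 * B - 5 * \<alpha> * (B * s\<^sup>2 + B / 2)) \<le> 6 / \<alpha> * B + 12 / \<alpha>\<^sup>2 * s * B"
    by (rule cancel)
  then show ?thesis using B0 unfolding \<alpha>_def s_def B_def[symmetric] by (simp add: power2_eq_square)
qed

end

section \<open>Slices of Fourier modes\<close>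

text \<open>Frequencies are functions on all naturals with support below d, so that pointwise
  addition makes them an abelian group and the lattice locales apply in every dimension with one
  index type.\<close>

definition modes :: "nat \<Rightarrow> (nat \<Rightarrow> int) set" where
  "modes d = {m. \<forall>i\<ge>d. m i = 0}"

definition unit_mode :: "nat \<Rightarrow> int \<Rightarrow> nat \<Rightarrow> int" where
  "unit_mode i q = (\<lambda>k. if k = i then q else 0)"

definition mode_square :: "nat \<Rightarrow> (nat \<Rightarrow> int) \<Rightarrow> real" where
  "mode_square d m = (\<Sum>i<d. (of_int (m i))\<^sup>2)"

definition energy_on :: "(real \<Rightarrow> 'i \<Rightarrow> real) \<Rightarrow> 'i set \<Rightarrow> real \<Rightarrow> real" where
  "energy_on a S t = (\<Sum>\<^sub>\<infinity>m\<in>S. (a t m)\<^sup>2)"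

lemma unit_mode_add: "unit_mode i (p + q) = unit_mode i p + unit_mode i q"
  by (auto simp: unit_mode_def fun_eq_iff)

lemma countable_modes: "countable (modes d)"
proof (rule countable_image_inj_on)
  show "countable ((\<lambda>m. map m [0..<d]) ` modes d)" by simp
  show "inj_on (\<lambda>m. map m [0..<d]) (modes d)"
  proof (rule inj_onI)
    fix m m' assume *: "m \<in> modes d" "m' \<in> modes d" "map m [0..<d] = map m' [0..<d]"
    show "m = m'"
    proof
      fix i show "m i = m' i" using * by (cases "i < d") (auto simp: modes_def)
    qed
  qed
qed

lemma unit_mode_periods:
  assumes "i < d"
  shows "unit_mode i q \<in> periods (modes d)"
  using assms by (auto simp: periods_def modes_def unit_mode_def)

lemma mode_square_shift:
  assumes "i < d"
  shows "mode_square d (m + unit_mode i q) = mode_square d m + (of_int (m i + q))\<^sup>2 - (of_int (m i))\<^sup>2"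
proof -
  have "mode_square d m' = (of_int (m' i))\<^sup>2 + (\<Sum>k\<in>{..<d} - {i}. (of_int (m' k))\<^sup>2)" for m'
    unfolding mode_square_def using assms by (intro sum.remove) auto
  from this[of m] this[of "m + unit_mode i q"] show ?thesis
    by (simp add: unit_mode_def)
qed

lemma mode_square_ge: "i < d \<Longrightarrow> (of_int (m i))\<^sup>2 \<le> mode_square d m"
  unfolding mode_square_def by (rule member_le_sum) auto

lemma mode_square_nonneg: "0 \<le> mode_square d m"
  unfolding mode_square_def by (intro sum_nonneg) auto

text \<open>One half-period of the alternating shear, with frozen frequencies \<open>p i\<close> and shifted frequencies \<open>s i\<close>.\<close>

locale shear_phase =
  fixes d n :: nat and p s :: "nat \<Rightarrow> nat" and \<nu> :: real and \<phi> :: "real \<Rightarrow> real"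
    and a :: "real \<Rightarrow> (nat \<Rightarrow> int) \<Rightarrow> real" and t0 t1 K :: real
  assumes s_inj: "inj_on s {..<n}" and s_less: "i < n \<Longrightarrow> s i < d"
    and p_neq_s: "i < n \<Longrightarrow> k < n \<Longrightarrow> p i \<noteq> s k"
    and \<nu>: "0 < \<nu>" "\<nu> \<le> 1"
    and \<phi>_cont: "continuous_on {t0..t1} \<phi>"
    and ode: "t \<in> {t0..t1} \<Longrightarrow> m \<in> modes d \<Longrightarrow>
      ((\<lambda>t. a t m) has_real_derivative
        - \<nu> * mode_square d m * a t m - \<phi> t / 2 *
          (\<Sum>i<n. of_int (m (p i)) * (a t (m - unit_mode (s i) 1) - a t (m + unit_mode (s i) 1))))
        (at t within {t0..t1})"
    and square_bound: "t \<in> {t0..t1} \<Longrightarrow> finite H \<Longrightarrow> H \<subseteq> modes d \<Longrightarrow> (\<Sum>m\<in>H. (a t m)\<^sup>2) \<le> K"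
begin

section \<open>One shear phase, slice by slice\<close>

lemma subinterval:
  assumes "t0 \<le> ta" "tb \<le> t1"
  shows "shear_phase d n p s \<nu> \<phi> a ta tb K"
proof -
  have sub: "{ta..tb} \<subseteq> {t0..t1}" using assms by auto
  show ?thesis
  proof
    fix t m assume "t \<in> {ta..tb}" "m \<in> modes d"
    then show "((\<lambda>t. a t m) has_real_derivative
        - \<nu> * mode_square d m * a t m - \<phi> t / 2 *
          (\<Sum>i<n. of_int (m (p i)) * (a t (m - unit_mode (s i) 1) - a t (m + unit_mode (s i) 1))))
        (at t within {ta..tb})"
      using sub by (intro has_field_derivative_subset[OF ode sub]) auto
  next
    show "continuous_on {ta..tb} \<phi>" by (rule continuous_on_subset[OF \<phi>_cont sub])
  next
    fix t H assume "t \<in> {ta..tb}" "finite H" "H \<subseteq> modes d"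
    then show "(\<Sum>m\<in>H. (a t m)\<^sup>2) \<le> K" using sub by (intro square_bound) auto
  qed (rule s_inj s_less p_neq_s \<nu>; assumption?)+
qed

definition slice :: "(nat \<Rightarrow> int) \<Rightarrow> (nat \<Rightarrow> int) set" where
  "slice k = {m \<in> modes d. \<forall>i<n. m (p i) = k i}"

lemma unit_mode_slice:
  assumes "i < n"
  shows "unit_mode (s i) q \<in> periods (slice k)"
proof -
  have "(l + unit_mode (s i) q) (p k) = l (p k)" if "k < n" for l k
    using p_neq_s[OF that assms] by (simp add: unit_mode_def)
  then show ?thesis
    using periodsD[OF unit_mode_periods[OF s_less[OF assms], of q]] unfolding periods_def slice_def by auto
qed

text \<open>Shifts in the directions \<open>s i\<close> leave the frequencies at \<open>p i\<close>
  alone, so a slice is invariant and the coupling coefficients on it are the constants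
  \<open>k i\<close>.\<close>

lemma slice_flow:
  "lattice_flow (slice k) {..<n} (\<lambda>i. unit_mode (s i) 1) (\<lambda>i. of_int (k i)) (mode_square d) \<nu> \<phi> a t0 t1 K"
proof
  show "countable (slice k)"
    by (rule countable_subset[OF _ countable_modes]) (auto simp: slice_def)
  show "0 \<le> \<nu>" using \<nu> by simp
  fix t l assume "t \<in> {t0..t1}" "l \<in> slice k"
  then show "((\<lambda>t. a t l) has_real_derivative
        - \<nu> * mode_square d l * a t l - \<phi> t / 2 *
          (\<Sum>i<n. of_int (k i) * (a t (l - unit_mode (s i) 1) - a t (l + unit_mode (s i) 1))))
        (at t within {t0..t1})"
    using ode[of t l] by (simp add: slice_def)
next
  fix t H assume "t \<in> {t0..t1}" "finite H" "H \<subseteq> slice k"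
  then show "(\<Sum>l\<in>H. (a t l)\<^sup>2) \<le> K"
    by (intro square_bound) (auto simp: slice_def)
qed (auto simp: mode_square_nonneg \<phi>_cont intro: unit_mode_slice)

lemma square_summable: "t \<in> {t0..t1} \<Longrightarrow> S \<subseteq> modes d \<Longrightarrow> (\<lambda>m. (a t m)\<^sup>2) summable_on S"
proof (rule nonneg_bdd_above_summable_on)
  assume t: "t \<in> {t0..t1}" and S: "S \<subseteq> modes d"
  have "(\<Sum>m\<in>H. (a t m)\<^sup>2) \<le> K" if "finite H" "H \<subseteq> S" for H
    using square_bound[OF t that(1)] that(2) S by blast
  then show "bdd_above (sum (\<lambda>m. (a t m)\<^sup>2) ` {F. F \<subseteq> S \<and> finite F})"
    by (intro bdd_aboveI[where M = K]) auto
qed simp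

lemma slice_antimono:
  assumes "t0 \<le> ta" "ta \<le> tb" "tb \<le> t1"
  shows "energy_on a (slice k) tb \<le> energy_on a (slice k) ta"
  using lattice_flow.energy_antimono[OF slice_flow assms] by (simp add: energy_on_def lattice_flow.energy_def[OF slice_flow])

text \<open>A nonzero integer has modulus at least 1, which is the source of uniformity in the
  frequency. The direction \<open>s i\<close> belonging to the nonzero frequency plays the role of
  j.\<close>

lemma slice_mixing:
  assumes k: "i < n" "k i \<noteq> 0" and \<phi>_1: "\<And>t. t \<in> {t0..t1} \<Longrightarrow> \<phi> t = 1" and t1: "t1 = t0 + 10 ^ 16 / sqrt \<nu>"
  shows "energy_on a (slice k) t1 \<le> energy_on a (slice k) t0 / 4"
proof -
  interpret lattice_mixing "slice k" "{..<n}" "\<lambda>i. unit_mode (s i) 1" "\<lambda>i. of_int (k i)" "mode_square d" \<nu> \<phi> a t0 t1 K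
    i "unit_mode (s i)" "\<lambda>m. m (s i)"
  proof (rule lattice_mixing.intro[OF slice_flow], unfold_locales)
    fix i' and l :: "nat \<Rightarrow> int" assume "i' \<in> {..<n}" "i' \<noteq> i"
    then show "(l + unit_mode (s i') 1) (s i) = l (s i)"
      using s_inj k by (auto simp: unit_mode_def inj_on_def)
  next
    show "1 \<le> \<bar>real_of_int (k i)\<bar>" using k by linarith
  next
    fix l q show "mode_square d (l + unit_mode (s i) q) =
        mode_square d l + (real_of_int (l (s i) + q))\<^sup>2 - (real_of_int (l (s i)))\<^sup>2"
      by (rule mode_square_shift[OF s_less[OF k(1)]])
  next
    fix l :: "nat \<Rightarrow> int" and q show "(l + unit_mode (s i) q) (s i) = l (s i) + q"
      by (simp add: unit_mode_def)
  qed (use k s_less in \<open>auto simp: \<phi>_1 unit_mode_add mode_square_ge\<close>)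
  show ?thesis
    using mixing_decay[OF \<nu> t1] by (simp add: energy_on_def energy_def)
qed

text \<open>When all frozen frequencies vanish, so does the coupling, and the mode by itself is a
  lattice flow with no directions.\<close>

lemma zero_mode_antimono:
  assumes m: "m \<in> modes d" "\<And>i. i < n \<Longrightarrow> m (p i) = 0" and t: "t0 \<le> ta" "ta \<le> tb" "tb \<le> t1"
  shows "(a tb m)\<^sup>2 \<le> (a ta m)\<^sup>2"
proof -
  interpret lattice_flow "{m}" "{} :: nat set" "\<lambda>_. 0" "\<lambda>_. 0" "mode_square d" \<nu> \<phi> a t0 t1 K
  proof
    fix t l assume "t \<in> {t0..t1}" "l \<in> {m}"
    then show "((\<lambda>t. a t l) has_real_derivative
        - \<nu> * mode_square d l * a t l - \<phi> t / 2 * (\<Sum>i\<in>{}. 0 * (a t (l - 0) - a t (l + 0)))) (at t within {t0..t1})"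
      using ode[of t m] m by simp
  qed (use m \<nu> in \<open>auto simp: mode_square_nonneg \<phi>_cont intro!: square_bound\<close>)
  show ?thesis using energy_antimono[OF t] by (simp add: energy_def)
qed

definition moving_modes :: "(nat \<Rightarrow> int) set" where
  "moving_modes = {m \<in> modes d. \<exists>i<n. m (p i) \<noteq> 0}"

lemma energy_on_mono: "t \<in> {t0..t1} \<Longrightarrow> S \<subseteq> S' \<Longrightarrow> S' \<subseteq> modes d \<Longrightarrow> energy_on a S t \<le> energy_on a S' t"
  unfolding energy_on_def by (intro infsum_mono2 square_summable) auto

text \<open>Extensional labels that differ do so at an index below n, hence their slices are
  disjoint.\<close>

lemma sum_slices_le:
  assumes t: "t \<in> {t0..t1}" and k: "finite \<K>" "\<And>k. k \<in> \<K> \<Longrightarrow> k \<in> extensional {..<n}"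
    and S: "\<And>k. k \<in> \<K> \<Longrightarrow> slice k \<subseteq> S" "S \<subseteq> modes d"
  shows "(\<Sum>k\<in>\<K>. energy_on a (slice k) t) \<le> energy_on a S t"
proof -
  have disj: "slice k \<inter> slice k' = {}" if "k \<in> \<K>" "k' \<in> \<K>" "k \<noteq> k'" for k k'
  proof (rule ccontr)
    assume "slice k \<inter> slice k' \<noteq> {}"
    then have "\<And>i. i < n \<Longrightarrow> k i = k' i" by (auto simp: slice_def)
    then have "k = k'" using k(2) that by (intro extensionalityI[of k "{..<n}" k']) auto
    then show False using that by simp
  qed
  have "((\<lambda>m. (a t m)\<^sup>2) has_sum (\<Sum>k\<in>\<K>. energy_on a (slice k) t)) (\<Union>k\<in>\<K>. slice k)"
    unfolding energy_on_def
    by (intro sum_has_sum k(1) disj has_sum_infsum square_summable[OF t]) (auto simp: slice_def)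
  moreover have "((\<lambda>m. (a t m)\<^sup>2) has_sum energy_on a S t) S"
    unfolding energy_on_def using square_summable[OF t S(2)] by simp
  ultimately show ?thesis
    by (rule has_sum_mono') (use S(1) in auto)
qed

text \<open>A finite set of modes meets finitely many slices, so a bound on each slice adds up with
  the same constant even though there are infinitely many slices.\<close>

lemma energy_on_slices:
  assumes t: "ta \<in> {t0..t1}" "tb \<in> {t0..t1}" and S: "S \<subseteq> modes d" "\<And>k m. m \<in> slice k \<Longrightarrow> m \<in> S \<Longrightarrow> slice k \<subseteq> S"
    and c: "\<And>k. slice k \<noteq> {} \<Longrightarrow> slice k \<subseteq> S \<Longrightarrow> energy_on a (slice k) tb \<le> c * energy_on a (slice k) ta" "0 \<le> c"
  shows "energy_on a S tb \<le> c * energy_on a S ta"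
  unfolding energy_on_def[of a S tb]
proof (rule infsum_le_finite_sums[OF square_summable[OF t(2) S(1)]])
  fix H assume H: "finite H" "H \<subseteq> S"
  define key where "key m = restrict (\<lambda>i. m (p i)) {..<n}" for m :: "nat \<Rightarrow> int"
  have key: "m \<in> slice (key m)" if "m \<in> H" for m
    using that H S by (auto simp: slice_def key_def)
  have sub: "slice k \<subseteq> S" if "k \<in> key ` H" for k
    using that key S(2) H(2) by blast
  have "(\<Sum>m\<in>H. (a tb m)\<^sup>2) = (\<Sum>k\<in>key ` H. \<Sum>m\<in>{m \<in> H. key m = k}. (a tb m)\<^sup>2)"
    using H(1) by (intro sum.group[symmetric]) auto
  also have "\<dots> \<le> (\<Sum>k\<in>key ` H. energy_on a (slice k) tb)"
  proof (rule sum_mono)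
    fix k assume k: "k \<in> key ` H"
    have "{m \<in> H. key m = k} \<subseteq> slice k" using key by auto
    then show "(\<Sum>m | m \<in> H \<and> key m = k. (a tb m)\<^sup>2) \<le> energy_on a (slice k) tb"
      unfolding energy_on_def using H(1) sub[OF k] S(1)
      by (intro finite_sum_le_infsum square_summable[OF t(2)]) auto
  qed
  also have "\<dots> \<le> (\<Sum>k\<in>key ` H. c * energy_on a (slice k) ta)"
    using key sub by (intro sum_mono c(1)) auto
  also have "\<dots> = c * (\<Sum>k\<in>key ` H. energy_on a (slice k) ta)"
    by (simp add: sum_distrib_left)
  also have "\<dots> \<le> c * energy_on a S ta"
    using H(1) sub S(1) c(2) t by (intro mult_left_mono sum_slices_le) (auto simp: key_def)
  finally show "(\<Sum>m\<in>H. (a tb m)\<^sup>2) \<le> c * energy_on a S ta" .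
qed

lemma moving_modes_slices: "m \<in> slice k \<Longrightarrow> m \<in> moving_modes \<Longrightarrow> slice k \<subseteq> moving_modes"
  by (auto simp: moving_modes_def slice_def)

lemma moving_modes_antimono:
  assumes "t0 \<le> ta" "ta \<le> tb" "tb \<le> t1"
  shows "energy_on a moving_modes tb \<le> energy_on a moving_modes ta"
  using energy_on_slices[of ta tb moving_modes 1] moving_modes_slices slice_antimono[OF assms] assms
  by (auto simp: moving_modes_def)

text \<open>The quarter is gained on the plateau; on the ramps before and after it monotonicity is
  enough.\<close>

lemma moving_modes_mixing:
  assumes t: "t0 \<le> ta" "tb \<le> t1" and \<phi>_1: "\<And>t. t \<in> {ta..tb} \<Longrightarrow> \<phi> t = 1" and tb: "tb = ta + 10 ^ 16 / sqrt \<nu>"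
  shows "energy_on a moving_modes t1 \<le> energy_on a moving_modes t0 / 4"
proof -
  interpret sub: shear_phase d n p s \<nu> \<phi> a ta tb K by (rule subinterval[OF t])
  have ab: "ta \<le> tb" using tb \<nu> by simp
  have "energy_on a (slice k) tb \<le> 1 / 4 * energy_on a (slice k) ta" if "slice k \<noteq> {}" "slice k \<subseteq> moving_modes" for k
  proof -
    from that obtain i where "i < n" "k i \<noteq> 0" by (auto simp: slice_def moving_modes_def)
    from sub.slice_mixing[where k = k, OF this \<phi>_1 tb] show ?thesis by simp
  qed
  note slices = this
  have tab: "ta \<in> {t0..t1}" "tb \<in> {t0..t1}" using t ab by auto
  have "moving_modes \<subseteq> modes d" by (auto simp: moving_modes_def)
  from energy_on_slices[OF tab this moving_modes_slices slices]
  have "energy_on a moving_modes tb \<le> 1 / 4 * energy_on a moving_modes ta" by simp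
  moreover have "energy_on a moving_modes ta \<le> energy_on a moving_modes t0"
    using t ab by (intro moving_modes_antimono) simp_all
  moreover have "energy_on a moving_modes t1 \<le> energy_on a moving_modes tb"
    using t ab by (intro moving_modes_antimono) simp_all
  ultimately show ?thesis by simp
qed

lemma resting_modes_antimono:
  assumes "S \<subseteq> modes d - moving_modes" "t0 \<le> ta" "ta \<le> tb" "tb \<le> t1"
  shows "energy_on a S tb \<le> energy_on a S ta"
  unfolding energy_on_def
proof (rule infsum_mono)
  fix m assume "m \<in> S"
  with assms show "(a tb m)\<^sup>2 \<le> (a ta m)\<^sup>2"
    by (intro zero_mode_antimono) (auto simp: moving_modes_def)
qed (use assms in \<open>auto intro!: square_summable\<close>)

lemma energy_on_antimono:
  assumes S: "moving_modes \<subseteq> S" "S \<subseteq> modes d" and t: "t0 \<le> ta" "ta \<le> tb" "tb \<le> t1"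
  shows "energy_on a S tb \<le> energy_on a S ta"
proof -
  have split: "energy_on a S t = energy_on a moving_modes t + energy_on a (S - moving_modes) t" if "t \<in> {t0..t1}" for t
  proof -
    have "energy_on a (moving_modes \<union> (S - moving_modes)) t = energy_on a moving_modes t + energy_on a (S - moving_modes) t"
      unfolding energy_on_def using S that by (intro infsum_Un_disjoint square_summable) auto
    then show ?thesis using S by (simp add: Un_absorb1)
  qed
  have "energy_on a (S - moving_modes) tb \<le> energy_on a (S - moving_modes) ta"
    using S by (intro resting_modes_antimono t) auto
  then show ?thesis
    using split[of ta] split[of tb] t moving_modes_antimono[OF t] by simp
qed

end

section \<open>The alternating flow\<close>

text \<open>Monotonicity of the energy is first known only within a single shear phase; the phases
  meet at multiples of T.\<close>

lemma antimono_from_pieces: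
  fixes f :: "real \<Rightarrow> real"
  assumes T: "0 < T" and piece: "\<And>(k::nat) x y. T * real k \<le> x \<Longrightarrow> x \<le> y \<Longrightarrow> y \<le> T * (real k + 1) \<Longrightarrow> f y \<le> f x"
    and xy: "0 \<le> x" "x \<le> y"
  shows "f y \<le> f x"
proof -
  have "f y \<le> f x" if "0 \<le> x" "x \<le> y" "y \<le> T * real N" for N x y
    using that
  proof (induction N arbitrary: x y)
    case 0
    then have "x = y" by simp
    then show ?case by simp
  next
    case (Suc N)
    have y: "y \<le> T * (real N + 1)" using Suc.prems by (simp add: add.commute)
    consider "y \<le> T * real N" | "T * real N \<le> x" | "x \<le> T * real N" "T * real N \<le> y" by linarith
    then show ?case
    proof cases
      case 1
      with Suc.IH Suc.prems show ?thesis by blast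
    next
      case 2
      with piece Suc.prems y show ?thesis by blast
    next
      case 3
      have "f y \<le> f (T * real N)" using 3 y by (intro piece) auto
      also have "\<dots> \<le> f x" using 3 Suc.prems by (intro Suc.IH) auto
      finally show ?thesis .
    qed
  qed
  moreover obtain N :: nat where "y / T \<le> real N" using real_arch_simple by blast
  then have "y \<le> T * real N" using T by (simp add: field_simps)
  ultimately show ?thesis using xy by blast
qed

text \<open>Rounding s up and s + t down to multiples of P loses at most two periods, which costs
  the factor 4 = 2^2.\<close>

lemma decay_from_halving:
  fixes f :: "real \<Rightarrow> real"
  assumes P: "0 < P" and anti: "\<And>x y. 0 \<le> x \<Longrightarrow> x \<le> y \<Longrightarrow> f y \<le> f x"
    and half: "\<And>k::nat. f (P * (real k + 1)) \<le> f (P * real k) / 2"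
    and nonneg: "\<And>x. 0 \<le> f x" and st: "0 \<le> s" "0 \<le> t"
  shows "f (s + t) \<le> 4 * exp (- ln 2 * t / P) * f s"
proof -
  have powers: "f (P * (real k + real j)) \<le> (1 / 2) ^ j * f (P * real k)" for k j :: nat
  proof (induction j)
    case (Suc j)
    have "f (P * (real k + real (Suc j))) \<le> f (P * (real k + real j)) / 2"
      using half[of "k + j"] by (simp add: add_ac)
    with Suc show ?case by simp
  qed simp
  define k where "k = nat \<lceil>s / P\<rceil>"
  define K where "K = nat \<lfloor>(s + t) / P\<rfloor>"
  have k: "s / P \<le> real k" "real k < s / P + 1"
    using st P by (simp_all add: k_def) linarith+
  have K: "real K \<le> (s + t) / P" "(s + t) / P < real K + 1"
    using st P by (simp_all add: K_def)
  have rate: "(1 / 2 :: real) ^ j = exp (- ln 2 * real j)" for j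
    using exp_of_nat_mult[of j "- ln 2 :: real"] by (simp add: exp_minus mult.commute power_one_over inverse_eq_divide)
  have four: "(4::real) = exp (2 * ln 2)" using exp_of_nat_mult[of 2 "ln 2 :: real"] by simp
  show ?thesis
  proof (cases "k \<le> K")
    case True
    have "f (s + t) \<le> f (P * real K)"
      using K(1) P by (intro anti) (auto simp: field_simps)
    also have "\<dots> \<le> (1 / 2) ^ (K - k) * f (P * real k)"
      using powers[of k "K - k"] True by simp
    also have "\<dots> \<le> (1 / 2) ^ (K - k) * f s"
      using k(1) P st by (intro mult_left_mono anti) (auto simp: field_simps)
    also have "(1 / 2) ^ (K - k) \<le> 4 * exp (- ln 2 * t / P)"
    proof -
      have "t / P - 2 \<le> real (K - k)" using k K True by (simp add: add_divide_distrib)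
      then have "ln 2 * (t / P - 2) \<le> ln 2 * real (K - k)" by (intro mult_left_mono) auto
      then have "- ln 2 * real (K - k) \<le> 2 * ln 2 + - ln 2 * t / P" by (simp add: algebra_simps)
      then show ?thesis unfolding rate four mult_exp_exp by simp
    qed
    finally show ?thesis using nonneg by (simp add: mult_right_mono)
  next
    \<comment> \<open>No multiple of P lies between the two times, so t is at most two periods and
      the factor 4 outweighs the exponential.\<close>
    case False
    then have "real K + 1 \<le> real k" by linarith
    then have "t / P \<le> 2" using k K by (simp add: add_divide_distrib)
    then have "ln 2 * (t / P) \<le> ln 2 * 2" by (intro mult_left_mono) auto
    then have "1 \<le> 4 * exp (- ln 2 * t / P)" unfolding four mult_exp_exp by (simp add: algebra_simps)
    then have "1 * f s \<le> 4 * exp (- ln 2 * t / P) * f s" by (rule mult_right_mono[OF _ nonneg])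
    moreover have "f (s + t) \<le> f s" using st by (intro anti) auto
    ultimately show ?thesis by simp
  qed
qed

text \<open>With this constant the unit of the schedule, 10^16 / sqrt \<nu>, is exactly the plateau
  length of \<open>mixing_decay\<close>. The equation carries both couplings, but at each time at
  most one of them is active.\<close>

locale alternating_flow =
  fixes n :: nat and \<nu> :: real and \<Phi>1 \<Phi>2 :: "real \<Rightarrow> real" and a :: "real \<Rightarrow> (nat \<Rightarrow> int) \<Rightarrow> real"
  assumes \<nu>: "0 < \<nu>" "\<nu> \<le> 1" and vary: "vary_on_time_scale (1 / 10 ^ 16) \<nu> \<Phi>1 \<Phi>2"
    and ode: "0 \<le> t \<Longrightarrow> m \<in> modes (2 * n) \<Longrightarrow>
      ((\<lambda>t. a t m) has_real_derivative
        - \<nu> * mode_square (2 * n) m * a t m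
        - \<Phi>1 t / 2 * (\<Sum>i<n. of_int (m i) * (a t (m - unit_mode (n + i) 1) - a t (m + unit_mode (n + i) 1)))
        - \<Phi>2 t / 2 * (\<Sum>i<n. of_int (m (n + i)) * (a t (m - unit_mode i 1) - a t (m + unit_mode i 1))))
        (at t within {0..})"
    and square_bound: "\<exists>K. \<forall>t\<in>{0..T}. \<forall>H. finite H \<and> H \<subseteq> modes (2 * n) \<longrightarrow> (\<Sum>m\<in>H. (a t m)\<^sup>2) \<le> K"
begin

definition \<tau> :: real where "\<tau> = 1 / (1 / 10 ^ 16 * sqrt \<nu>)"

lemma \<tau>_eq: "\<tau> = 10 ^ 16 / sqrt \<nu>" by (simp add: \<tau>_def)

lemma \<tau>_pos: "0 < \<tau>" using \<nu> by (simp add: \<tau>_eq)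

lemmas vary_unfolded = vary[unfolded vary_on_time_scale_def Let_def, folded \<tau>_def]

lemma \<Phi>_continuous: "continuous_on {0..} \<Phi>1" "continuous_on {0..} \<Phi>2"
  by (rule smooth_on_halfline_continuous[OF conjunct1[OF vary_unfolded]]
    smooth_on_halfline_continuous[OF conjunct1[OF conjunct2[OF vary_unfolded]]])+

lemma \<Phi>1_eq_0: "\<Phi>1 t = 0" if "\<tau> * (6 * real k + 3) \<le> t" "t \<le> \<tau> * (6 * real k + 6)"
proof -
  have t: "0 \<le> t" using that(1) \<tau>_pos by (intro order_trans[OF _ that(1)]) simp
  have "t \<notin> (\<Union>k::nat. {\<tau> * (6 * real k) <..< \<tau> * (6 * real k + 3)})"
  proof
    assume "t \<in> (\<Union>k::nat. {\<tau> * (6 * real k) <..< \<tau> * (6 * real k + 3)})"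
    then obtain k' :: nat where "\<tau> * (6 * real k') < t" "t < \<tau> * (6 * real k' + 3)" by auto
    then have "\<tau> * (6 * real k') < \<tau> * (6 * real k + 6)" "\<tau> * (6 * real k + 3) < \<tau> * (6 * real k' + 3)"
      using that by linarith+
    then have "6 * real k' < 6 * real k + 6" "6 * real k + 3 < 6 * real k' + 3"
      using \<tau>_pos by (simp_all only: mult_less_cancel_left_pos)
    then have "k' < k + 1" "k < k'" by linarith+
    then show False by simp
  qed
  moreover have "\<forall>t\<ge>0. t \<notin> (\<Union>k::nat. {\<tau> * (6 * real k) <..< \<tau> * (6 * real k + 3)}) \<longrightarrow> \<Phi>1 t = 0"
    using vary_unfolded by (elim conjE)
  ultimately show ?thesis using t by blast
qed

lemma \<Phi>2_eq_0: "\<Phi>2 t = 0" if "\<tau> * (6 * real k) \<le> t" "t \<le> \<tau> * (6 * real k + 3)"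
proof -
  have t: "0 \<le> t" using that(1) \<tau>_pos by (intro order_trans[OF _ that(1)]) simp
  have "t \<notin> (\<Union>k::nat. {\<tau> * (6 * real k + 3) <..< \<tau> * (6 * real k + 6)})"
  proof
    assume "t \<in> (\<Union>k::nat. {\<tau> * (6 * real k + 3) <..< \<tau> * (6 * real k + 6)})"
    then obtain k' :: nat where "\<tau> * (6 * real k' + 3) < t" "t < \<tau> * (6 * real k' + 6)" by auto
    then have "\<tau> * (6 * real k' + 3) < \<tau> * (6 * real k + 3)" "\<tau> * (6 * real k) < \<tau> * (6 * real k' + 6)"
      using that by linarith+
    then have "6 * real k' + 3 < 6 * real k + 3" "6 * real k < 6 * real k' + 6"
      using \<tau>_pos by (simp_all only: mult_less_cancel_left_pos)
    then have "k' < k" "k < k' + 1" by linarith+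
    then show False by simp
  qed
  moreover have "\<forall>t\<ge>0. t \<notin> (\<Union>k::nat. {\<tau> * (6 * real k + 3) <..< \<tau> * (6 * real k + 6)}) \<longrightarrow> \<Phi>2 t = 0"
    using vary_unfolded by (elim conjE)
  ultimately show ?thesis using t by blast
qed

lemma \<Phi>1_eq_1: "\<tau> * (6 * real k + 1) \<le> t \<Longrightarrow> t \<le> \<tau> * (6 * real k + 2) \<Longrightarrow> \<Phi>1 t = 1"
proof -
  have "\<forall>k::nat. \<forall>t\<in>{\<tau> * (6 * real k + 1) .. \<tau> * (6 * real k + 2)}. \<Phi>1 t = 1"
    using vary_unfolded by (elim conjE)
  then show "\<tau> * (6 * real k + 1) \<le> t \<Longrightarrow> t \<le> \<tau> * (6 * real k + 2) \<Longrightarrow> \<Phi>1 t = 1" by auto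
qed

lemma \<Phi>2_eq_1: "\<tau> * (6 * real k + 4) \<le> t \<Longrightarrow> t \<le> \<tau> * (6 * real k + 5) \<Longrightarrow> \<Phi>2 t = 1"
proof -
  have "\<forall>k::nat. \<forall>t\<in>{\<tau> * (6 * real k + 4) .. \<tau> * (6 * real k + 5)}. \<Phi>2 t = 1"
    using vary_unfolded by (elim conjE)
  then show "\<tau> * (6 * real k + 4) \<le> t \<Longrightarrow> t \<le> \<tau> * (6 * real k + 5) \<Longrightarrow> \<Phi>2 t = 1" by auto
qed

lemma phase1:
  "\<exists>K. shear_phase (2 * n) n (\<lambda>i. i) (\<lambda>i. n + i) \<nu> \<Phi>1 a (\<tau> * (6 * real k)) (\<tau> * (6 * real k + 3)) K"
proof -
  obtain K where K: "\<And>t H. t \<in> {0..\<tau> * (6 * real k + 3)} \<Longrightarrow> finite H \<Longrightarrow> H \<subseteq> modes (2 * n) \<Longrightarrow> (\<Sum>m\<in>H. (a t m)\<^sup>2) \<le> K"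
    using square_bound[of "\<tau> * (6 * real k + 3)"] by blast
  have t0: "0 \<le> \<tau> * (6 * real k)" using \<tau>_pos by simp
  then have sub: "{\<tau> * (6 * real k)..\<tau> * (6 * real k + 3)} \<subseteq> {0..}" by auto
  have "shear_phase (2 * n) n (\<lambda>i. i) (\<lambda>i. n + i) \<nu> \<Phi>1 a (\<tau> * (6 * real k)) (\<tau> * (6 * real k + 3)) K"
  proof
    show "continuous_on {\<tau> * (6 * real k)..\<tau> * (6 * real k + 3)} \<Phi>1"
      by (rule continuous_on_subset[OF \<Phi>_continuous(1) sub])
    fix t m assume t: "t \<in> {\<tau> * (6 * real k)..\<tau> * (6 * real k + 3)}" and m: "m \<in> modes (2 * n)"
    have "0 \<le> t" using t order_trans[OF t0] by auto
    from has_field_derivative_subset[OF ode[OF this m] sub]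
    show "((\<lambda>t. a t m) has_real_derivative
        - \<nu> * mode_square (2 * n) m * a t m - \<Phi>1 t / 2 *
          (\<Sum>i<n. of_int (m i) * (a t (m - unit_mode (n + i) 1) - a t (m + unit_mode (n + i) 1))))
        (at t within {\<tau> * (6 * real k)..\<tau> * (6 * real k + 3)})"
      using \<Phi>2_eq_0[of k t] t by simp
  next
    fix t H assume "t \<in> {\<tau> * (6 * real k)..\<tau> * (6 * real k + 3)}" "finite H" "H \<subseteq> modes (2 * n)"
    then show "(\<Sum>m\<in>H. (a t m)\<^sup>2) \<le> K" using order_trans[OF t0] by (intro K) auto
  qed (use \<nu> in \<open>auto simp: inj_on_def\<close>)
  then show ?thesis by blast
qed

lemma phase2:
  "\<exists>K. shear_phase (2 * n) n (\<lambda>i. n + i) (\<lambda>i. i) \<nu> \<Phi>2 a (\<tau> * (6 * real k + 3)) (\<tau> * (6 * real k + 6)) K"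
proof -
  obtain K where K: "\<And>t H. t \<in> {0..\<tau> * (6 * real k + 6)} \<Longrightarrow> finite H \<Longrightarrow> H \<subseteq> modes (2 * n) \<Longrightarrow> (\<Sum>m\<in>H. (a t m)\<^sup>2) \<le> K"
    using square_bound[of "\<tau> * (6 * real k + 6)"] by blast
  have t0: "0 \<le> \<tau> * (6 * real k + 3)" using \<tau>_pos by simp
  then have sub: "{\<tau> * (6 * real k + 3)..\<tau> * (6 * real k + 6)} \<subseteq> {0..}" by auto
  have "shear_phase (2 * n) n (\<lambda>i. n + i) (\<lambda>i. i) \<nu> \<Phi>2 a (\<tau> * (6 * real k + 3)) (\<tau> * (6 * real k + 6)) K"
  proof
    show "continuous_on {\<tau> * (6 * real k + 3)..\<tau> * (6 * real k + 6)} \<Phi>2"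
      by (rule continuous_on_subset[OF \<Phi>_continuous(2) sub])
    fix t m assume t: "t \<in> {\<tau> * (6 * real k + 3)..\<tau> * (6 * real k + 6)}" and m: "m \<in> modes (2 * n)"
    have "0 \<le> t" using t order_trans[OF t0] by auto
    from has_field_derivative_subset[OF ode[OF this m] sub]
    show "((\<lambda>t. a t m) has_real_derivative
        - \<nu> * mode_square (2 * n) m * a t m - \<Phi>2 t / 2 *
          (\<Sum>i<n. of_int (m (n + i)) * (a t (m - unit_mode i 1) - a t (m + unit_mode i 1))))
        (at t within {\<tau> * (6 * real k + 3)..\<tau> * (6 * real k + 6)})"
      using \<Phi>1_eq_0[of k t] t by simp
  next
    fix t H assume "t \<in> {\<tau> * (6 * real k + 3)..\<tau> * (6 * real k + 6)}" "finite H" "H \<subseteq> modes (2 * n)"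
    then show "(\<Sum>m\<in>H. (a t m)\<^sup>2) \<le> K" using order_trans[OF t0] by (intro K) auto
  qed (use \<nu> in \<open>auto simp: inj_on_def\<close>)
  then show ?thesis by blast
qed

abbreviation nonzero_modes :: "(nat \<Rightarrow> int) set" where
  "nonzero_modes \<equiv> modes (2 * n) - {0}"

lemma energy_antimono:
  assumes "0 \<le> s" "s \<le> t"
  shows "energy_on a nonzero_modes t \<le> energy_on a nonzero_modes s"
proof (rule antimono_from_pieces[of "3 * \<tau>", OF _ _ assms])
  fix k :: nat and x y assume xy: "3 * \<tau> * real k \<le> x" "x \<le> y" "y \<le> 3 * \<tau> * (real k + 1)"
  \<comment> \<open>Even pieces are phases of the first shear, odd pieces of the second.\<close>
  obtain j where "k = 2 * j \<or> k = 2 * j + 1" by (metis oddE evenE)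
  then show "energy_on a nonzero_modes y \<le> energy_on a nonzero_modes x"
  proof
    assume k: "k = 2 * j"
    obtain K where "shear_phase (2 * n) n (\<lambda>i. i) (\<lambda>i. n + i) \<nu> \<Phi>1 a (\<tau> * (6 * real j)) (\<tau> * (6 * real j + 3)) K"
      using phase1 by blast
    then interpret ph: shear_phase "2 * n" n "\<lambda>i. i" "\<lambda>i. n + i" \<nu> \<Phi>1 a "\<tau> * (6 * real j)" "\<tau> * (6 * real j + 3)" K .
    have "ph.moving_modes \<subseteq> nonzero_modes" by (auto simp: ph.moving_modes_def)
    then show ?thesis
      using xy by (intro ph.energy_on_antimono) (simp_all add: k algebra_simps)
  next
    assume k: "k = 2 * j + 1"
    obtain K where "shear_phase (2 * n) n (\<lambda>i. n + i) (\<lambda>i. i) \<nu> \<Phi>2 a (\<tau> * (6 * real j + 3)) (\<tau> * (6 * real j + 6)) K"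
      using phase2 by blast
    then interpret ph: shear_phase "2 * n" n "\<lambda>i. n + i" "\<lambda>i. i" \<nu> \<Phi>2 a "\<tau> * (6 * real j + 3)" "\<tau> * (6 * real j + 6)" K .
    have "ph.moving_modes \<subseteq> nonzero_modes" by (auto simp: ph.moving_modes_def)
    then show ?thesis
      using xy by (intro ph.energy_on_antimono) (simp_all add: k algebra_simps)
  qed
qed (use \<tau>_pos in auto)

text \<open>A nonzero mode at rest in the second phase has a nonzero frequency among those frozen in the first
  phase, where it was therefore damped.\<close>

lemma period_halving:
  "energy_on a nonzero_modes (\<tau> * (6 * real k + 6)) \<le> energy_on a nonzero_modes (\<tau> * (6 * real k)) / 2"
proof -
  let ?t0 = "\<tau> * (6 * real k)" and ?t1 = "\<tau> * (6 * real k + 3)" and ?t2 = "\<tau> * (6 * real k + 6)"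
  obtain K1 where "shear_phase (2 * n) n (\<lambda>i. i) (\<lambda>i. n + i) \<nu> \<Phi>1 a ?t0 ?t1 K1"
    using phase1 by blast
  then interpret ph1: shear_phase "2 * n" n "\<lambda>i. i" "\<lambda>i. n + i" \<nu> \<Phi>1 a ?t0 ?t1 K1 .
  obtain K2 where "shear_phase (2 * n) n (\<lambda>i. n + i) (\<lambda>i. i) \<nu> \<Phi>2 a ?t1 ?t2 K2"
    using phase2 by blast
  then interpret ph2: shear_phase "2 * n" n "\<lambda>i. n + i" "\<lambda>i. i" \<nu> \<Phi>2 a ?t1 ?t2 K2 .
  have le: "?t0 \<le> ?t1" "?t1 \<le> ?t2" using \<tau>_pos by simp_all
  have sub1: "ph1.moving_modes \<subseteq> nonzero_modes" and sub2: "ph2.moving_modes \<subseteq> nonzero_modes"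
    by (auto simp: ph1.moving_modes_def ph2.moving_modes_def)
  have rest: "nonzero_modes - ph2.moving_modes \<subseteq> ph1.moving_modes"
  proof
    fix m assume m: "m \<in> nonzero_modes - ph2.moving_modes"
    have "\<exists>i<n. m i \<noteq> 0"
    proof (rule ccontr)
      assume "\<not> (\<exists>i<n. m i \<noteq> 0)"
      moreover have "m i = 0" if "n \<le> i" for i
        using m that by (cases "i < 2 * n") (auto simp: ph2.moving_modes_def modes_def dest: spec[of _ "i - n"])
      ultimately have "m i = 0" for i by (cases "i < n") auto
      then show False using m by (auto simp: fun_eq_iff)
    qed
    then show "m \<in> ph1.moving_modes" using m by (auto simp: ph1.moving_modes_def)
  qed
  have mix1: "energy_on a ph1.moving_modes ?t1 \<le> energy_on a ph1.moving_modes ?t0 / 4"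
  proof (rule ph1.moving_modes_mixing)
    show "\<tau> * (6 * real k + 2) = \<tau> * (6 * real k + 1) + 10 ^ 16 / sqrt \<nu>"
      unfolding \<tau>_eq[symmetric] by (simp add: algebra_simps)
    show "\<And>t. t \<in> {\<tau> * (6 * real k + 1)..\<tau> * (6 * real k + 2)} \<Longrightarrow> \<Phi>1 t = 1"
      using \<Phi>1_eq_1 by auto
  qed (use \<tau>_pos in auto)
  have mix2: "energy_on a ph2.moving_modes ?t2 \<le> energy_on a ph2.moving_modes ?t1 / 4"
  proof (rule ph2.moving_modes_mixing)
    show "\<tau> * (6 * real k + 5) = \<tau> * (6 * real k + 4) + 10 ^ 16 / sqrt \<nu>"
      unfolding \<tau>_eq[symmetric] by (simp add: algebra_simps)
    show "\<And>t. t \<in> {\<tau> * (6 * real k + 4)..\<tau> * (6 * real k + 5)} \<Longrightarrow> \<Phi>2 t = 1"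
      using \<Phi>2_eq_1 by auto
  qed (use \<tau>_pos in auto)
  \<comment> \<open>One quarter of the initial energy bounds the modes damped in the second phase,
    another quarter those at rest in it, which were damped in the first.\<close>
  have "energy_on a nonzero_modes ?t2 = energy_on a ph2.moving_modes ?t2 + energy_on a (nonzero_modes - ph2.moving_modes) ?t2"
  proof -
    have "energy_on a (ph2.moving_modes \<union> (nonzero_modes - ph2.moving_modes)) ?t2 =
        energy_on a ph2.moving_modes ?t2 + energy_on a (nonzero_modes - ph2.moving_modes) ?t2"
      unfolding energy_on_def using le sub2 by (intro infsum_Un_disjoint ph2.square_summable) auto
    then show ?thesis using sub2 by (simp add: Un_absorb1)
  qed
  also have "energy_on a (nonzero_modes - ph2.moving_modes) ?t2 \<le> energy_on a (nonzero_modes - ph2.moving_modes) ?t1"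
    using le by (intro ph2.resting_modes_antimono) auto
  also have "\<dots> \<le> energy_on a ph1.moving_modes ?t1"
    using le rest by (intro ph1.energy_on_mono) (auto simp: ph1.moving_modes_def)
  also note mix1
  also have "energy_on a ph1.moving_modes ?t0 \<le> energy_on a nonzero_modes ?t0"
    using le sub1 by (intro ph1.energy_on_mono) auto
  also note mix2
  also have "energy_on a ph2.moving_modes ?t1 \<le> energy_on a nonzero_modes ?t1"
    using le sub2 by (intro ph1.energy_on_mono) auto
  also have "\<dots> \<le> energy_on a nonzero_modes ?t0"
    using le \<tau>_pos by (intro energy_antimono) auto
  finally show ?thesis by linarith
qed

lemma energy_decay:
  assumes "0 \<le> s" "0 \<le> t"
  shows "energy_on a nonzero_modes (s + t) \<le> 4 * exp (- ln 2 * t / (6 * \<tau>)) * energy_on a nonzero_modes s"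
proof (rule decay_from_halving)
  fix k :: nat
  show "energy_on a nonzero_modes (6 * \<tau> * (real k + 1)) \<le> energy_on a nonzero_modes (6 * \<tau> * real k) / 2"
    using period_halving[of k] by (simp add: algebra_simps)
  show "0 \<le> energy_on a nonzero_modes x" for x
    unfolding energy_on_def by (rule infsum_nonneg) simp
next
  fix x y :: real assume "0 \<le> x" "x \<le> y"
  then show "energy_on a nonzero_modes y \<le> energy_on a nonzero_modes x" by (rule energy_antimono)
qed (use assms \<tau>_pos in simp_all)

end

section \<open>Trigonometric polynomials and Parseval\<close>

abbreviation cell :: "real measure" where
  "cell \<equiv> restrict_space lborel {0..<2 * pi}"

lemma space_cell [simp]: "space cell = {0..<2 * pi}"
  by (simp add: space_restrict_space)

lemma emeasure_cell: "emeasure cell {0..<2 * pi} = ennreal (2 * pi)"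
  by (subst emeasure_restrict_space) auto

lemma measure_cell: "measure cell {0..<2 * pi} = 2 * pi"
  by (simp add: measure_def emeasure_cell)

interpretation cell: finite_measure cell
  by standard (simp add: emeasure_cell)

interpretation torus_product: product_sigma_finite "\<lambda>_::nat. cell"
  by standard

lemma torus_eq: "torus d = (\<Pi>\<^sub>M i\<in>{..<d}. cell)"
  by (simp add: torus_def)

lemma space_torus: "space (torus d) = (\<Pi>\<^sub>E i\<in>{..<d}. {0..<2 * pi})"
  by (simp add: torus_eq space_PiM)

lemma emeasure_torus: "emeasure (torus d) (space (torus d)) = ennreal ((2 * pi) ^ d)"
proof -
  have "emeasure (torus d) (space (torus d)) = (\<Prod>i<d. emeasure cell {0..<2 * pi})"
    unfolding torus_eq space_PiM space_cell
    by (rule torus_product.emeasure_PiM) (auto intro: sets.top[of cell, simplified])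
  also have "\<dots> = ennreal ((2 * pi) ^ d)"
    by (simp add: emeasure_cell ennreal_power)
  finally show ?thesis .
qed

interpretation torus: finite_measure "torus d" for d
  by standard (simp add: emeasure_torus)

lemma measure_torus: "measure (torus d) (space (torus d)) = (2 * pi) ^ d"
  by (simp add: measure_def emeasure_torus)

lemma measurable_coordinate [measurable]: "i < d \<Longrightarrow> (\<lambda>x. x i) \<in> measurable (torus d) cell"
  unfolding torus_eq by (rule measurable_component_singleton) simp

lemma borel_measurable_cell: "f \<in> borel_measurable borel \<Longrightarrow> f \<in> borel_measurable cell"
  by (intro measurable_restrict_space1) simp

lemma borel_measurable_coordinate: "i < d \<Longrightarrow> f \<in> borel_measurable borel \<Longrightarrow> (\<lambda>x. f (x i)) \<in> borel_measurable (torus d)"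
  using measurable_compose[OF measurable_coordinate borel_measurable_cell] .

definition phase :: "nat \<Rightarrow> (nat \<Rightarrow> int) \<Rightarrow> (nat \<Rightarrow> real) \<Rightarrow> real" where
  "phase d m x = (\<Sum>i<d. of_int (m i) * x i)"

definition character :: "nat \<Rightarrow> (nat \<Rightarrow> int) \<Rightarrow> (nat \<Rightarrow> real) \<Rightarrow> complex" where
  "character d m x = cis (phase d m x)"

lemma cis_sum: "cis (\<Sum>i\<in>A. f i) = (\<Prod>i\<in>A. cis (f i))"
  by (induction A rule: infinite_finite_induct) (auto simp flip: cis_mult)

lemma character_prod: "character d m x = (\<Prod>i<d. cis (of_int (m i) * x i))"
  by (simp add: character_def phase_def cis_sum)

lemma norm_character [simp]: "cmod (character d m x) = 1"
  by (simp add: character_def)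

lemma borel_measurable_phase [measurable]: "phase d m \<in> borel_measurable (torus d)"
  unfolding phase_def by (intro borel_measurable_sum borel_measurable_coordinate) auto

lemma borel_measurable_cis [measurable]: "cis \<in> borel_measurable borel"
  by (intro borel_measurable_continuous_onI continuous_intros)

lemma borel_measurable_character [measurable]: "character d m \<in> borel_measurable (torus d)"
  unfolding character_def by measurable

text \<open>The cell is half-open, whereas the fundamental theorem of calculus works on a compact
  interval; the missing endpoint is null.\<close>

lemma integral_cell_eq:
  fixes f :: "real \<Rightarrow> 'a::euclidean_space"
  assumes "continuous_on {0..2 * pi} f"
  shows "integral\<^sup>L cell f = integral {0..2 * pi} f"
proof -
  have "integral\<^sup>L cell f = (LINT x:{0..<2 * pi}|lborel. f x)"
    by (subst integral_restrict_space) (auto simp: set_lebesgue_integral_def)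
  also have "\<dots> = (LINT x:{0..2 * pi}|lborel. f x)"
    unfolding set_lebesgue_integral_def
    by (rule integral_discrete_difference[where X = "{2 * pi}"]) (auto simp: indicator_def)
  also have "\<dots> = integral {0..2 * pi} f"
    by (rule set_borel_integral_eq_integral(2)[OF borel_integrable_atLeastAtMost'[OF assms]])
  finally show ?thesis .
qed

lemma integral_cis_cell: "(\<integral>x. cis (of_int k * x) \<partial>cell) = (if k = 0 then of_real (2 * pi) else 0)"
proof (cases "k = 0")
  case True
  then show ?thesis
    using integral_cell_eq[of "\<lambda>_. 1 :: complex"] by (simp add: scaleR_conv_of_real)
next
  case False
  have "((\<lambda>x. cis (of_int k * x)) has_integral
     (cis (of_int k * (2 * pi)) / (\<i> * of_int k) - cis (of_int k * 0) / (\<i> * of_int k))) {0..2 * pi}"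
    using False unfolding cis_conv_exp
    by (intro fundamental_theorem_of_calculus)
       (auto intro!: derivative_eq_intros has_vector_derivative_real_field simp: field_simps)
  moreover have "cis (of_int k * (2 * pi)) = 1"
    using cis_multiple_2pi[of "of_int k"] by (simp add: mult.commute mult.left_commute)
  ultimately have "integral {0..2 * pi} (\<lambda>x. cis (of_int k * x)) = 0"
    by (simp add: integral_unique)
  then show ?thesis
    using False integral_cell_eq[of "\<lambda>x. cis (of_int k * x)"] by (simp add: continuous_intros)
qed

lemma integral_character:
  assumes "m \<in> modes d"
  shows "integral\<^sup>L (torus d) (character d m) = (if m = 0 then of_real ((2 * pi) ^ d) else 0)"
proof -
  have int: "integrable cell (\<lambda>x. cis (of_int k * x))" for k
    by (rule cell.integrable_const_bound[of _ 1]) (auto intro!: borel_measurable_cell)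
  have "integral\<^sup>L (torus d) (character d m) = (\<integral>x. (\<Prod>i<d. cis (of_int (m i) * x i)) \<partial>(\<Pi>\<^sub>M i\<in>{..<d}. cell))"
    by (simp add: torus_eq character_prod[abs_def])
  also have "\<dots> = (\<Prod>i<d. \<integral>x. cis (of_int (m i) * x) \<partial>cell)"
    by (rule torus_product.product_integral_prod) (auto intro: int)
  also have "\<dots> = (if m = 0 then of_real ((2 * pi) ^ d) else 0)"
  proof (cases "m = 0")
    case False
    then obtain i where "m i \<noteq> 0" by (auto simp: fun_eq_iff)
    moreover from this have "i < d" using assms by (auto simp: modes_def not_less[symmetric])
    ultimately show ?thesis using False by (auto simp: integral_cis_cell intro!: prod_zero)
  qed (simp add: measure_cell scaleR_conv_of_real)
  finally show ?thesis .
qed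

lemma phase_diff: "phase d (m - m') x = phase d m x - phase d m' x"
  by (simp add: phase_def left_diff_distrib sum_subtractf)

lemma phase_add: "phase d (m + m') x = phase d m x + phase d m' x"
  by (simp add: phase_def distrib_right sum.distrib)

lemma integral_character_cnj:
  assumes "m \<in> modes d" "m' \<in> modes d"
  shows "(\<integral>x. character d m x * cnj (character d m' x) \<partial>torus d) = (if m = m' then of_real ((2 * pi) ^ d) else 0)"
proof -
  have "(\<lambda>x. character d m x * cnj (character d m' x)) = character d (m - m')"
    by (simp add: character_def phase_diff cis_cnj cis_mult fun_eq_iff)
  moreover have "m - m' \<in> modes d" using assms by (simp add: modes_def)
  ultimately show ?thesis using integral_character by simp
qed

section \<open>Trigonometric polynomials\<close>

inductive_set trig1 :: "(real \<Rightarrow> complex) set" where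
  base: "(\<lambda>x. c * cis (of_int k * x)) \<in> trig1"
| add: "f \<in> trig1 \<Longrightarrow> g \<in> trig1 \<Longrightarrow> (\<lambda>x. f x + g x) \<in> trig1"

inductive_set trig :: "nat \<Rightarrow> ((nat \<Rightarrow> real) \<Rightarrow> complex) set" for d where
  base: "m \<in> modes d \<Longrightarrow> (\<lambda>x. c * character d m x) \<in> trig d"
| add: "f \<in> trig d \<Longrightarrow> g \<in> trig d \<Longrightarrow> (\<lambda>x. f x + g x) \<in> trig d"

lemma trig1_mult_base: "f \<in> trig1 \<Longrightarrow> (\<lambda>x. c * cis (of_int k * x) * f x) \<in> trig1"
proof (induction rule: trig1.induct)
  case (base c' k')
  have "(\<lambda>x. c * cis (of_int k * x) * (c' * cis (of_int k' * x))) = (\<lambda>x. (c * c') * cis (of_int (k + k') * x))"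
    by (auto simp: fun_eq_iff distrib_right simp flip: cis_mult)
  then show ?case by (simp only: trig1.base)
next
  case (add f g)
  then show ?case using trig1.add[OF add.IH] by (simp add: distrib_left)
qed

lemma trig1_mult: "f \<in> trig1 \<Longrightarrow> g \<in> trig1 \<Longrightarrow> (\<lambda>x. f x * g x) \<in> trig1"
proof (induction rule: trig1.induct)
  case (base c k)
  then show ?case by (rule trig1_mult_base)
next
  case (add f f')
  then show ?case using trig1.add[OF add.IH] by (simp add: distrib_right)
qed

lemma trig1_cos_sin: "(\<lambda>x. of_real (cos x)) \<in> trig1" "(\<lambda>x. of_real (sin x)) \<in> trig1"
proof -
  have "(\<lambda>x. 1 / 2 * cis (of_int 1 * x) + 1 / 2 * cis (of_int (- 1) * x)) \<in> trig1"
    by (intro trig1.intros)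
  also have "(\<lambda>x. 1 / 2 * cis (of_int 1 * x) + 1 / 2 * cis (of_int (- 1) * x)) = (\<lambda>x. of_real (cos x))"
    by (auto simp: fun_eq_iff complex_eq_iff)
  finally show "(\<lambda>x. of_real (cos x)) \<in> trig1" .
  have "(\<lambda>x. (- \<i> / 2) * cis (of_int 1 * x) + (\<i> / 2) * cis (of_int (- 1) * x)) \<in> trig1"
    by (intro trig1.intros)
  also have "(\<lambda>x. (- \<i> / 2) * cis (of_int 1 * x) + (\<i> / 2) * cis (of_int (- 1) * x)) = (\<lambda>x. of_real (sin x))"
    by (auto simp: fun_eq_iff complex_eq_iff)
  finally show "(\<lambda>x. of_real (sin x)) \<in> trig1" .
qed

lemma trig1_const: "(\<lambda>x. c) \<in> trig1"
  using trig1.base[of c 0] by simp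

text \<open>On the circle the real coordinates are cosine and sine. This turns the polynomials
  supplied by Stone-Weierstrass in the plane into trigonometric polynomials.\<close>

lemma real_polynomial_circle_trig1:
  fixes q :: "complex \<Rightarrow> real"
  assumes "real_polynomial_function q"
  shows "(\<lambda>x. of_real (q (cis x))) \<in> trig1"
  using assms
proof induction
  case (linear f)
  then interpret f: bounded_linear f .
  have "f (cis x) = f 1 * cos x + f \<i> * sin x" for x
  proof -
    have "cis x = cos x *\<^sub>R 1 + sin x *\<^sub>R \<i>" by (simp add: complex_eq_iff)
    then show ?thesis by (simp only: f.add f.scaleR) simp
  qed
  then have "(\<lambda>x. of_real (f (cis x))) = (\<lambda>x. of_real (f 1) * of_real (cos x) + of_real (f \<i>) * (of_real (sin x) :: complex))"
    by simp
  also have "\<dots> \<in> trig1"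
    by (intro trig1.add trig1_mult trig1_const trig1_cos_sin)
  finally show ?case .
qed (auto intro: trig1_const trig1.add trig1_mult)

lemma borel_measurable_trig1: "f \<in> trig1 \<Longrightarrow> f \<in> borel_measurable borel"
  by (induction rule: trig1.induct) measurable

lemma borel_measurable_trig: "f \<in> trig d \<Longrightarrow> f \<in> borel_measurable (torus d)"
  by (induction rule: trig.induct) measurable

lemma trig_bounded: "f \<in> trig d \<Longrightarrow> \<exists>C. \<forall>x. cmod (f x) \<le> C"
proof (induction rule: trig.induct)
  case (base m c)
  show ?case by (rule exI[of _ "cmod c"]) (simp add: norm_mult)
next
  case (add f g)
  then obtain C C' where "\<And>x. cmod (f x) \<le> C" "\<And>x. cmod (g x) \<le> C'" by blast
  then show ?case by (intro exI[of _ "C + C'"]) (auto intro: norm_triangle_le add_mono)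
qed

lemma trig_const: "(\<lambda>x. c) \<in> trig d"
proof -
  have "(\<lambda>x. c * character d 0 x) \<in> trig d" by (rule trig.base) (simp add: modes_def)
  then show ?thesis by (simp add: character_def phase_def)
qed

lemma trig_scale: "f \<in> trig d \<Longrightarrow> (\<lambda>x. c * f x) \<in> trig d"
proof (induction rule: trig.induct)
  case (base m c')
  then show ?case using trig.base[of m d "c * c'"] by (simp add: mult.assoc)
next
  case (add f g)
  then show ?case using trig.add[OF add.IH] by (simp add: distrib_left)
qed

lemma trig_mult_cis:
  assumes "f \<in> trig d" "j < d"
  shows "(\<lambda>x. cis (of_int k * x j) * f x) \<in> trig d"
  using assms(1)
proof (induction rule: trig.induct)
  case (base m c)
  have "phase d (m + unit_mode j k) x = of_int k * x j + phase d m x" for x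
  proof -
    have "phase d (unit_mode j k) x = (\<Sum>i<d. if i = j then of_int k * x i else 0)"
      unfolding phase_def unit_mode_def by (intro sum.cong) auto
    then show ?thesis using assms(2) by (simp add: phase_add)
  qed
  then have "(\<lambda>x. cis (of_int k * x j) * (c * character d m x)) = (\<lambda>x. c * character d (m + unit_mode j k) x)"
    by (auto simp: fun_eq_iff character_def simp flip: cis_mult)
  moreover have "m + unit_mode j k \<in> modes d"
    using base assms(2) by (auto simp: modes_def unit_mode_def)
  ultimately show ?case by (simp only: trig.base)
next
  case (add f g)
  then show ?case using trig.add[OF add.IH] by (simp add: distrib_left)
qed

lemma trig_mult_trig1:
  assumes "f \<in> trig d" "j < d" "g \<in> trig1"
  shows "(\<lambda>x. g (x j) * f x) \<in> trig d"
  using assms(3)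
proof (induction rule: trig1.induct)
  case (base c k)
  show ?case using trig_scale[OF trig_mult_cis[OF assms(1,2)], of c k] by (simp add: mult.assoc)
next
  case (add g g')
  then show ?case using trig.add[OF add.IH] by (simp add: distrib_right)
qed

section \<open>Density of trigonometric polynomials in L2\<close>

definition sq_err :: "nat \<Rightarrow> ((nat \<Rightarrow> real) \<Rightarrow> complex) \<Rightarrow> ((nat \<Rightarrow> real) \<Rightarrow> complex) \<Rightarrow> ennreal" where
  "sq_err d f g = (\<integral>\<^sup>+x. ennreal ((cmod (f x - g x))\<^sup>2) \<partial>torus d)"

lemma norm_diff_square_le: "(cmod (u - w))\<^sup>2 \<le> 2 * (cmod (u - v))\<^sup>2 + 2 * (cmod (v - w))\<^sup>2"
proof -
  have "(cmod (u - w))\<^sup>2 \<le> (cmod (u - v) + cmod (v - w))\<^sup>2"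
    using norm_triangle_ineq[of "u - v" "v - w"] by (intro power_mono) auto
  also have "\<dots> \<le> 2 * (cmod (u - v))\<^sup>2 + 2 * (cmod (v - w))\<^sup>2"
    using sum_squares_bound[of "cmod (u - v)" "cmod (v - w)"] by (simp add: power2_sum)
  finally show ?thesis .
qed

lemma sq_err_triangle:
  assumes [measurable]: "f \<in> borel_measurable (torus d)" "g \<in> borel_measurable (torus d)" "h \<in> borel_measurable (torus d)"
  shows "sq_err d f h \<le> 2 * sq_err d f g + 2 * sq_err d g h"
proof -
  have "sq_err d f h \<le> (\<integral>\<^sup>+x. 2 * ennreal ((cmod (f x - g x))\<^sup>2) + 2 * ennreal ((cmod (g x - h x))\<^sup>2) \<partial>torus d)"
    unfolding sq_err_def
  proof (rule nn_integral_mono)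
    fix x
    have "ennreal ((cmod (f x - h x))\<^sup>2) \<le> ennreal (2 * (cmod (f x - g x))\<^sup>2 + 2 * (cmod (g x - h x))\<^sup>2)"
      by (intro ennreal_leI norm_diff_square_le)
    then show "ennreal ((cmod (f x - h x))\<^sup>2) \<le> 2 * ennreal ((cmod (f x - g x))\<^sup>2) + 2 * ennreal ((cmod (g x - h x))\<^sup>2)"
      by (simp add: ennreal_plus ennreal_mult)
  qed
  also have "\<dots> = 2 * sq_err d f g + 2 * sq_err d g h"
    unfolding sq_err_def by (subst nn_integral_add) (auto simp: nn_integral_cmult)
  finally show ?thesis .
qed

text \<open>The L2 closure, with squared distances valued in the extended reals so that no
  integrability has to be shown. Squaring makes the triangle inequality lose a factor 2, which
  explains the tolerances \<epsilon> / 4 below.\<close>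

definition trig_closure :: "nat \<Rightarrow> ((nat \<Rightarrow> real) \<Rightarrow> complex) set" where
  "trig_closure d = {f \<in> borel_measurable (torus d). \<forall>\<epsilon>>0. \<exists>P\<in>trig d. sq_err d f P \<le> ennreal \<epsilon>}"

lemma trig_closure_measurable: "f \<in> trig_closure d \<Longrightarrow> f \<in> borel_measurable (torus d)"
  by (simp add: trig_closure_def)

lemma trig_closureD: "f \<in> trig_closure d \<Longrightarrow> 0 < \<epsilon> \<Longrightarrow> \<exists>P\<in>trig d. sq_err d f P \<le> ennreal \<epsilon>"
  by (simp add: trig_closure_def)

lemma trig_subset_closure: "f \<in> trig d \<Longrightarrow> f \<in> trig_closure d"
  unfolding trig_closure_def by (auto simp: borel_measurable_trig sq_err_def intro!: bexI[of _ f])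

lemma trig_closure_cong:
  assumes "f \<in> trig_closure d" "\<And>x. x \<in> space (torus d) \<Longrightarrow> f x = g x"
  shows "g \<in> trig_closure d"
proof -
  have "g \<in> borel_measurable (torus d)"
    using trig_closure_measurable[OF assms(1)] measurable_cong[of "torus d" f g borel] assms(2) by simp
  moreover have "sq_err d g P = sq_err d f P" for P
    unfolding sq_err_def using assms(2) by (intro nn_integral_cong) simp
  ultimately show ?thesis using assms(1) by (simp add: trig_closure_def)
qed

lemma trig_closure_limit:
  assumes g: "g \<in> borel_measurable (torus d)"
    and lim: "\<And>\<epsilon>. 0 < \<epsilon> \<Longrightarrow> \<exists>f\<in>trig_closure d. sq_err d g f \<le> ennreal \<epsilon>"
  shows "g \<in> trig_closure d"
  unfolding trig_closure_def
proof (intro CollectI conjI allI impI g)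
  fix \<epsilon> :: real assume "0 < \<epsilon>"
  then obtain f where f: "f \<in> trig_closure d" "sq_err d g f \<le> ennreal (\<epsilon> / 4)"
    using lim[of "\<epsilon> / 4"] by auto
  obtain P where P: "P \<in> trig d" "sq_err d f P \<le> ennreal (\<epsilon> / 4)"
    using trig_closureD[OF f(1), of "\<epsilon> / 4"] \<open>0 < \<epsilon>\<close> by auto
  have "sq_err d g P \<le> 2 * sq_err d g f + 2 * sq_err d f P"
    by (intro sq_err_triangle g trig_closure_measurable f borel_measurable_trig P)
  also have "\<dots> \<le> 2 * ennreal (\<epsilon> / 4) + 2 * ennreal (\<epsilon> / 4)"
    by (intro add_mono mult_left_mono f P) auto
  also have "\<dots> = ennreal \<epsilon>"
  proof -
    have "2 * ennreal (\<epsilon> / 4) = ennreal (\<epsilon> / 2)"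
      using \<open>0 < \<epsilon>\<close> ennreal_mult[of 2 "\<epsilon> / 4"] by simp
    then show ?thesis using \<open>0 < \<epsilon>\<close> ennreal_plus[of "\<epsilon> / 2" "\<epsilon> / 2"] by simp
  qed
  finally show "\<exists>P\<in>trig d. sq_err d g P \<le> ennreal \<epsilon>" using P by blast
qed

lemma trig_closure_add:
  assumes "f \<in> trig_closure d" "g \<in> trig_closure d"
  shows "(\<lambda>x. f x + g x) \<in> trig_closure d"
proof (rule trig_closure_limit)
  note [measurable] = trig_closure_measurable[OF assms(1)] trig_closure_measurable[OF assms(2)]
  show "(\<lambda>x. f x + g x) \<in> borel_measurable (torus d)" by measurable
  fix \<epsilon> :: real assume \<epsilon>: "0 < \<epsilon>"
  obtain P Q where P: "P \<in> trig d" "sq_err d f P \<le> ennreal (\<epsilon> / 4)" and Q: "Q \<in> trig d" "sq_err d g Q \<le> ennreal (\<epsilon> / 4)"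
    using trig_closureD[OF assms(1), of "\<epsilon> / 4"] trig_closureD[OF assms(2), of "\<epsilon> / 4"] \<epsilon> by auto
  note [measurable] = borel_measurable_trig[OF P(1)] borel_measurable_trig[OF Q(1)]
  have "sq_err d (\<lambda>x. f x + g x) (\<lambda>x. P x + Q x) \<le> 2 * sq_err d (\<lambda>x. f x + g x) (\<lambda>x. P x + g x) + 2 * sq_err d (\<lambda>x. P x + g x) (\<lambda>x. P x + Q x)"
    by (intro sq_err_triangle) measurable
  also have "\<dots> = 2 * sq_err d f P + 2 * sq_err d g Q"
    by (simp add: sq_err_def)
  also have "\<dots> \<le> 2 * ennreal (\<epsilon> / 4) + 2 * ennreal (\<epsilon> / 4)"
    by (intro add_mono mult_left_mono P Q) auto
  also have "\<dots> = ennreal \<epsilon>"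
  proof -
    have "2 * ennreal (\<epsilon> / 4) = ennreal (\<epsilon> / 2)"
      using \<epsilon> ennreal_mult[of 2 "\<epsilon> / 4"] by simp
    then show ?thesis using \<epsilon> ennreal_plus[of "\<epsilon> / 2" "\<epsilon> / 2"] by simp
  qed
  finally show "\<exists>f'\<in>trig_closure d. sq_err d (\<lambda>x. f x + g x) f' \<le> ennreal \<epsilon>"
    using trig_subset_closure[OF trig.add[OF P(1) Q(1)]] by blast
qed

lemma trig_closure_scale:
  assumes "f \<in> trig_closure d"
  shows "(\<lambda>x. c * f x) \<in> trig_closure d"
proof (rule trig_closure_limit)
  note [measurable] = trig_closure_measurable[OF assms]
  show "(\<lambda>x. c * f x) \<in> borel_measurable (torus d)" by measurable
  fix \<epsilon> :: real assume \<epsilon>: "0 < \<epsilon>"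
  define C where "C = (cmod c)\<^sup>2 + 1"
  have C: "0 < C" by (simp add: C_def add_nonneg_pos)
  obtain P where P: "P \<in> trig d" "sq_err d f P \<le> ennreal (\<epsilon> / C)"
    using trig_closureD[OF assms, of "\<epsilon> / C"] \<epsilon> C by auto
  note [measurable] = borel_measurable_trig[OF P(1)]
  have "sq_err d (\<lambda>x. c * f x) (\<lambda>x. c * P x) = (\<integral>\<^sup>+x. ennreal ((cmod c)\<^sup>2) * ennreal ((cmod (f x - P x))\<^sup>2) \<partial>torus d)"
    unfolding sq_err_def by (simp add: norm_mult power_mult_distrib ennreal_mult flip: right_diff_distrib)
  also have "\<dots> = ennreal ((cmod c)\<^sup>2) * sq_err d f P"
    unfolding sq_err_def by (intro nn_integral_cmult) measurable
  also have "\<dots> \<le> ennreal C * ennreal (\<epsilon> / C)"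
    by (intro mult_mono P ennreal_leI) (auto simp: C_def)
  also have "\<dots> = ennreal \<epsilon>"
    using C \<epsilon> by (simp flip: ennreal_mult)
  finally show "\<exists>f'\<in>trig_closure d. sq_err d (\<lambda>x. c * f x) f' \<le> ennreal \<epsilon>"
    using trig_subset_closure[OF trig_scale[OF P(1)]] by blast
qed

lemma trig_closure_sum: "(\<And>i. i \<in> A \<Longrightarrow> f i \<in> trig_closure d) \<Longrightarrow> (\<lambda>x. \<Sum>i\<in>A. f i x) \<in> trig_closure d"
  by (induction A rule: infinite_finite_induct)
    (auto intro: trig_subset_closure[OF trig_const] trig_closure_add)

text \<open>One point lies in the open interval while the other may be an endpoint. This keeps a
  subset of the open interval apart from a set containing both 0 and 2 pi, which coincide on the
  circle.\<close>

lemma cis_inj_cell: "cis x = cis y \<Longrightarrow> 0 < x \<Longrightarrow> x < 2 * pi \<Longrightarrow> 0 \<le> y \<Longrightarrow> y \<le> 2 * pi \<Longrightarrow> x = y"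
proof -
  assume *: "cis x = cis y" "0 < x" "x < 2 * pi" "0 \<le> y" "y \<le> 2 * pi"
  then have "cis (x - y) = 1" by (simp flip: cis_divide)
  then have "cos (x - y) = 1" by (simp add: complex_eq_iff)
  then obtain k :: int where k: "x - y = of_int k * 2 * pi" by (auto simp: cos_one_2pi_int)
  have "- (2 * pi) < x - y" "x - y < 2 * pi" using * by auto
  then have "(- 1) * (2 * pi) < of_int k * (2 * pi)" "of_int k * (2 * pi) < 1 * (2 * pi)"
    using k by (simp_all add: mult.assoc)
  then have "(- 1 :: real) < of_int k" "of_int k < (1 :: real)"
    by (simp_all only: mult_less_cancel_right_pos[of "2 * pi"] pi_gt_zero zero_less_mult_iff zero_less_numeral simp_thms)
  then have "k = 0" by linarith
  with k show "x = y" by simp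
qed

text \<open>Regularity of Lebesgue measure gives a closed set inside and an open set outside of
  nearly equal measure. Urysohn's lemma interpolates between them on the circle, and
  Stone-Weierstrass makes the interpolant a trigonometric polynomial.\<close>

lemma trig1_approximates_indicator:
  assumes B: "B \<in> sets cell" and \<epsilon>: "0 < \<epsilon>"
  shows "\<exists>g\<in>trig1. (\<integral>\<^sup>+x. ennreal ((cmod (indicator B x - g x))\<^sup>2) \<partial>cell) \<le> ennreal \<epsilon>"
proof -
  \<comment> \<open>The exceptional set has measure at most 2 \<delta> and enters with a factor 2;
    the uniform error contributes 2 \<eta>^2 times the length 2 pi. Each amounts to \<epsilon> /
    2.\<close>
  define \<delta> where "\<delta> = \<epsilon> / 8"
  define \<eta> where "\<eta> = sqrt (\<epsilon> / (8 * pi))"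
  have \<delta>: "0 < \<delta>" and \<eta>: "0 < \<eta>" using \<epsilon> by (simp_all add: \<delta>_def \<eta>_def)
  \<comment> \<open>The points 0 and 2 pi are the same on the circle. Removing 0, a null set, places
    the set in the open interval, away from this seam.\<close>
  define B' where "B' = B - {0}"
  have B_sub: "B \<subseteq> {0..<2 * pi}" "B \<in> sets lborel" using B by (auto simp: sets_restrict_space)
  then have B'_sub: "B' \<subseteq> {0<..<2 * pi}" by (force simp: B'_def)
  have B'_leb: "B' \<in> sets lebesgue" using B_sub(2) by (auto simp: B'_def)
  obtain K where K: "closed K" "K \<subseteq> B'" "(B' - K) \<in> lmeasurable" "emeasure lebesgue (B' - K) < ennreal \<delta>"
    using sets_lebesgue_inner_closed[OF B'_leb \<delta>] .
  obtain U where U: "open U" "B' \<subseteq> U" "(U - B') \<in> lmeasurable" "emeasure lebesgue (U - B') < ennreal \<delta>"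
    using sets_lebesgue_outer_open[OF B'_leb \<delta>] .
  define W where "W = U \<inter> {0<..<2 * pi}"
  define V where "V = {0..2 * pi} - W"
  have "K \<inter> {0..2 * pi} = K" using K(2) B'_sub by force
  then have "compact K" using closed_Int_compact[OF K(1) compact_Icc[of 0 "2 * pi"]] by simp
  then have compK: "compact (cis ` K)"
    by (intro compact_continuous_image continuous_intros)
  have "open W" using U(1) by (simp add: W_def open_Int)
  then have "compact V" unfolding V_def by (intro compact_diff) auto
  then have compV: "compact (cis ` V)"
    by (intro compact_continuous_image continuous_intros)
  have "cis ` K \<inter> cis ` V = {}"
  proof (rule ccontr)
    assume "cis ` K \<inter> cis ` V \<noteq> {}"
    then obtain x y where xy: "x \<in> K" "y \<in> V" "cis x = cis y" by auto
    then have "x \<in> W" using K(2) U(2) B'_sub by (auto simp: W_def)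
    moreover from this have "x = y" using xy by (intro cis_inj_cell) (auto simp: W_def V_def)
    ultimately show False using xy by (simp add: V_def)
  qed
  then obtain H :: "complex \<Rightarrow> real" where H: "continuous_on UNIV H" "\<And>z. H z \<in> closed_segment 1 0"
    "\<And>z. z \<in> cis ` K \<Longrightarrow> H z = 1" "\<And>z. z \<in> cis ` V \<Longrightarrow> H z = 0"
    using Urysohn[OF compact_imp_closed[OF compK] compact_imp_closed[OF compV], of "1 :: real" 0] by metis
  have H01: "0 \<le> H z" "H z \<le> 1" for z
    using H(2)[of z] by (auto simp: closed_segment_eq_real_ivl)
  obtain q where q: "real_polynomial_function q" "\<And>z. z \<in> cis ` {0..2 * pi} \<Longrightarrow> \<bar>H z - q z\<bar> < \<eta>"
  proof (rule Stone_Weierstrass_real_polynomial_function)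
    show "compact (cis ` {0..2 * pi})" by (intro compact_continuous_image continuous_intros) auto
    show "continuous_on (cis ` {0..2 * pi}) H" using H(1) continuous_on_subset by blast
  qed (use \<eta> in auto)
  define g where "g x = complex_of_real (q (cis x))" for x
  have g: "g \<in> trig1" unfolding g_def[abs_def] by (rule real_polynomial_circle_trig1[OF q(1)])
  define Z where "Z = (B' - K) \<union> (U - B') \<union> {0}"
  have Z: "Z \<in> sets lebesgue"
    unfolding Z_def by (intro sets.Un fmeasurableD[OF K(3)] fmeasurableD[OF U(3)]) auto
  have pointwise: "(cmod (indicator B x - g x))\<^sup>2 \<le> 2 * indicator Z x + 2 * \<eta>\<^sup>2" if x: "x \<in> {0..<2 * pi}" for x
  proof -
    have "\<bar>indicator B x - H (cis x)\<bar> \<le> indicator Z x"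
    proof (cases "x \<in> Z")
      case True
      then show ?thesis using H01[of "cis x"] by (auto simp: indicator_def)
    next
      case False
      then consider "x \<in> K" | "x \<notin> U" "x \<notin> B" using x K(2) U(2) by (auto simp: Z_def B'_def)
      then show ?thesis
      proof cases
        case 1
        then have "x \<in> B" "H (cis x) = 1" using K(2) H(3) by (auto simp: B'_def)
        then show ?thesis by simp
      next
        case 2
        then have "x \<in> V" using x by (auto simp: V_def W_def)
        then have "H (cis x) = 0" using H(4) by blast
        with 2 show ?thesis by simp
      qed
    qed
    then have "\<bar>indicator B x - H (cis x)\<bar>\<^sup>2 \<le> (indicator Z x)\<^sup>2" by (intro power_mono) auto
    moreover have "\<bar>H (cis x) - q (cis x)\<bar>\<^sup>2 \<le> \<eta>\<^sup>2"
      using q(2)[of "cis x"] x by (intro power_mono) (auto intro: less_imp_le)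
    moreover have "(cmod (indicator B x - g x))\<^sup>2 \<le>
        2 * (cmod (complex_of_real (indicator B x - H (cis x))))\<^sup>2 + 2 * (cmod (complex_of_real (H (cis x) - q (cis x))))\<^sup>2"
    proof -
      have ind: "complex_of_real (indicator B x) = indicator B x" by (simp add: indicator_def)
      show ?thesis
        using norm_diff_square_le[of "indicator B x" "g x" "of_real (H (cis x))"]
        by (simp only: g_def of_real_diff ind)
    qed
    moreover have "(indicator Z x :: real)\<^sup>2 = indicator Z x" by (simp add: indicator_def)
    ultimately show ?thesis by (simp only: norm_of_real)
  qed
  have "(\<integral>\<^sup>+x. ennreal ((cmod (indicator B x - g x))\<^sup>2) \<partial>cell) \<le>
     (\<integral>\<^sup>+x. ennreal (2 * indicator Z x + 2 * \<eta>\<^sup>2) * indicator {0..<2 * pi} x \<partial>lebesgue)"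
  proof -
    have "(\<integral>\<^sup>+x. ennreal ((cmod (indicator B x - g x))\<^sup>2) \<partial>cell) =
      (\<integral>\<^sup>+x. ennreal ((cmod (indicator B x - g x))\<^sup>2) * indicator {0..<2 * pi} x \<partial>lborel)"
      by (rule nn_integral_restrict_space) auto
    also have "\<dots> = (\<integral>\<^sup>+x. ennreal ((cmod (indicator B x - g x))\<^sup>2) * indicator {0..<2 * pi} x \<partial>lebesgue)"
      using borel_measurable_trig1[OF g] B_sub(2) by (subst nn_integral_completion) auto
    also have "\<dots> \<le> (\<integral>\<^sup>+x. ennreal (2 * indicator Z x + 2 * \<eta>\<^sup>2) * indicator {0..<2 * pi} x \<partial>lebesgue)"
    proof (rule nn_integral_mono)
      fix x show "ennreal ((cmod (indicator B x - g x))\<^sup>2) * indicator {0..<2 * pi} x \<le>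
          ennreal (2 * indicator Z x + 2 * \<eta>\<^sup>2) * indicator {0..<2 * pi} x"
        using ennreal_leI[OF pointwise[of x]] by (cases "x \<in> {0..<2 * pi}") simp_all
    qed
    finally show ?thesis .
  qed
  also have "\<dots> \<le> (\<integral>\<^sup>+x. 2 * indicator Z x + ennreal (2 * \<eta>\<^sup>2) * indicator {0..<2 * pi} x \<partial>lebesgue)"
    by (intro nn_integral_mono) (auto simp: indicator_def ennreal_plus)
  also have "\<dots> = 2 * emeasure lebesgue Z + ennreal (2 * \<eta>\<^sup>2) * emeasure lebesgue {0..<2 * pi}"
  proof -
    have cell: "{0..<2 * pi} \<in> sets lebesgue" by simp
    show ?thesis
      by (subst nn_integral_add; (subst nn_integral_cmult_indicator[OF Z] nn_integral_cmult_indicator[OF cell])?)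
        (auto intro!: borel_measurable_times_ennreal borel_measurable_indicator Z cell simp: nn_integral_cmult_indicator[OF cell])
  qed
  also have "emeasure lebesgue Z \<le> ennreal \<delta> + ennreal \<delta> + 0"
  proof -
    have sets: "B' - K \<in> sets lebesgue" "U - B' \<in> sets lebesgue" "{0::real} \<in> sets lebesgue"
      using fmeasurableD[OF K(3)] fmeasurableD[OF U(3)] by simp_all
    have "emeasure lebesgue Z \<le> emeasure lebesgue ((B' - K) \<union> (U - B')) + emeasure lebesgue {0::real}"
      unfolding Z_def by (intro emeasure_subadditive sets.Un sets)
    also have "\<dots> \<le> emeasure lebesgue (B' - K) + emeasure lebesgue (U - B') + emeasure lebesgue {0::real}"
      by (intro add_right_mono emeasure_subadditive sets)
    also have "\<dots> \<le> ennreal \<delta> + ennreal \<delta> + 0"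
      by (intro add_mono less_imp_le[OF K(4)] less_imp_le[OF U(4)]) simp
    finally show ?thesis .
  qed
  also have "ennreal (2 * \<eta>\<^sup>2) * emeasure lebesgue {0..<2 * pi} = ennreal (\<epsilon> / 2)"
    using \<epsilon> by (simp add: \<eta>_def flip: ennreal_mult)
  also have "2 * (ennreal \<delta> + ennreal \<delta> + 0) + ennreal (\<epsilon> / 2) = ennreal \<epsilon>"
  proof -
    have double: "2 * ennreal r = ennreal (2 * r)" if "0 \<le> r" for r
      using ennreal_mult[of 2 r] that by simp
    have "ennreal \<delta> + ennreal \<delta> + 0 = ennreal (\<delta> + \<delta>)"
      using \<delta> by (simp flip: ennreal_plus)
    then have "2 * (ennreal \<delta> + ennreal \<delta> + 0) = ennreal (2 * (\<delta> + \<delta>))"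
      using \<delta> by (simp only: double)
    then show ?thesis using \<delta> \<epsilon> by (simp add: \<delta>_def flip: ennreal_plus)
  qed
  finally show ?thesis using g by (auto simp: mult_left_mono add_right_mono)
qed

lemma nn_integral_coordinate:
  assumes j: "j < d" and f: "f \<in> borel_measurable cell"
  shows "(\<integral>\<^sup>+x. f (x j) \<partial>torus d) = ennreal ((2 * pi) ^ (d - 1)) * integral\<^sup>N cell f"
proof -
  let ?F = "\<lambda>i. if i = j then f else (\<lambda>_. 1)"
  have "(\<integral>\<^sup>+x. f (x j) \<partial>torus d) = (\<integral>\<^sup>+x. (\<Prod>i\<in>{..<d}. ?F i (x i)) \<partial>(\<Pi>\<^sub>M i\<in>{..<d}. cell))"
    unfolding torus_eq
  proof (rule nn_integral_cong)
    fix x :: "nat \<Rightarrow> real"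
    have "(\<Prod>i\<in>{..<d}. ?F i (x i)) = ?F j (x j) * (\<Prod>i\<in>{..<d} - {j}. ?F i (x i))"
      using j by (intro prod.remove) auto
    also have "(\<Prod>i\<in>{..<d} - {j}. ?F i (x i)) = 1" by (intro prod.neutral) auto
    finally show "f (x j) = (\<Prod>i\<in>{..<d}. ?F i (x i))" by simp
  qed
  also have "\<dots> = (\<Prod>i\<in>{..<d}. integral\<^sup>N cell (?F i))"
    by (rule torus_product.product_nn_integral_prod) (use f in auto)
  also have "\<dots> = integral\<^sup>N cell (?F j) * (\<Prod>i\<in>{..<d} - {j}. integral\<^sup>N cell (?F i))"
    using j by (intro prod.remove) auto
  also have "(\<Prod>i\<in>{..<d} - {j}. integral\<^sup>N cell (?F i)) = (\<Prod>i\<in>{..<d} - {j}. ennreal (2 * pi))"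
    by (intro prod.cong) (auto simp: emeasure_cell)
  also have "\<dots> = ennreal ((2 * pi) ^ (d - 1))"
    using j by (simp add: ennreal_power)
  finally show ?thesis by (simp add: mult.commute)
qed

lemma borel_measurable_cell_indicator:
  "B \<in> sets cell \<Longrightarrow> j < d \<Longrightarrow> (\<lambda>x. indicator B (x j) :: complex) \<in> borel_measurable (torus d)"
  by (rule measurable_compose[OF measurable_coordinate]) auto

text \<open>Two approximations in turn: f by a trigonometric polynomial P, which multiplication by
  an indicator does not worsen, then the indicator by a polynomial in one variable, at the cost of a
  bound on P. Products of indicators are thus reached one coordinate at a time.\<close>

lemma trig_closure_mult_indicator:
  assumes f: "f \<in> trig_closure d" and j: "j < d" and B: "B \<in> sets cell"
  shows "(\<lambda>x. indicator B (x j) * f x) \<in> trig_closure d"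
proof (rule trig_closure_limit)
  note [measurable] = trig_closure_measurable[OF f] borel_measurable_cell_indicator[OF B j]
  show "(\<lambda>x. indicator B (x j) * f x) \<in> borel_measurable (torus d)" by measurable
  fix \<epsilon> :: real assume \<epsilon>: "0 < \<epsilon>"
  obtain P where P: "P \<in> trig d" "sq_err d f P \<le> ennreal (\<epsilon> / 4)"
    using trig_closureD[OF f, of "\<epsilon> / 4"] \<epsilon> by auto
  note [measurable] = borel_measurable_trig[OF P(1)]
  obtain C where C: "\<And>x. cmod (P x) \<le> C" using trig_bounded[OF P(1)] by blast
  \<comment> \<open>The cost of replacing the indicator: the bound on P squared times the volume of
    the other coordinates. The added 1 keeps the divisor positive.\<close>
  define D where "D = C\<^sup>2 * (2 * pi) ^ (d - 1) + 1"
  have D: "0 < D" by (simp add: D_def add_nonneg_pos)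
  obtain g where g: "g \<in> trig1" "(\<integral>\<^sup>+x. ennreal ((cmod (indicator B x - g x))\<^sup>2) \<partial>cell) \<le> ennreal (\<epsilon> / (4 * D))"
    using trig1_approximates_indicator[OF B, of "\<epsilon> / (4 * D)"] \<epsilon> D by auto
  note gm = borel_measurable_trig1[OF g(1)]
  note [measurable] = borel_measurable_coordinate[OF j gm]
  have 1: "sq_err d (\<lambda>x. indicator B (x j) * f x) (\<lambda>x. indicator B (x j) * P x) \<le> sq_err d f P"
    unfolding sq_err_def by (intro nn_integral_mono ennreal_leI power_mono) (auto simp: indicator_def)
  have 2: "sq_err d (\<lambda>x. indicator B (x j) * P x) (\<lambda>x. g (x j) * P x) \<le> ennreal (\<epsilon> / 4)"
  proof -
    let ?h = "\<lambda>y. ennreal ((cmod (indicator B y - g y))\<^sup>2)"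
    have h: "?h \<in> borel_measurable cell"
      using B borel_measurable_cell[OF gm] by measurable
    have "sq_err d (\<lambda>x. indicator B (x j) * P x) (\<lambda>x. g (x j) * P x) \<le> (\<integral>\<^sup>+x. ennreal (C\<^sup>2) * ?h (x j) \<partial>torus d)"
      unfolding sq_err_def
    proof (rule nn_integral_mono)
      fix x
      have "(cmod (indicator B (x j) * P x - g (x j) * P x))\<^sup>2 = (cmod (P x))\<^sup>2 * (cmod (indicator B (x j) - g (x j)))\<^sup>2"
        by (simp add: norm_mult power_mult_distrib flip: left_diff_distrib)
      also have "\<dots> \<le> C\<^sup>2 * (cmod (indicator B (x j) - g (x j)))\<^sup>2"
        using C by (intro mult_right_mono power_mono) auto
      finally have "ennreal ((cmod (indicator B (x j) * P x - g (x j) * P x))\<^sup>2) \<le> ennreal (C\<^sup>2 * (cmod (indicator B (x j) - g (x j)))\<^sup>2)"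
        by (rule ennreal_leI)
      then show "ennreal ((cmod (indicator B (x j) * P x - g (x j) * P x))\<^sup>2) \<le> ennreal (C\<^sup>2) * ?h (x j)"
        by (simp add: ennreal_mult)
    qed
    also have "\<dots> = ennreal (C\<^sup>2) * (\<integral>\<^sup>+x. ?h (x j) \<partial>torus d)"
      by (rule nn_integral_cmult) (rule measurable_compose[OF measurable_coordinate[OF j] h])
    also have "\<dots> = ennreal (C\<^sup>2) * (ennreal ((2 * pi) ^ (d - 1)) * integral\<^sup>N cell ?h)"
      by (subst nn_integral_coordinate[OF j h]) simp
    also have "\<dots> \<le> ennreal (C\<^sup>2) * (ennreal ((2 * pi) ^ (d - 1)) * ennreal (\<epsilon> / (4 * D)))"
      by (intro mult_left_mono g) auto
    also have "\<dots> = ennreal (C\<^sup>2 * ((2 * pi) ^ (d - 1) * (\<epsilon> / (4 * D))))"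
    proof -
      have r: "0 \<le> \<epsilon> / (4 * D)" "0 \<le> (2 * pi) ^ (d - 1)" using \<epsilon> D by auto
      show ?thesis
        by (simp only: ennreal_mult[symmetric] r mult_nonneg_nonneg[OF r(2,1)] zero_le_power2)
    qed
    also have "\<dots> \<le> ennreal (D * (\<epsilon> / (4 * D)))"
    proof (rule ennreal_leI)
      have "(C\<^sup>2 * (2 * pi) ^ (d - 1)) * (\<epsilon> / (4 * D)) \<le> D * (\<epsilon> / (4 * D))"
        using \<epsilon> D by (intro mult_right_mono) (auto simp: D_def)
      then show "C\<^sup>2 * ((2 * pi) ^ (d - 1) * (\<epsilon> / (4 * D))) \<le> D * (\<epsilon> / (4 * D))" by (simp only: mult.assoc)
    qed
    also have "D * (\<epsilon> / (4 * D)) = \<epsilon> / 4" using D by simp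
    finally show ?thesis .
  qed
  have "sq_err d (\<lambda>x. indicator B (x j) * f x) (\<lambda>x. g (x j) * P x) \<le>
      2 * sq_err d (\<lambda>x. indicator B (x j) * f x) (\<lambda>x. indicator B (x j) * P x) + 2 * sq_err d (\<lambda>x. indicator B (x j) * P x) (\<lambda>x. g (x j) * P x)"
    by (intro sq_err_triangle) measurable
  also have "\<dots> \<le> 2 * ennreal (\<epsilon> / 4) + 2 * ennreal (\<epsilon> / 4)"
    by (intro add_mono mult_left_mono 2 order_trans[OF 1 P(2)]) auto
  also have "\<dots> = ennreal \<epsilon>"
  proof -
    have "2 * ennreal (\<epsilon> / 4) = ennreal (\<epsilon> / 2)"
      using \<epsilon> ennreal_mult[of 2 "\<epsilon> / 4"] by simp
    then show ?thesis using \<epsilon> ennreal_plus[of "\<epsilon> / 2" "\<epsilon> / 2"] by simp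
  qed
  finally show "\<exists>f'\<in>trig_closure d. sq_err d (\<lambda>x. indicator B (x j) * f x) f' \<le> ennreal \<epsilon>"
    using trig_subset_closure[OF trig_mult_trig1[OF P(1) j g(1)]] by blast
qed

lemma trig_closure_rectangle:
  assumes "\<And>i. i < d \<Longrightarrow> B i \<in> sets cell"
  shows "(indicator (\<Pi>\<^sub>E i\<in>{..<d}. B i) :: _ \<Rightarrow> complex) \<in> trig_closure d"
proof -
  have "(\<lambda>x. \<Prod>i<k. indicator (B i) (x i) :: complex) \<in> trig_closure d" if "k \<le> d" for k
    using that
  proof (induction k)
    case (Suc k)
    then have "(\<lambda>x. indicator (B k) (x k) * (\<Prod>i<k. indicator (B i) (x i) :: complex)) \<in> trig_closure d"
      using assms by (intro trig_closure_mult_indicator) auto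
    then show ?case by (simp add: mult.commute)
  qed (simp add: trig_subset_closure[OF trig_const])
  from this[OF order_refl] show ?thesis
  proof (rule trig_closure_cong)
    fix x assume x: "x \<in> space (torus d)"
    show "(\<Prod>i<d. indicator (B i) (x i)) = (indicator (\<Pi>\<^sub>E i\<in>{..<d}. B i) x :: complex)"
    proof (cases "\<forall>i<d. x i \<in> B i")
      case True
      then show ?thesis using x by (auto simp: space_torus PiE_def Pi_def)
    next
      case False
      then obtain i where i: "i < d" "x i \<notin> B i" by blast
      then have "(\<Prod>i<d. indicator (B i) (x i) :: complex) = 0" by (auto intro!: prod_zero bexI[of _ i])
      moreover have "x \<notin> (\<Pi>\<^sub>E i\<in>{..<d}. B i)" using i by (auto simp: PiE_def Pi_def)
      ultimately show ?thesis by simp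
    qed
  qed
qed

lemma sq_err_indicator:
  assumes "A \<in> sets (torus d)" "B \<in> sets (torus d)" "B \<subseteq> A"
  shows "sq_err d (indicator A) (indicator B) = emeasure (torus d) (A - B)"
proof -
  have "sq_err d (indicator A) (indicator B) = (\<integral>\<^sup>+x. indicator (A - B) x \<partial>torus d)"
    unfolding sq_err_def using assms(3) by (intro nn_integral_cong) (auto simp: indicator_def)
  also have "\<dots> = emeasure (torus d) (A - B)"
    using assms by (intro nn_integral_indicator) auto
  finally show ?thesis .
qed

text \<open>Rectangles generate the product sigma-algebra and are stable under intersection, so
  Dynkin's theorem leaves complements and disjoint unions; for a union the measure of the tail tends
  to 0, as the torus has finite measure.\<close>

lemma trig_closure_indicator:
  assumes "A \<in> sets (torus d)"
  shows "(indicator A :: _ \<Rightarrow> complex) \<in> trig_closure d"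
proof -
  let ?\<Omega> = "\<Pi>\<^sub>E i\<in>{..<d}. space cell"
  let ?G = "prod_algebra {..<d} (\<lambda>_. cell)"
  have sets: "sets (torus d) = sigma_sets ?\<Omega> ?G" unfolding torus_eq by (rule sets_PiM)
  have "A \<in> sigma_sets ?\<Omega> ?G" using assms sets by simp
  from Int_stable_prod_algebra prod_algebra_sets_into_space this show ?thesis
  proof (induction rule: sigma_sets_induct_disjoint)
    case (basic A)
    then obtain B where "A = (\<Pi>\<^sub>E i\<in>{..<d}. B i)" "\<And>i. i < d \<Longrightarrow> B i \<in> sets cell"
      by (auto simp: prod_algebra_eq_finite)
    then show ?case using trig_closure_rectangle by simp
  next
    case empty
    then show ?case using trig_subset_closure[OF trig_const[of 0]] by (simp add: indicator_def)
  next
    case (compl A)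
    have "(\<lambda>x. 1 + (- 1) * indicator A x :: complex) \<in> trig_closure d"
      by (intro trig_closure_add trig_closure_scale compl trig_subset_closure trig_const)
    then show ?case
      by (rule trig_closure_cong) (auto simp: torus_eq space_PiM indicator_def)
  next
    case (union A)
    have A: "A i \<in> sets (torus d)" for i using union(2) sets by auto
    show ?case
    proof (rule trig_closure_limit)
      show "(indicator (\<Union>i. A i) :: _ \<Rightarrow> complex) \<in> borel_measurable (torus d)"
        using A by (intro borel_measurable_indicator) auto
      fix \<epsilon> :: real assume \<epsilon>: "0 < \<epsilon>"
      define R where "R n = (\<Union>i. A i) - (\<Union>i<n. A i)" for n :: nat
      have "(\<lambda>n. emeasure (torus d) (R n)) \<longlonglongrightarrow> emeasure (torus d) (\<Inter>n. R n)"
      proof (rule Lim_emeasure_decseq)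
        show "range R \<subseteq> sets (torus d)" using A by (auto simp: R_def)
        show "decseq R" by (auto simp: decseq_def R_def)
        show "emeasure (torus d) (R i) \<noteq> \<infinity>" for i using torus.emeasure_finite by simp
      qed
      moreover have "(\<Inter>n. R n) = {}" by (auto simp: R_def)
      ultimately have "(\<lambda>n. emeasure (torus d) (R n)) \<longlonglongrightarrow> 0" by simp
      then have "eventually (\<lambda>n. emeasure (torus d) (R n) < ennreal \<epsilon>) sequentially"
        using \<epsilon> by (intro order_tendstoD) auto
      then obtain n where n: "emeasure (torus d) (R n) < ennreal \<epsilon>"
        by (auto simp: eventually_sequentially)
      have "(\<lambda>x. \<Sum>i<n. indicator (A i) x :: complex) \<in> trig_closure d"
        using union by (intro trig_closure_sum) auto
      moreover have "(\<lambda>x. \<Sum>i<n. indicator (A i) x :: complex) = indicator (\<Union>i<n. A i)"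
      proof
        fix x
        show "(\<Sum>i<n. indicator (A i) x :: complex) = indicator (\<Union>i<n. A i) x"
          using union(1) by (intro indicator_UN_disjoint[symmetric]) (auto simp: disjoint_family_on_def)
      qed
      moreover have "sq_err d (indicator (\<Union>i. A i)) (indicator (\<Union>i<n. A i)) \<le> ennreal \<epsilon>"
        using n A by (subst sq_err_indicator) (auto simp: R_def less_imp_le)
      ultimately show "\<exists>f\<in>trig_closure d. sq_err d (indicator (\<Union>i. A i)) f \<le> ennreal \<epsilon>" by force
    qed
  qed
qed

lemma trig_closure_L2:
  assumes f: "f \<in> L2 d"
  shows "(\<lambda>x. complex_of_real (f x)) \<in> trig_closure d"
proof -
  have fm [measurable]: "f \<in> borel_measurable (torus d)" and fi: "integrable (torus d) (\<lambda>x. (f x)\<^sup>2)"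
    using f by (auto simp: L2_def)
  obtain F where F: "\<And>i. simple_function (torus d) (F i)" "\<And>x. x \<in> space (torus d) \<Longrightarrow> (\<lambda>i. F i x) \<longlonglongrightarrow> f x"
    "\<And>i x. x \<in> space (torus d) \<Longrightarrow> \<bar>F i x\<bar> \<le> 2 * \<bar>f x\<bar>"
    using borel_measurable_implies_sequence_metric[OF fm, of 0] by (simp add: dist_real_def) metis
  have Fm [measurable]: "F i \<in> borel_measurable (torus d)" for i
    using F(1) by (rule borel_measurable_simple_function)
  have simple: "(\<lambda>x. complex_of_real (F i x)) \<in> trig_closure d" for i
  proof (rule trig_closure_cong)
    let ?S = "space (torus d)"
    show "(\<lambda>x. \<Sum>y\<in>F i ` ?S. of_real y * indicator (F i -` {y} \<inter> ?S) x) \<in> trig_closure d"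
      using simple_functionD(2)[OF F(1)] by (intro trig_closure_sum trig_closure_scale trig_closure_indicator)
    fix x assume x: "x \<in> ?S"
    have "(\<Sum>y\<in>F i ` ?S. of_real y * indicator (F i -` {y} \<inter> ?S) x) = (\<Sum>y\<in>F i ` ?S. if y = F i x then complex_of_real y else 0)"
      using x by (intro sum.cong) (auto simp: indicator_def)
    also have "\<dots> = complex_of_real (F i x)"
      using x simple_functionD(1)[OF F(1)] by (subst sum.delta) auto
    finally show "(\<Sum>y\<in>F i ` ?S. of_real y * indicator (F i -` {y} \<inter> ?S) x) = complex_of_real (F i x)" .
  qed
  have "(\<lambda>i. \<integral>\<^sup>+x. ennreal ((f x - F i x)\<^sup>2) \<partial>torus d) \<longlonglongrightarrow> (\<integral>\<^sup>+x. 0 \<partial>torus d)"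
  proof (rule nn_integral_dominated_convergence[where w = "\<lambda>x. ennreal (9 * (f x)\<^sup>2)"])
    show "AE x in torus d. ennreal ((f x - F i x)\<^sup>2) \<le> ennreal (9 * (f x)\<^sup>2)" for i
    proof (rule AE_I2, rule ennreal_leI)
      fix x assume "x \<in> space (torus d)"
      then have "\<bar>f x - F i x\<bar> \<le> 3 * \<bar>f x\<bar>" using F(3)[of x i] by linarith
      then have "\<bar>f x - F i x\<bar>\<^sup>2 \<le> (3 * \<bar>f x\<bar>)\<^sup>2" by (intro power_mono) auto
      then show "(f x - F i x)\<^sup>2 \<le> 9 * (f x)\<^sup>2" by (simp add: power_mult_distrib)
    qed
    show "(\<integral>\<^sup>+x. ennreal (9 * (f x)\<^sup>2) \<partial>torus d) < \<infinity>"
      using fi by (subst nn_integral_eq_integral) auto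
    show "AE x in torus d. (\<lambda>i. ennreal ((f x - F i x)\<^sup>2)) \<longlonglongrightarrow> 0"
    proof (rule AE_I2)
      fix x assume "x \<in> space (torus d)"
      then have "(\<lambda>i. (f x - F i x)\<^sup>2) \<longlonglongrightarrow> (f x - f x)\<^sup>2" by (intro tendsto_intros F)
      from tendsto_ennrealI[OF this] show "(\<lambda>i. ennreal ((f x - F i x)\<^sup>2)) \<longlonglongrightarrow> 0" by simp
    qed
  qed measurable
  then have lim: "(\<lambda>i. sq_err d (\<lambda>x. complex_of_real (f x)) (\<lambda>x. complex_of_real (F i x))) \<longlonglongrightarrow> 0"
    by (simp add: sq_err_def flip: of_real_diff)
  show ?thesis
  proof (rule trig_closure_limit)
    show "(\<lambda>x. complex_of_real (f x)) \<in> borel_measurable (torus d)" by measurable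
    fix \<epsilon> :: real assume "0 < \<epsilon>"
    then have "eventually (\<lambda>i. sq_err d (\<lambda>x. complex_of_real (f x)) (\<lambda>x. complex_of_real (F i x)) < ennreal \<epsilon>) sequentially"
      using lim by (intro order_tendstoD) auto
    then show "\<exists>g\<in>trig_closure d. sq_err d (\<lambda>x. complex_of_real (f x)) g \<le> ennreal \<epsilon>"
      using simple by (auto simp: eventually_sequentially intro!: less_imp_le)
  qed
qed

text \<open>Unnormalised and real: cosine and sine coefficients solve the same real system and enter
  \<open>alternating_flow\<close> separately, while the complex coefficient serves Parseval's
  identity.\<close>

definition fourier_cos :: "nat \<Rightarrow> ((nat \<Rightarrow> real) \<Rightarrow> real) \<Rightarrow> (nat \<Rightarrow> int) \<Rightarrow> real" where
  "fourier_cos d f m = (\<integral>x. f x * cos (phase d m x) \<partial>torus d)"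

definition fourier_sin :: "nat \<Rightarrow> ((nat \<Rightarrow> real) \<Rightarrow> real) \<Rightarrow> (nat \<Rightarrow> int) \<Rightarrow> real" where
  "fourier_sin d f m = (\<integral>x. f x * sin (phase d m x) \<partial>torus d)"

definition fourier :: "nat \<Rightarrow> ((nat \<Rightarrow> real) \<Rightarrow> real) \<Rightarrow> (nat \<Rightarrow> int) \<Rightarrow> complex" where
  "fourier d f m = (\<integral>x. of_real (f x) * cnj (character d m x) \<partial>torus d)"

lemma L2_measurable: "f \<in> L2 d \<Longrightarrow> f \<in> borel_measurable (torus d)"
  and L2_square_integrable: "f \<in> L2 d \<Longrightarrow> integrable (torus d) (\<lambda>x. (f x)\<^sup>2)"
  by (simp_all add: L2_def)

lemma L2_integrable:
  assumes "f \<in> L2 d"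
  shows "integrable (torus d) f"
proof (rule Bochner_Integration.integrable_bound)
  show "integrable (torus d) (\<lambda>x. 1 + (f x)\<^sup>2)"
    using L2_square_integrable[OF assms] by simp
  show "AE x in torus d. norm (f x) \<le> norm (1 + (f x)\<^sup>2)"
  proof (rule AE_I2)
    fix x
    have "0 \<le> (\<bar>f x\<bar> - 1)\<^sup>2" by simp
    then have "2 * \<bar>f x\<bar> \<le> 1 + (f x)\<^sup>2" by (simp add: power2_diff)
    then show "norm (f x) \<le> norm (1 + (f x)\<^sup>2)" by simp
  qed
qed (rule L2_measurable[OF assms])

lemma L2_mult_bounded_integrable:
  fixes g :: "(nat \<Rightarrow> real) \<Rightarrow> 'a::{real_normed_field, second_countable_topology, banach}"
  assumes f: "f \<in> L2 d" and g [measurable]: "g \<in> borel_measurable (torus d)" and C: "\<And>x. norm (g x) \<le> C"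
  shows "integrable (torus d) (\<lambda>x. of_real (f x) * g x)"
proof (rule Bochner_Integration.integrable_bound)
  note [measurable] = L2_measurable[OF f]
  show "integrable (torus d) (\<lambda>x. C * f x)" using L2_integrable[OF f] by simp
  show "(\<lambda>x. of_real (f x) * g x) \<in> borel_measurable (torus d)" by measurable
  show "AE x in torus d. norm (of_real (f x) * g x) \<le> norm (C * f x)"
  proof (rule AE_I2)
    fix x
    have "norm (g x) * \<bar>f x\<bar> \<le> \<bar>C\<bar> * \<bar>f x\<bar>" using C[of x] by (intro mult_right_mono) auto
    then show "norm (of_real (f x) * g x) \<le> norm (C * f x)" by (simp add: norm_mult abs_mult mult.commute)
  qed
qed

lemma L2_mult_cos_integrable: "f \<in> L2 d \<Longrightarrow> integrable (torus d) (\<lambda>x. f x * cos (phase d m x))"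
  and L2_mult_sin_integrable: "f \<in> L2 d \<Longrightarrow> integrable (torus d) (\<lambda>x. f x * sin (phase d m x))"
  using L2_mult_bounded_integrable[of f d "\<lambda>x. cos (phase d m x)" 1]
    L2_mult_bounded_integrable[of f d "\<lambda>x. sin (phase d m x)" 1] by auto

lemma borel_measurable_cnj [measurable]: "cnj \<in> borel_measurable borel"
  by (intro borel_measurable_continuous_onI continuous_intros)

lemma borel_measurable_cnj_character [measurable, simp]: "(\<lambda>x. cnj (character d m x)) \<in> borel_measurable (torus d)"
  by (rule measurable_compose[OF borel_measurable_character borel_measurable_cnj])

lemma fourier_eq:
  assumes f: "f \<in> L2 d"
  shows "fourier d f m = Complex (fourier_cos d f m) (- fourier_sin d f m)"
proof -
  have int: "integrable (torus d) (\<lambda>x. of_real (f x) * cnj (character d m x))"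
    by (rule L2_mult_bounded_integrable[OF f, of _ 1]) simp_all
  have "Re (fourier d f m) = fourier_cos d f m" "Im (fourier d f m) = - fourier_sin d f m"
    unfolding fourier_def fourier_cos_def fourier_sin_def
    using integral_Re[OF int] integral_Im[OF int] by (simp_all add: character_def)
  then show ?thesis by (simp add: complex_eq_iff)
qed

lemma cmod_fourier: "f \<in> L2 d \<Longrightarrow> (cmod (fourier d f m))\<^sup>2 = (fourier_cos d f m)\<^sup>2 + (fourier_sin d f m)\<^sup>2"
  by (simp add: fourier_eq cmod_power2)

section \<open>Bessel's inequality and Parseval's identity\<close>

lemma trig_representation:
  assumes "P \<in> trig d"
  shows "\<exists>F p. finite F \<and> F \<subseteq> modes d \<and> P = (\<lambda>x. \<Sum>m\<in>F. p m * character d m x)"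
  using assms
proof induction
  case (base m c)
  then show ?case by (intro exI[of _ "{m}"] exI[of _ "\<lambda>_. c"]) auto
next
  case (add f g)
  then obtain F p G q where F: "finite F" "F \<subseteq> modes d" "f = (\<lambda>x. \<Sum>m\<in>F. p m * character d m x)"
    and G: "finite G" "G \<subseteq> modes d" "g = (\<lambda>x. \<Sum>m\<in>G. q m * character d m x)" by blast
  have restrict: "(\<Sum>m\<in>H. r m * character d m x) = (\<Sum>m\<in>F \<union> G. (if m \<in> H then r m else 0) * character d m x)"
    if "H \<subseteq> F \<union> G" for H r x
    using that F(1) G(1) by (intro sum.mono_neutral_cong_left) auto
  have "f x + g x = (\<Sum>m\<in>F \<union> G. ((if m \<in> F then p m else 0) + (if m \<in> G then q m else 0)) * character d m x)" for x
    unfolding F(3) G(3) using restrict[of F p x] restrict[of G q x] by (simp add: distrib_right sum.distrib)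
  then show ?case
    using F G by (intro exI[of _ "F \<union> G"] exI[of _ "\<lambda>m. (if m \<in> F then p m else 0) + (if m \<in> G then q m else 0)"]) auto
qed

lemma integral_square_distance:
  fixes p :: "(nat \<Rightarrow> int) \<Rightarrow> complex"
  assumes f: "f \<in> L2 d" and F: "finite F" "F \<subseteq> modes d"
  defines "P \<equiv> (\<lambda>x. \<Sum>m\<in>F. p m * character d m x)"
  shows "integrable (torus d) (\<lambda>x. (cmod (of_real (f x) - P x))\<^sup>2)"
    and "(\<integral>x. (cmod (of_real (f x) - P x))\<^sup>2 \<partial>torus d) =
      (\<integral>x. (f x)\<^sup>2 \<partial>torus d) + (\<Sum>m\<in>F. (2 * pi) ^ d * (cmod (p m))\<^sup>2 - 2 * Re (p m * cnj (fourier d f m)))"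
proof -
  have Pm [measurable]: "P \<in> borel_measurable (torus d)" unfolding P_def by measurable
  have P_bound: "cmod (P x) \<le> (\<Sum>m\<in>F. cmod (p m))" for x
    unfolding P_def by (rule order_trans[OF norm_sum]) (simp add: norm_mult)
  have expand: "(cmod (of_real (f x) - P x))\<^sup>2 = (f x)\<^sup>2 - 2 * Re (of_real (f x) * P x) + Re (P x * cnj (P x))" for x
    by (simp only: cmod_power2) (simp add: power2_eq_square algebra_simps)
  have int1: "integrable (torus d) (\<lambda>x. of_real (f x) * P x)"
    by (rule L2_mult_bounded_integrable[OF f Pm P_bound])
  have int2: "integrable (torus d) (\<lambda>x. P x * cnj (P x))"
  proof (rule torus.integrable_const_bound[of _ "(\<Sum>m\<in>F. cmod (p m))\<^sup>2"])
    show "AE x in torus d. norm (P x * cnj (P x)) \<le> (\<Sum>m\<in>F. cmod (p m))\<^sup>2"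
      using P_bound by (intro AE_I2) (simp add: norm_mult power_mono flip: power2_eq_square)
  qed measurable
  show "integrable (torus d) (\<lambda>x. (cmod (of_real (f x) - P x))\<^sup>2)"
    unfolding expand using L2_square_integrable[OF f] int1 int2
    by (intro Bochner_Integration.integrable_add Bochner_Integration.integrable_diff integrable_mult_right integrable_Re)
  have char_int: "integrable (torus d) (\<lambda>x. of_real (f x) * character d m x)" for m
    by (rule L2_mult_bounded_integrable[OF f, of _ 1]) auto
  have "(\<integral>x. of_real (f x) * P x \<partial>torus d) = (\<Sum>m\<in>F. p m * (\<integral>x. of_real (f x) * character d m x \<partial>torus d))"
  proof -
    have "(\<lambda>x. of_real (f x) * P x) = (\<lambda>x. \<Sum>m\<in>F. p m * (of_real (f x) * character d m x))"
      by (simp add: P_def sum_distrib_left mult_ac)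
    then show ?thesis using char_int by (simp add: Bochner_Integration.integral_sum)
  qed
  also have "\<dots> = (\<Sum>m\<in>F. p m * cnj (fourier d f m))"
  proof (intro sum.cong refl arg_cong2[where f = "(*)"])
    fix m
    have "cnj (fourier d f m) = (\<integral>x. cnj (of_real (f x) * cnj (character d m x)) \<partial>torus d)"
      unfolding fourier_def by (subst Bochner_Integration.integral_cnj) (rule refl)
    then show "(\<integral>x. of_real (f x) * character d m x \<partial>torus d) = cnj (fourier d f m)" by simp
  qed
  finally have I1: "(\<integral>x. of_real (f x) * P x \<partial>torus d) = (\<Sum>m\<in>F. p m * cnj (fourier d f m))" .
  have cc_int: "integrable (torus d) (\<lambda>x. character d m x * cnj (character d m' x))" for m m'
    by (rule torus.integrable_const_bound[of _ 1]) (auto simp: norm_mult)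
  have "(\<integral>x. P x * cnj (P x) \<partial>torus d) = (\<Sum>m\<in>F. \<Sum>m'\<in>F. p m * cnj (p m') * (\<integral>x. character d m x * cnj (character d m' x) \<partial>torus d))"
  proof -
    have "(\<lambda>x. P x * cnj (P x)) = (\<lambda>x. \<Sum>m\<in>F. \<Sum>m'\<in>F. p m * cnj (p m') * (character d m x * cnj (character d m' x)))"
      by (simp add: P_def sum_product mult_ac)
    then show ?thesis using cc_int by (simp add: Bochner_Integration.integral_sum)
  qed
  also have "\<dots> = (\<Sum>m\<in>F. \<Sum>m'\<in>F. if m' = m then p m * cnj (p m) * of_real ((2 * pi) ^ d) else 0)"
    using F(2) by (intro sum.cong refl) (auto simp: integral_character_cnj subset_iff)
  also have "\<dots> = (\<Sum>m\<in>F. of_real ((2 * pi) ^ d * (cmod (p m))\<^sup>2))"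
    using F(1) by (intro sum.cong) (auto simp: complex_norm_square mult.commute simp del: of_real_power)
  finally have I2: "Re (\<integral>x. P x * cnj (P x) \<partial>torus d) = (\<Sum>m\<in>F. (2 * pi) ^ d * (cmod (p m))\<^sup>2)"
    by (simp flip: of_real_sum)
  have "(\<integral>x. (cmod (of_real (f x) - P x))\<^sup>2 \<partial>torus d) =
      (\<integral>x. (f x)\<^sup>2 \<partial>torus d) - 2 * (\<integral>x. Re (of_real (f x) * P x) \<partial>torus d) + (\<integral>x. Re (P x * cnj (P x)) \<partial>torus d)"
    unfolding expand using L2_square_integrable[OF f] integrable_Re[OF int1] integrable_Re[OF int2]
    by (subst Bochner_Integration.integral_add; (subst Bochner_Integration.integral_diff)?) auto
  also have "\<dots> = (\<integral>x. (f x)\<^sup>2 \<partial>torus d) - 2 * Re (\<Sum>m\<in>F. p m * cnj (fourier d f m)) + (\<Sum>m\<in>F. (2 * pi) ^ d * (cmod (p m))\<^sup>2)"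
    by (simp only: integral_Re[OF int1] integral_Re[OF int2] I1 I2)
  also have "\<dots> = (\<integral>x. (f x)\<^sup>2 \<partial>torus d) + (\<Sum>m\<in>F. (2 * pi) ^ d * (cmod (p m))\<^sup>2 - 2 * Re (p m * cnj (fourier d f m)))"
    by (simp add: sum_subtractf sum_distrib_left Re_sum)
  finally show "(\<integral>x. (cmod (of_real (f x) - P x))\<^sup>2 \<partial>torus d) =
      (\<integral>x. (f x)\<^sup>2 \<partial>torus d) + (\<Sum>m\<in>F. (2 * pi) ^ d * (cmod (p m))\<^sup>2 - 2 * Re (p m * cnj (fourier d f m)))" .
qed

text \<open>For p = c / V the first square vanishes and nonnegativity of the distance is Bessel's
  inequality; for the approximants given by density this square is nonnegative and yields the
  converse.\<close>

lemma complete_square: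
  assumes "0 < (V :: real)"
  shows "V * (V * (cmod p)\<^sup>2 - 2 * Re (p * cnj c)) = (cmod (of_real V * p - c))\<^sup>2 - (cmod c)\<^sup>2"
  by (simp only: cmod_power2) (simp add: power2_eq_square algebra_simps)

theorem parseval:
  assumes f: "f \<in> L2 d"
  shows "((\<lambda>m. (fourier_cos d f m)\<^sup>2 + (fourier_sin d f m)\<^sup>2) has_sum ((2 * pi) ^ d * (\<integral>x. (f x)\<^sup>2 \<partial>torus d))) (modes d)"
proof -
  define V :: real where "V = (2 * pi) ^ d"
  have V: "0 < V" by (simp add: V_def)
  define c where "c = fourier d f"
  let ?N = "\<integral>x. (f x)\<^sup>2 \<partial>torus d"
  have dist: "V * (\<integral>x. (cmod (of_real (f x) - (\<Sum>m\<in>F. p m * character d m x)))\<^sup>2 \<partial>torus d) =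
      V * ?N + (\<Sum>m\<in>F. (cmod (of_real V * p m - c m))\<^sup>2) - (\<Sum>m\<in>F. (cmod (c m))\<^sup>2)"
    if "finite F" "F \<subseteq> modes d" for F p
    unfolding integral_square_distance(2)[OF f that] V_def[symmetric] c_def[symmetric]
    unfolding distrib_left sum_distrib_left complete_square[OF V] by (simp add: sum_subtractf)
  have bessel: "(\<Sum>m\<in>F. (cmod (c m))\<^sup>2) \<le> V * ?N" if "finite F" "F \<subseteq> modes d" for F
  proof -
    have "0 \<le> V * (\<integral>x. (cmod (of_real (f x) - (\<Sum>m\<in>F. c m / of_real V * character d m x)))\<^sup>2 \<partial>torus d)"
      using V by (intro mult_nonneg_nonneg integral_nonneg) auto
    then show ?thesis using V unfolding dist[OF that] by simp
  qed
  have summable: "(\<lambda>m. (cmod (c m))\<^sup>2) summable_on modes d"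
    using bessel by (intro nonneg_bdd_above_summable_on bdd_aboveI[where M = "V * ?N"]) auto
  have "V * ?N \<le> (\<Sum>\<^sub>\<infinity>m\<in>modes d. (cmod (c m))\<^sup>2) + \<epsilon>" if \<epsilon>: "0 < \<epsilon>" for \<epsilon>
  proof -
    obtain P where P: "P \<in> trig d" "sq_err d (\<lambda>x. complex_of_real (f x)) P \<le> ennreal (\<epsilon> / V)"
      using trig_closureD[OF trig_closure_L2[OF f], of "\<epsilon> / V"] \<epsilon> V by auto
    obtain F p where F: "finite F" "F \<subseteq> modes d" "P = (\<lambda>x. \<Sum>m\<in>F. p m * character d m x)"
      using trig_representation[OF P(1)] by blast
    have "sq_err d (\<lambda>x. complex_of_real (f x)) P = ennreal (\<integral>x. (cmod (of_real (f x) - P x))\<^sup>2 \<partial>torus d)"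
      unfolding sq_err_def F(3) by (intro nn_integral_eq_integral integral_square_distance f F) auto
    then have "(\<integral>x. (cmod (of_real (f x) - P x))\<^sup>2 \<partial>torus d) \<le> \<epsilon> / V"
      using P(2) \<epsilon> V by (simp add: ennreal_le_iff)
    then have "V * (\<integral>x. (cmod (of_real (f x) - P x))\<^sup>2 \<partial>torus d) \<le> \<epsilon>"
      using V by (simp add: field_simps)
    moreover have "0 \<le> (\<Sum>m\<in>F. (cmod (of_real V * p m - c m))\<^sup>2)" by (intro sum_nonneg) auto
    moreover have "(\<Sum>m\<in>F. (cmod (c m))\<^sup>2) \<le> (\<Sum>\<^sub>\<infinity>m\<in>modes d. (cmod (c m))\<^sup>2)"
      using F by (intro finite_sum_le_infsum summable) auto
    ultimately show ?thesis using dist[OF F(1,2), of p] unfolding F(3) by linarith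
  qed
  then have "V * ?N \<le> (\<Sum>\<^sub>\<infinity>m\<in>modes d. (cmod (c m))\<^sup>2)"
    by (rule field_le_epsilon)
  moreover have "(\<Sum>\<^sub>\<infinity>m\<in>modes d. (cmod (c m))\<^sup>2) \<le> V * ?N"
    by (intro infsum_le_finite_sums summable bessel)
  ultimately have "((\<lambda>m. (cmod (c m))\<^sup>2) has_sum (V * ?N)) (modes d)"
    using has_sum_infsum[OF summable] by simp
  then show ?thesis by (simp add: c_def cmod_fourier[OF f] V_def)
qed

text \<open>The zero mode carries the square of the integral, which is exactly what subtraction of
  the mean takes from the squared norm after scaling by the volume.\<close>

lemma parseval_mean_zero:
  assumes f: "f \<in> L2 d"
  shows "((\<lambda>m. (fourier_cos d f m)\<^sup>2 + (fourier_sin d f m)\<^sup>2) has_sum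
    ((2 * pi) ^ d * (L2_norm d (\<lambda>x. f x - torus_mean d f))\<^sup>2)) (modes d - {0})"
proof -
  define V :: real where "V = (2 * pi) ^ d"
  have V: "0 < V" by (simp add: V_def)
  define I where "I = (\<integral>x. f x \<partial>torus d)"
  have zero: "(fourier_cos d f 0)\<^sup>2 + (fourier_sin d f 0)\<^sup>2 = I\<^sup>2"
    by (simp add: fourier_cos_def fourier_sin_def phase_def I_def)
  have mean: "torus_mean d f = I / V" by (simp add: torus_mean_def I_def V_def)
  have "(L2_norm d (\<lambda>x. f x - torus_mean d f))\<^sup>2 = (\<integral>x. (f x - I / V)\<^sup>2 \<partial>torus d)"
    unfolding L2_norm_def mean by (simp add: integral_nonneg)
  also have "\<dots> = (\<integral>x. (f x)\<^sup>2 + (I / V)\<^sup>2 - 2 * (I / V) * f x \<partial>torus d)"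
    by (simp add: power2_diff mult_ac)
  also have "\<dots> = (\<integral>x. (f x)\<^sup>2 \<partial>torus d) + V * (I / V)\<^sup>2 - 2 * (I / V) * I"
    using L2_square_integrable[OF f] L2_integrable[OF f]
    by (simp add: measure_torus V_def I_def)
  finally have norm: "(L2_norm d (\<lambda>x. f x - torus_mean d f))\<^sup>2 =
      (\<integral>x. (f x)\<^sup>2 \<partial>torus d) + V * (I / V)\<^sup>2 - 2 * (I / V) * I" .
  have VI: "V * (I / V) = I" using V by simp
  have complete: "V * (N + V * (I / V)\<^sup>2 - 2 * (I / V) * I) = V * N - I\<^sup>2" for N
  proof -
    have "V * (N + V * (I / V)\<^sup>2 - 2 * (I / V) * I) = V * N + (V * (I / V))\<^sup>2 - 2 * (V * (I / V)) * I"
      by (simp only: algebra_simps power2_eq_square)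
    then show ?thesis unfolding VI by (simp add: power2_eq_square)
  qed
  have "V * (L2_norm d (\<lambda>x. f x - torus_mean d f))\<^sup>2 = V * (\<integral>x. (f x)\<^sup>2 \<partial>torus d) - I\<^sup>2"
    unfolding norm complete ..
  moreover have "((\<lambda>m. (fourier_cos d f m)\<^sup>2 + (fourier_sin d f m)\<^sup>2) has_sum (V * (\<integral>x. (f x)\<^sup>2 \<partial>torus d) - I\<^sup>2)) (modes d - {0})"
    using has_sum_Diff[OF parseval[OF f] has_sum_finite[of "{0}"]] zero by (simp add: V_def modes_def)
  ultimately show ?thesis by (simp add: V_def)
qed

section \<open>Weak solutions\<close>

definition wave :: "nat \<Rightarrow> (nat \<Rightarrow> int) \<Rightarrow> real \<Rightarrow> real \<Rightarrow> (nat \<Rightarrow> real) \<Rightarrow> real" where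
  "wave d m A B x = A * cos (phase d m x) + B * sin (phase d m x)"

lemma phase_upd:
  assumes "j < d"
  shows "phase d m (x(j := h)) = phase d m x + of_int (m j) * (h - x j)"
proof -
  have "phase d m y = of_int (m j) * y j + (\<Sum>i\<in>{..<d} - {j}. of_int (m i) * y i)" for y
    unfolding phase_def using assms by (intro sum.remove) auto
  from this[of x] this[of "x(j := h)"] show ?thesis by (simp add: algebra_simps)
qed

lemma wave_has_derivative:
  assumes "j < d"
  shows "((\<lambda>h. wave d m A B (x(j := h))) has_real_derivative wave d m (of_int (m j) * B) (- of_int (m j) * A) x) (at (x j))"
  unfolding wave_def phase_upd[OF assms] by (auto intro!: derivative_eq_intros simp: algebra_simps)

lemma partial_wave:
  assumes "j < d"
  shows "partial j (wave d m A B) = wave d m (of_int (m j) * B) (- of_int (m j) * A)"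
  unfolding partial_def by (rule ext) (rule DERIV_imp_deriv[OF wave_has_derivative[OF assms]])

text \<open>A partial derivative changes only the two amplitudes, so continuity and
  differentiability of a general wave settle all orders at once.\<close>

lemma foldr_partial_wave:
  "set js \<subseteq> {..<d} \<Longrightarrow> \<exists>A' B'. foldr partial js (wave d m A B) = wave d m A' B'"
proof (induction js)
  case (Cons j js)
  then obtain A' B' where "foldr partial js (wave d m A B) = wave d m A' B'" by auto
  then show ?case using Cons.prems partial_wave[of j d m A' B'] by auto
qed auto

lemma continuous_on_wave: "continuous_on S (wave d m A B)"
  unfolding wave_def phase_def
  by (intro continuous_intros continuous_on_subset[OF continuous_on_product_coordinates subset_UNIV])

lemma smooth_periodic_wave: "smooth_periodic d (wave d m A B)"
  unfolding smooth_periodic_def smooth_on_RR_def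
proof (intro conjI allI impI ballI)
  fix js :: "nat list" assume js: "set js \<subseteq> {..<d}"
  then obtain A' B' where eq: "foldr partial js (wave d m A B) = wave d m A' B'"
    using foldr_partial_wave by blast
  show "continuous_on (RR d) (foldr partial js (wave d m A B))"
    unfolding eq by (rule continuous_on_wave)
  fix x j assume "j < d"
  then show "(\<lambda>h. foldr partial js (wave d m A B) (x(j := h))) differentiable at (x j)"
    unfolding eq using wave_has_derivative real_differentiable_def by blast
next
  fix x j assume j: "j < d"
  have "phase d m (x(j := x j + 2 * pi)) = phase d m x + 2 * pi * of_int (m j)"
    unfolding phase_upd[OF j] by simp
  moreover have "cos (y + 2 * pi * of_int k) = cos y" "sin (y + 2 * pi * of_int k) = sin y" for y and k :: int
    using sin_int_2pin[of k] cos_int_2pin[of k] by (simp_all add: cos_add sin_add)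
  ultimately show "wave d m A B (x(j := x j + 2 * pi)) = wave d m A B x"
    by (simp add: wave_def)
qed

lemma laplacian_wave: "laplacian d (wave d m A B) x = - mode_square d m * wave d m A B x"
proof -
  have "laplacian d (wave d m A B) x = (\<Sum>j<d. - (of_int (m j))\<^sup>2 * wave d m A B x)"
    unfolding laplacian_def
    by (intro sum.cong) (auto simp: partial_wave wave_def power2_eq_square algebra_simps)
  then show ?thesis by (simp add: mode_square_def sum_distrib_right sum_negf)
qed

lemma phase_unit_mode: "j < d \<Longrightarrow> phase d (unit_mode j q) x = of_int q * x j"
proof -
  assume j: "j < d"
  have "phase d (unit_mode j q) x = (\<Sum>i<d. if i = j then of_int q * x i else 0)"
    unfolding phase_def unit_mode_def by (intro sum.cong) auto
  then show ?thesis using j by simp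
qed

text \<open>Differentiation takes the amplitudes (A, B) to a multiple of (B, -A), and multiplication
  by the sine turns them back. The neighbouring waves appear with the original A and B, which is why
  cosine and sine coefficients do not mix.\<close>

lemma sin_times_wave:
  assumes "j < d"
  shows "sin (x j) * wave d m B (- A) x =
    - 1 / 2 * (wave d (m - unit_mode j 1) A B x - wave d (m + unit_mode j 1) A B x)"
  using assms
  by (simp add: wave_def phase_diff phase_add phase_unit_mode cos_add cos_diff sin_add sin_diff algebra_simps)

lemma u1_eq: "u1 n x i = (if i < n then sin (x (n + i)) else 0)"
proof -
  have "u1 n x i = (\<Sum>j<n. if j = i then sin (x (n + j)) else 0)"
    unfolding u1_def basis_vec_def by (intro sum.cong) auto
  then show ?thesis by simp
qed

lemma u2_eq: "u2 n x i = (if n \<le> i \<and> i < 2 * n then sin (x (i - n)) else 0)"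
proof (cases "n \<le> i")
  case True
  have "u2 n x i = (\<Sum>j<n. if j = i - n then sin (x j) else 0)"
    unfolding u2_def basis_vec_def using True by (intro sum.cong) auto
  then show ?thesis using True by auto
qed (auto simp: u2_def basis_vec_def)

lemma velocity_low: "i < n \<Longrightarrow> velocity n \<Phi>1 \<Phi>2 t x i = \<Phi>1 t * sin (x (n + i))"
  and velocity_high: "i < n \<Longrightarrow> velocity n \<Phi>1 \<Phi>2 t x (n + i) = \<Phi>2 t * sin (x i)"
  by (simp_all add: velocity_def u1_eq u2_eq)

text \<open>Component j of the velocity is constant in the variable x j, so the divergence form of
  the test term produces no derivative of the velocity.\<close>

lemma partial_cmult_wave:
  assumes j: "j < d" and c: "\<And>h. c (x(j := h)) = c x"
  shows "partial j (\<lambda>y. c y * wave d m A B y) x = c x * wave d m (of_int (m j) * B) (- of_int (m j) * A) x"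
  unfolding partial_def c
  by (rule DERIV_imp_deriv) (auto intro!: derivative_eq_intros wave_has_derivative[OF j])

text \<open>The test-function side of the equation, written so that integration against \<eta>
  reproduces the right-hand side in \<open>alternating_flow\<close>.\<close>

definition generator_wave :: "nat \<Rightarrow> real \<Rightarrow> real \<Rightarrow> real \<Rightarrow> (nat \<Rightarrow> int) \<Rightarrow> real \<Rightarrow> real \<Rightarrow> (nat \<Rightarrow> real) \<Rightarrow> real" where
  "generator_wave n \<nu> p1 p2 m A B x =
     - \<nu> * mode_square (2 * n) m * wave (2 * n) m A B x
     - p1 / 2 * (\<Sum>i<n. of_int (m i) * (wave (2 * n) (m - unit_mode (n + i) 1) A B x - wave (2 * n) (m + unit_mode (n + i) 1) A B x))
     - p2 / 2 * (\<Sum>i<n. of_int (m (n + i)) * (wave (2 * n) (m - unit_mode i 1) A B x - wave (2 * n) (m + unit_mode i 1) A B x))"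

lemma adjoint_generator_wave:
  "(\<Sum>j<2 * n. partial j (\<lambda>y. velocity n \<Phi>1 \<Phi>2 t y j * wave (2 * n) m A B y) x) + \<nu> * laplacian (2 * n) (wave (2 * n) m A B) x
    = generator_wave n \<nu> (\<Phi>1 t) (\<Phi>2 t) m A B x"
proof -
  let ?w = "\<lambda>m. wave (2 * n) m A B x"
  have scale: "wave d m (c * B) (- c * A) x = c * wave d m B (- A) x" for d m c
    by (simp add: wave_def algebra_simps)
  have low: "partial i (\<lambda>y. velocity n \<Phi>1 \<Phi>2 t y i * wave (2 * n) m A B y) x =
      - \<Phi>1 t / 2 * (of_int (m i) * (?w (m - unit_mode (n + i) 1) - ?w (m + unit_mode (n + i) 1)))" if "i < n" for i
  proof -
    have "partial i (\<lambda>y. velocity n \<Phi>1 \<Phi>2 t y i * wave (2 * n) m A B y) x =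
        \<Phi>1 t * sin (x (n + i)) * wave (2 * n) m (of_int (m i) * B) (- of_int (m i) * A) x"
      using that by (simp only: velocity_low) (rule partial_cmult_wave, auto)
    also have "\<dots> = \<Phi>1 t * of_int (m i) * (sin (x (n + i)) * wave (2 * n) m B (- A) x)"
      unfolding scale by simp
    also have "\<dots> = - \<Phi>1 t / 2 * (of_int (m i) * (?w (m - unit_mode (n + i) 1) - ?w (m + unit_mode (n + i) 1)))"
      using that by (subst sin_times_wave) auto
    finally show ?thesis .
  qed
  have high: "partial (n + i) (\<lambda>y. velocity n \<Phi>1 \<Phi>2 t y (n + i) * wave (2 * n) m A B y) x =
      - \<Phi>2 t / 2 * (of_int (m (n + i)) * (?w (m - unit_mode i 1) - ?w (m + unit_mode i 1)))" if "i < n" for i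
  proof -
    have "partial (n + i) (\<lambda>y. velocity n \<Phi>1 \<Phi>2 t y (n + i) * wave (2 * n) m A B y) x =
        \<Phi>2 t * sin (x i) * wave (2 * n) m (of_int (m (n + i)) * B) (- of_int (m (n + i)) * A) x"
      using that by (simp only: velocity_high) (rule partial_cmult_wave, auto)
    also have "\<dots> = \<Phi>2 t * of_int (m (n + i)) * (sin (x i) * wave (2 * n) m B (- A) x)"
      unfolding scale by simp
    also have "\<dots> = - \<Phi>2 t / 2 * (of_int (m (n + i)) * (?w (m - unit_mode i 1) - ?w (m + unit_mode i 1)))"
      using that by (subst sin_times_wave) auto
    finally show ?thesis .
  qed
  have split: "(\<Sum>j<2 * n. F j) = (\<Sum>i<n. F i) + (\<Sum>i<n. F (n + i))" for F :: "nat \<Rightarrow> real"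
  proof -
    have "{..<2 * n} = {..<n} \<union> (\<lambda>i. n + i) ` {..<n}"
    proof (intro equalityI subsetI)
      fix j assume "j \<in> {..<2 * n}"
      then show "j \<in> {..<n} \<union> (\<lambda>i. n + i) ` {..<n}"
        by (cases "j < n") (auto simp: image_iff intro!: bexI[of _ "j - n"])
    qed auto
    then show ?thesis by (simp add: sum.union_disjoint sum.reindex disjoint_iff image_iff)
  qed
  show ?thesis
    unfolding split laplacian_wave generator_wave_def
    by (simp add: low high sum_distrib_left sum_negf)
qed

text \<open>Taking the root turns the factor 4 into 2 and the rate ln 2 / (6 c) into ln 2 / (12
  c).\<close>

lemma root_decay:
  fixes N N' t \<nu> :: real
  assumes \<nu>: "0 < \<nu>" and N: "0 \<le> N"
    and decay: "N'\<^sup>2 \<le> 4 * exp (- ln 2 * t / (6 * (c / sqrt \<nu>))) * N\<^sup>2"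
  shows "N' \<le> 2 * N * exp (- (ln 2 / (12 * c)) * sqrt \<nu> * t)"
proof (rule power2_le_imp_le)
  have "- ln 2 * t / (6 * (c / sqrt \<nu>)) = 2 * (- (ln 2 / (12 * c)) * sqrt \<nu> * t)"
    by (cases "c = 0") (simp_all add: field_simps)
  then show "N'\<^sup>2 \<le> (2 * N * exp (- (ln 2 / (12 * c)) * sqrt \<nu> * t))\<^sup>2"
    using decay by (simp only: exp_double power_mult_distrib) (simp add: mult_ac)
qed (use N in simp)

lemma L2_diff:
  assumes f: "f \<in> L2 d" and g: "g \<in> L2 d"
  shows "(\<lambda>x. f x - g x) \<in> L2 d"
proof -
  note [measurable] = L2_measurable[OF f] L2_measurable[OF g]
  have "integrable (torus d) (\<lambda>x. (f x - g x)\<^sup>2)"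
  proof (rule Bochner_Integration.integrable_bound)
    show "integrable (torus d) (\<lambda>x. 2 * (f x)\<^sup>2 + 2 * (g x)\<^sup>2)"
      using L2_square_integrable[OF f] L2_square_integrable[OF g] by simp
    show "AE x in torus d. norm ((f x - g x)\<^sup>2) \<le> norm (2 * (f x)\<^sup>2 + 2 * (g x)\<^sup>2)"
    proof (rule AE_I2)
      fix x
      have "0 \<le> (f x + g x)\<^sup>2" by simp
      then have "(f x - g x)\<^sup>2 \<le> 2 * (f x)\<^sup>2 + 2 * (g x)\<^sup>2"
        by (simp add: power2_sum power2_diff)
      moreover have "0 \<le> 2 * (f x)\<^sup>2 + 2 * (g x)\<^sup>2" by simp
      ultimately show "norm ((f x - g x)\<^sup>2) \<le> norm (2 * (f x)\<^sup>2 + 2 * (g x)\<^sup>2)"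
        by (simp only: real_norm_def abs_of_nonneg zero_le_power2)
    qed
  qed measurable
  then show ?thesis by (simp add: L2_def)
qed

lemma L2_norm_square: "(L2_norm d f)\<^sup>2 = (\<integral>x. (f x)\<^sup>2 \<partial>torus d)"
  unfolding L2_norm_def by (simp add: integral_nonneg)

lemma fourier_cos_diff: "f \<in> L2 d \<Longrightarrow> g \<in> L2 d \<Longrightarrow> fourier_cos d (\<lambda>x. f x - g x) m = fourier_cos d f m - fourier_cos d g m"
  and fourier_sin_diff: "f \<in> L2 d \<Longrightarrow> g \<in> L2 d \<Longrightarrow> fourier_sin d (\<lambda>x. f x - g x) m = fourier_sin d f m - fourier_sin d g m"
  unfolding fourier_cos_def fourier_sin_def left_diff_distrib
  by (simp_all add: Bochner_Integration.integral_diff L2_mult_cos_integrable L2_mult_sin_integrable)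

lemma coeff_bessel:
  assumes f: "f \<in> L2 d" and H: "finite H" "H \<subseteq> modes d"
  shows "(\<Sum>m\<in>H. (fourier_cos d f m)\<^sup>2) \<le> (2 * pi) ^ d * (L2_norm d f)\<^sup>2"
    and "(\<Sum>m\<in>H. (fourier_sin d f m)\<^sup>2) \<le> (2 * pi) ^ d * (L2_norm d f)\<^sup>2"
proof -
  have "(\<Sum>m\<in>H. (fourier_cos d f m)\<^sup>2 + (fourier_sin d f m)\<^sup>2) \<le> (2 * pi) ^ d * (L2_norm d f)\<^sup>2"
    unfolding L2_norm_square using H by (intro finite_sum_le_has_sum[OF parseval[OF f]]) auto
  moreover have "0 \<le> (\<Sum>m\<in>H. (fourier_cos d f m)\<^sup>2)" "0 \<le> (\<Sum>m\<in>H. (fourier_sin d f m)\<^sup>2)"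
    by (intro sum_nonneg; simp)+
  ultimately show "(\<Sum>m\<in>H. (fourier_cos d f m)\<^sup>2) \<le> (2 * pi) ^ d * (L2_norm d f)\<^sup>2"
    "(\<Sum>m\<in>H. (fourier_sin d f m)\<^sup>2) \<le> (2 * pi) ^ d * (L2_norm d f)\<^sup>2"
    by (simp_all add: sum.distrib)
qed

lemma wave_integral:
  assumes f: "f \<in> L2 d"
  shows "integrable (torus d) (\<lambda>x. f x * wave d m A B x)"
    and "(\<integral>x. f x * wave d m A B x \<partial>torus d) = A * fourier_cos d f m + B * fourier_sin d f m"
proof -
  have eq: "f x * wave d m A B x = A * (f x * cos (phase d m x)) + B * (f x * sin (phase d m x))" for x
    by (simp add: wave_def algebra_simps)
  show "integrable (torus d) (\<lambda>x. f x * wave d m A B x)"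
    unfolding eq using L2_mult_cos_integrable[OF f] L2_mult_sin_integrable[OF f]
    by (intro Bochner_Integration.integrable_add integrable_mult_right)
  show "(\<integral>x. f x * wave d m A B x \<partial>torus d) = A * fourier_cos d f m + B * fourier_sin d f m"
    unfolding eq fourier_cos_def fourier_sin_def
    using L2_mult_cos_integrable[OF f] L2_mult_sin_integrable[OF f] by simp
qed

locale weak_solution =
  fixes n :: nat and \<nu> :: real and \<Phi>1 \<Phi>2 :: "real \<Rightarrow> real" and \<eta>0 \<eta>
  assumes \<nu>: "0 < \<nu>" "\<nu> \<le> 1" and vary: "vary_on_time_scale (1 / 10 ^ 16) \<nu> \<Phi>1 \<Phi>2"
    and \<eta>0: "\<eta>0 \<in> L2 (2 * n)"
    and solution: "passive_scalar_solution (2 * n) \<nu> (velocity n \<Phi>1 \<Phi>2) \<eta>0 \<eta>"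
begin

section \<open>From weak solutions to equations for the coefficients\<close>

lemma \<eta>_L2: "0 \<le> t \<Longrightarrow> \<eta> t \<in> L2 (2 * n)"
  and \<eta>_continuous: "0 \<le> s \<Longrightarrow> ((\<lambda>t. L2_norm (2 * n) (\<lambda>x. \<eta> t x - \<eta> s x)) \<longlongrightarrow> 0) (at s within {0..})"
  and \<eta>_initial: "AE x in torus (2 * n). \<eta> 0 x = \<eta>0 x"
  and \<eta>_weak: "smooth_periodic (2 * n) \<phi> \<Longrightarrow> 0 \<le> t \<Longrightarrow>
        ((\<lambda>s. \<integral>x. \<eta> s x * ((\<Sum>j<2 * n. partial j (\<lambda>y. velocity n \<Phi>1 \<Phi>2 s y j * \<phi> y) x) + \<nu> * laplacian (2 * n) \<phi> x)
            \<partial>torus (2 * n))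
         has_integral ((\<integral>x. \<eta> t x * \<phi> x \<partial>torus (2 * n)) - (\<integral>x. \<eta>0 x * \<phi> x \<partial>torus (2 * n)))) {0..t}"
  using solution unfolding passive_scalar_solution_def by blast+

text \<open>Bessel's inequality for the difference of two times turns continuity in L2 into
  continuity of each coefficient.\<close>

lemma coeff_continuous:
  assumes m: "m \<in> modes (2 * n)"
  shows "continuous_on {0..} (\<lambda>t. fourier_cos (2 * n) (\<eta> t) m)" "continuous_on {0..} (\<lambda>t. fourier_sin (2 * n) (\<eta> t) m)"
proof -
  let ?V = "(2 * pi) ^ (2 * n) :: real"
  have lim: "((\<lambda>t. sqrt ?V * L2_norm (2 * n) (\<lambda>x. \<eta> t x - \<eta> s x)) \<longlongrightarrow> 0) (at s within {0..})" if "0 \<le> s" for s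
    using tendsto_mult_left[OF \<eta>_continuous[OF that], of "sqrt ?V"] by simp
  have step: "\<bar>c\<bar> \<le> sqrt ?V * L2_norm (2 * n) f" if "c\<^sup>2 \<le> ?V * (L2_norm (2 * n) f)\<^sup>2" for c f
  proof -
    have "0 \<le> L2_norm (2 * n) f" by (simp add: L2_norm_def integral_nonneg)
    then have "sqrt (?V * (L2_norm (2 * n) f)\<^sup>2) = sqrt ?V * L2_norm (2 * n) f"
      by (simp add: real_sqrt_mult)
    then show ?thesis using real_sqrt_le_mono[OF that] by simp
  qed
  show "continuous_on {0..} (\<lambda>t. fourier_cos (2 * n) (\<eta> t) m)"
    unfolding continuous_on_def
  proof
    fix s :: real assume s: "s \<in> {0..}"
    show "((\<lambda>t. fourier_cos (2 * n) (\<eta> t) m) \<longlongrightarrow> fourier_cos (2 * n) (\<eta> s) m) (at s within {0..})"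
    proof (rule Lim_null[THEN iffD2], rule Lim_null_comparison[OF _ lim])
      show "\<forall>\<^sub>F t in at s within {0..}. norm (fourier_cos (2 * n) (\<eta> t) m - fourier_cos (2 * n) (\<eta> s) m)
          \<le> sqrt ?V * L2_norm (2 * n) (\<lambda>x. \<eta> t x - \<eta> s x)"
        unfolding eventually_at_filter
      proof (intro always_eventually allI impI)
        fix t :: real assume "t \<noteq> s" "t \<in> {0..}"
        then have L: "\<eta> t \<in> L2 (2 * n)" "\<eta> s \<in> L2 (2 * n)" using s \<eta>_L2 by auto
        show "norm (fourier_cos (2 * n) (\<eta> t) m - fourier_cos (2 * n) (\<eta> s) m) \<le> sqrt ?V * L2_norm (2 * n) (\<lambda>x. \<eta> t x - \<eta> s x)"
          using step coeff_bessel(1)[OF L2_diff[OF L], of "{m}"] m by (simp add: fourier_cos_diff[OF L])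
      qed
    qed (use s in simp)
  qed
  show "continuous_on {0..} (\<lambda>t. fourier_sin (2 * n) (\<eta> t) m)"
    unfolding continuous_on_def
  proof
    fix s :: real assume s: "s \<in> {0..}"
    show "((\<lambda>t. fourier_sin (2 * n) (\<eta> t) m) \<longlongrightarrow> fourier_sin (2 * n) (\<eta> s) m) (at s within {0..})"
    proof (rule Lim_null[THEN iffD2], rule Lim_null_comparison[OF _ lim])
      show "\<forall>\<^sub>F t in at s within {0..}. norm (fourier_sin (2 * n) (\<eta> t) m - fourier_sin (2 * n) (\<eta> s) m)
          \<le> sqrt ?V * L2_norm (2 * n) (\<lambda>x. \<eta> t x - \<eta> s x)"
        unfolding eventually_at_filter
      proof (intro always_eventually allI impI)
        fix t :: real assume "t \<noteq> s" "t \<in> {0..}"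
        then have L: "\<eta> t \<in> L2 (2 * n)" "\<eta> s \<in> L2 (2 * n)" using s \<eta>_L2 by auto
        show "norm (fourier_sin (2 * n) (\<eta> t) m - fourier_sin (2 * n) (\<eta> s) m) \<le> sqrt ?V * L2_norm (2 * n) (\<lambda>x. \<eta> t x - \<eta> s x)"
          using step coeff_bessel(2)[OF L2_diff[OF L], of "{m}"] m by (simp add: fourier_sin_diff[OF L])
      qed
    qed (use s in simp)
  qed
qed

text \<open>Continuity in L2 bounds the norm near each time, and compactness of the interval makes
  the bound uniform; this supplies \<open>square_bound\<close>.\<close>

lemma norm_locally_bounded: "\<exists>K. \<forall>t\<in>{0..T}. (L2_norm (2 * n) (\<eta> t))\<^sup>2 \<le> K"
proof (cases "0 \<le> T")
  case True
  have "\<exists>K. \<forall>t. 0 \<le> t \<and> t \<in> {0..T} \<longrightarrow> (L2_norm (2 * n) (\<eta> t))\<^sup>2 \<le> K"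
  \<comment> \<open>The guard 0 <= t is carried along because the small intervals in this principle
    may reach below 0, where \<eta> is unconstrained.\<close>
  proof (rule Bolzano[OF True, where P = "\<lambda>a b. \<exists>K. \<forall>t. 0 \<le> t \<and> t \<in> {a..b} \<longrightarrow> (L2_norm (2 * n) (\<eta> t))\<^sup>2 \<le> K"])
    fix a b c :: real
    assume "\<exists>K. \<forall>t. 0 \<le> t \<and> t \<in> {a..b} \<longrightarrow> (L2_norm (2 * n) (\<eta> t))\<^sup>2 \<le> K"
      and "\<exists>K. \<forall>t. 0 \<le> t \<and> t \<in> {b..c} \<longrightarrow> (L2_norm (2 * n) (\<eta> t))\<^sup>2 \<le> K"
    then obtain K K' where "\<forall>t. 0 \<le> t \<and> t \<in> {a..b} \<longrightarrow> (L2_norm (2 * n) (\<eta> t))\<^sup>2 \<le> K"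
      "\<forall>t. 0 \<le> t \<and> t \<in> {b..c} \<longrightarrow> (L2_norm (2 * n) (\<eta> t))\<^sup>2 \<le> K'" by blast
    then have "\<forall>t. 0 \<le> t \<and> t \<in> {a..c} \<longrightarrow> (L2_norm (2 * n) (\<eta> t))\<^sup>2 \<le> max K K'"
      by (metis atLeastAtMost_iff le_max_iff_disj linear)
    then show "\<exists>K. \<forall>t. 0 \<le> t \<and> t \<in> {a..c} \<longrightarrow> (L2_norm (2 * n) (\<eta> t))\<^sup>2 \<le> K" by blast
  next
    fix s :: real assume s: "0 \<le> s" "s \<le> T"
    have "\<forall>\<^sub>F t in at s within {0..}. L2_norm (2 * n) (\<lambda>x. \<eta> t x - \<eta> s x) < 1"
      by (rule order_tendstoD(2)[OF \<eta>_continuous[OF s(1)]]) simp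
    then obtain r where r: "0 < r" "\<And>t. 0 \<le> t \<Longrightarrow> t \<noteq> s \<Longrightarrow> \<bar>t - s\<bar> < r \<Longrightarrow> L2_norm (2 * n) (\<lambda>x. \<eta> t x - \<eta> s x) < 1"
      by (auto simp: eventually_at dist_real_def)
    have bound: "(L2_norm (2 * n) (\<eta> t))\<^sup>2 \<le> 2 + 2 * (L2_norm (2 * n) (\<eta> s))\<^sup>2" if t: "0 \<le> t" "\<bar>t - s\<bar> < r" for t
    proof (cases "t = s")
      case False
      have L: "\<eta> t \<in> L2 (2 * n)" "\<eta> s \<in> L2 (2 * n)" using t s \<eta>_L2 by auto
      have "(\<integral>x. (\<eta> t x)\<^sup>2 \<partial>torus (2 * n)) \<le> (\<integral>x. 2 * (\<eta> t x - \<eta> s x)\<^sup>2 + 2 * (\<eta> s x)\<^sup>2 \<partial>torus (2 * n))"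
      proof (rule integral_mono)
        fix x
        have "0 \<le> (\<eta> t x - 2 * \<eta> s x)\<^sup>2" by simp
        then show "(\<eta> t x)\<^sup>2 \<le> 2 * (\<eta> t x - \<eta> s x)\<^sup>2 + 2 * (\<eta> s x)\<^sup>2"
          by (simp add: power2_eq_square algebra_simps)
      qed (use L2_square_integrable[OF L(1)] L2_square_integrable[OF L(2)] L2_square_integrable[OF L2_diff[OF L]] in simp_all)
      also have "\<dots> = 2 * (L2_norm (2 * n) (\<lambda>x. \<eta> t x - \<eta> s x))\<^sup>2 + 2 * (L2_norm (2 * n) (\<eta> s))\<^sup>2"
        unfolding L2_norm_square using L2_square_integrable[OF L(2)] L2_square_integrable[OF L2_diff[OF L]] by simp
      also have "(L2_norm (2 * n) (\<lambda>x. \<eta> t x - \<eta> s x))\<^sup>2 \<le> 1"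
        using r(2)[OF t(1) False t(2)] by (intro power_le_one) (auto simp: L2_norm_def integral_nonneg)
      finally show ?thesis by (simp add: L2_norm_square)
    qed simp
    show "\<exists>r>0. \<forall>a b. a \<le> s \<and> s \<le> b \<and> b - a < r \<longrightarrow>
        (\<exists>K. \<forall>t. 0 \<le> t \<and> t \<in> {a..b} \<longrightarrow> (L2_norm (2 * n) (\<eta> t))\<^sup>2 \<le> K)"
    proof (rule exI[of _ r], intro conjI r(1) allI impI)
      fix a b assume "a \<le> s \<and> s \<le> b \<and> b - a < r"
      then have "\<forall>t. 0 \<le> t \<and> t \<in> {a..b} \<longrightarrow> (L2_norm (2 * n) (\<eta> t))\<^sup>2 \<le> 2 + 2 * (L2_norm (2 * n) (\<eta> s))\<^sup>2"
        using bound by (auto simp: abs_less_iff)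
      then show "\<exists>K. \<forall>t. 0 \<le> t \<and> t \<in> {a..b} \<longrightarrow> (L2_norm (2 * n) (\<eta> t))\<^sup>2 \<le> K" by blast
    qed
  qed
  then obtain K where "\<forall>t. 0 \<le> t \<and> t \<in> {0..T} \<longrightarrow> (L2_norm (2 * n) (\<eta> t))\<^sup>2 \<le> K" ..
  then have "\<forall>t\<in>{0..T}. (L2_norm (2 * n) (\<eta> t))\<^sup>2 \<le> K" by simp
  then show ?thesis ..
qed simp

definition wave_coeff :: "real \<Rightarrow> real \<Rightarrow> real \<Rightarrow> (nat \<Rightarrow> int) \<Rightarrow> real" where
  "wave_coeff A B t m = A * fourier_cos (2 * n) (\<eta> t) m + B * fourier_sin (2 * n) (\<eta> t) m"

definition coeff_rhs :: "real \<Rightarrow> real \<Rightarrow> (nat \<Rightarrow> int) \<Rightarrow> real \<Rightarrow> real" where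
  "coeff_rhs A B m t =
     - \<nu> * mode_square (2 * n) m * wave_coeff A B t m
     - \<Phi>1 t / 2 * (\<Sum>i<n. of_int (m i) * (wave_coeff A B t (m - unit_mode (n + i) 1) - wave_coeff A B t (m + unit_mode (n + i) 1)))
     - \<Phi>2 t / 2 * (\<Sum>i<n. of_int (m (n + i)) * (wave_coeff A B t (m - unit_mode i 1) - wave_coeff A B t (m + unit_mode i 1)))"

lemma wave_coeff_integral: "0 \<le> t \<Longrightarrow> (\<integral>x. \<eta> t x * wave (2 * n) m A B x \<partial>torus (2 * n)) = wave_coeff A B t m"
  unfolding wave_coeff_def by (rule wave_integral[OF \<eta>_L2])

lemma generator_wave_integral:
  assumes t: "0 \<le> t"
  shows "(\<integral>x. \<eta> t x * generator_wave n \<nu> (\<Phi>1 t) (\<Phi>2 t) m A B x \<partial>torus (2 * n)) = coeff_rhs A B m t"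
proof -
  let ?M = "torus (2 * n)"
  let ?w = "\<lambda>m x. \<eta> t x * wave (2 * n) m A B x"
  note int = wave_integral(1)[OF \<eta>_L2[OF t]]
  have "(\<lambda>x. \<eta> t x * generator_wave n \<nu> (\<Phi>1 t) (\<Phi>2 t) m A B x) = (\<lambda>x.
     (- \<nu> * mode_square (2 * n) m) * ?w m x
     - \<Phi>1 t / 2 * (\<Sum>i<n. of_int (m i) * (?w (m - unit_mode (n + i) 1) x - ?w (m + unit_mode (n + i) 1) x))
     - \<Phi>2 t / 2 * (\<Sum>i<n. of_int (m (n + i)) * (?w (m - unit_mode i 1) x - ?w (m + unit_mode i 1) x)))"
    by (simp add: generator_wave_def fun_eq_iff right_diff_distrib sum_distrib_left mult_ac)
  moreover have drift: "integrable ?M (\<lambda>x. - \<nu> * mode_square (2 * n) m * ?w m x)"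
      "(\<integral>x. - \<nu> * mode_square (2 * n) m * ?w m x \<partial>?M) = - \<nu> * mode_square (2 * n) m * wave_coeff A B t m"
    by (rule integrable_mult_right[OF int], simp only: integral_mult_right_zero wave_coeff_integral[OF t])
  moreover have shear: "integrable ?M (\<lambda>x. c * (\<Sum>i<n. g i * (?w (k i) x - ?w (k' i) x)))"
      "(\<integral>x. c * (\<Sum>i<n. g i * (?w (k i) x - ?w (k' i) x)) \<partial>?M) =
        c * (\<Sum>i<n. g i * (wave_coeff A B t (k i) - wave_coeff A B t (k' i)))" for c :: real and g k k'
    using int by (simp_all add: wave_coeff_integral[OF t])
  ultimately show ?thesis
    by (simp only: coeff_rhs_def Bochner_Integration.integral_diff[OF Bochner_Integration.integrable_diff[OF drift(1) shear(1)] shear(1)]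
        Bochner_Integration.integral_diff[OF drift(1) shear(1)] drift(2) shear(2))
qed

lemma wave_coeff_continuous: "m \<in> modes (2 * n) \<Longrightarrow> continuous_on {0..} (\<lambda>t. wave_coeff A B t m)"
  unfolding wave_coeff_def by (intro continuous_intros coeff_continuous)

lemma modes_shift: "m \<in> modes d \<Longrightarrow> i < d \<Longrightarrow> m + unit_mode i 1 \<in> modes d" "m \<in> modes d \<Longrightarrow> i < d \<Longrightarrow> m - unit_mode i 1 \<in> modes d"
  by (auto simp: modes_def unit_mode_def)

lemma \<Phi>_smooth_continuous: "continuous_on {0..} \<Phi>1" "continuous_on {0..} \<Phi>2"
  using vary by (auto simp: vary_on_time_scale_def Let_def intro: smooth_on_halfline_continuous)

text \<open>The weak equation holds in integrated form. Tested with a wave its integrand is a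
  continuous function of time, so the coefficient is differentiable in the classical sense.\<close>

lemma wave_coeff_has_derivative:
  assumes t: "0 \<le> t" and m: "m \<in> modes (2 * n)"
  shows "((\<lambda>t. wave_coeff A B t m) has_real_derivative coeff_rhs A B m t) (at t within {0..})"
proof -
  have cont: "continuous_on {0..} (coeff_rhs A B m)"
    unfolding coeff_rhs_def
    by (intro continuous_intros wave_coeff_continuous m modes_shift \<Phi>_smooth_continuous) auto
  have eq: "wave_coeff A B s m = wave_coeff A B 0 m + integral {0..s} (coeff_rhs A B m)" if s: "0 \<le> s" for s
  proof -
    let ?\<phi> = "wave (2 * n) m A B"
    have "((\<lambda>r. \<integral>x. \<eta> r x * generator_wave n \<nu> (\<Phi>1 r) (\<Phi>2 r) m A B x \<partial>torus (2 * n))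
       has_integral ((\<integral>x. \<eta> s x * ?\<phi> x \<partial>torus (2 * n)) - (\<integral>x. \<eta>0 x * ?\<phi> x \<partial>torus (2 * n)))) {0..s}"
      using \<eta>_weak[OF smooth_periodic_wave s, of m A B] by (simp only: adjoint_generator_wave)
    moreover have "(\<integral>x. \<eta>0 x * ?\<phi> x \<partial>torus (2 * n)) = (\<integral>x. \<eta> 0 x * ?\<phi> x \<partial>torus (2 * n))"
      using \<eta>_initial borel_measurable_integrable[OF wave_integral(1)[OF \<eta>0]] borel_measurable_integrable[OF wave_integral(1)[OF \<eta>_L2[of 0]]]
      by (intro integral_cong_AE) (auto elim: eventually_mono)
    ultimately have "((\<lambda>r. \<integral>x. \<eta> r x * generator_wave n \<nu> (\<Phi>1 r) (\<Phi>2 r) m A B x \<partial>torus (2 * n))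
       has_integral (wave_coeff A B s m - wave_coeff A B 0 m)) {0..s}"
      using s by (simp add: wave_coeff_integral)
    then have "(coeff_rhs A B m has_integral (wave_coeff A B s m - wave_coeff A B 0 m)) {0..s}"
      by (rule has_integral_eq[rotated]) (simp add: generator_wave_integral)
    then show ?thesis by (simp add: integral_unique)
  qed
  \<comment> \<open>The interval ends beyond t and is thus a neighbourhood of t within the
    half-line.\<close>
  have "((\<lambda>s. integral {0..s} (coeff_rhs A B m)) has_real_derivative coeff_rhs A B m t) (at t within {0..t + 1})"
    using t by (intro integral_has_real_derivative continuous_on_subset[OF cont]) auto
  then have "((\<lambda>s. wave_coeff A B 0 m + integral {0..s} (coeff_rhs A B m)) has_real_derivative coeff_rhs A B m t) (at t within {0..t + 1})"
    by (auto intro!: derivative_eq_intros)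
  moreover have "at t within {0..t + 1} = at t within {0..}"
    by (rule at_within_nhd[of t "{..<t + 1}"]) auto
  ultimately have "((\<lambda>s. wave_coeff A B 0 m + integral {0..s} (coeff_rhs A B m)) has_real_derivative coeff_rhs A B m t) (at t within {0..})"
    by simp
  then show ?thesis
  proof (rule has_field_derivative_transform_within[where d = 1])
    fix r :: real assume "r \<in> {0..}"
    then show "wave_coeff A B 0 m + integral {0..r} (coeff_rhs A B m) = wave_coeff A B r m"
      by (intro eq[symmetric]) simp
  qed (use t in simp_all)
qed

lemma cos_flow: "alternating_flow n \<nu> \<Phi>1 \<Phi>2 (\<lambda>t. fourier_cos (2 * n) (\<eta> t))"
proof
  fix t :: real and m assume "0 \<le> t" "m \<in> modes (2 * n)"
  from wave_coeff_has_derivative[OF this, of 1 0]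
  show "((\<lambda>t. fourier_cos (2 * n) (\<eta> t) m) has_real_derivative
        - \<nu> * mode_square (2 * n) m * fourier_cos (2 * n) (\<eta> t) m
        - \<Phi>1 t / 2 * (\<Sum>i<n. of_int (m i) * (fourier_cos (2 * n) (\<eta> t) (m - unit_mode (n + i) 1) - fourier_cos (2 * n) (\<eta> t) (m + unit_mode (n + i) 1)))
        - \<Phi>2 t / 2 * (\<Sum>i<n. of_int (m (n + i)) * (fourier_cos (2 * n) (\<eta> t) (m - unit_mode i 1) - fourier_cos (2 * n) (\<eta> t) (m + unit_mode i 1))))
        (at t within {0..})"
    by (simp add: coeff_rhs_def wave_coeff_def)
next
  fix T
  obtain K where K: "\<And>t. t \<in> {0..T} \<Longrightarrow> (L2_norm (2 * n) (\<eta> t))\<^sup>2 \<le> K" using norm_locally_bounded by blast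
  show "\<exists>K. \<forall>t\<in>{0..T}. \<forall>H. finite H \<and> H \<subseteq> modes (2 * n) \<longrightarrow> (\<Sum>m\<in>H. (fourier_cos (2 * n) (\<eta> t) m)\<^sup>2) \<le> K"
  proof (intro exI[of _ "(2 * pi) ^ (2 * n) * K"] ballI allI impI)
    fix t H assume "t \<in> {0..T}" "finite H \<and> H \<subseteq> modes (2 * n)"
    then show "(\<Sum>m\<in>H. (fourier_cos (2 * n) (\<eta> t) m)\<^sup>2) \<le> (2 * pi) ^ (2 * n) * K"
      by (intro order_trans[OF coeff_bessel(1)] mult_left_mono K \<eta>_L2) auto
  qed
qed (use \<nu> vary in auto)

lemma sin_flow: "alternating_flow n \<nu> \<Phi>1 \<Phi>2 (\<lambda>t. fourier_sin (2 * n) (\<eta> t))"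
proof
  fix t :: real and m assume "0 \<le> t" "m \<in> modes (2 * n)"
  from wave_coeff_has_derivative[OF this, of 0 1]
  show "((\<lambda>t. fourier_sin (2 * n) (\<eta> t) m) has_real_derivative
        - \<nu> * mode_square (2 * n) m * fourier_sin (2 * n) (\<eta> t) m
        - \<Phi>1 t / 2 * (\<Sum>i<n. of_int (m i) * (fourier_sin (2 * n) (\<eta> t) (m - unit_mode (n + i) 1) - fourier_sin (2 * n) (\<eta> t) (m + unit_mode (n + i) 1)))
        - \<Phi>2 t / 2 * (\<Sum>i<n. of_int (m (n + i)) * (fourier_sin (2 * n) (\<eta> t) (m - unit_mode i 1) - fourier_sin (2 * n) (\<eta> t) (m + unit_mode i 1))))
        (at t within {0..})"
    by (simp add: coeff_rhs_def wave_coeff_def)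
next
  fix T
  obtain K where K: "\<And>t. t \<in> {0..T} \<Longrightarrow> (L2_norm (2 * n) (\<eta> t))\<^sup>2 \<le> K" using norm_locally_bounded by blast
  show "\<exists>K. \<forall>t\<in>{0..T}. \<forall>H. finite H \<and> H \<subseteq> modes (2 * n) \<longrightarrow> (\<Sum>m\<in>H. (fourier_sin (2 * n) (\<eta> t) m)\<^sup>2) \<le> K"
  proof (intro exI[of _ "(2 * pi) ^ (2 * n) * K"] ballI allI impI)
    fix t H assume "t \<in> {0..T}" "finite H \<and> H \<subseteq> modes (2 * n)"
    then show "(\<Sum>m\<in>H. (fourier_sin (2 * n) (\<eta> t) m)\<^sup>2) \<le> (2 * pi) ^ (2 * n) * K"
      by (intro order_trans[OF coeff_bessel(2)] mult_left_mono K \<eta>_L2) auto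
  qed
qed (use \<nu> vary in auto)

text \<open>Cosine and sine energies decay by the same factor, and by Parseval their sum is the
  volume times the squared norm of the solution minus its mean.\<close>

lemma enhanced_dissipation:
  assumes s: "0 \<le> s" and t: "0 \<le> t"
  shows "L2_norm (2 * n) (\<lambda>x. \<eta> (s + t) x - torus_mean (2 * n) (\<eta> (s + t)))
    \<le> 2 * L2_norm (2 * n) (\<lambda>x. \<eta> s x - torus_mean (2 * n) (\<eta> s)) * exp (- (ln 2 / (12 * 10 ^ 16)) * sqrt \<nu> * t)"
proof -
  interpret c: alternating_flow n \<nu> \<Phi>1 \<Phi>2 "\<lambda>t. fourier_cos (2 * n) (\<eta> t)" by (rule cos_flow)
  interpret sn: alternating_flow n \<nu> \<Phi>1 \<Phi>2 "\<lambda>t. fourier_sin (2 * n) (\<eta> t)" by (rule sin_flow)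
  let ?V = "(2 * pi) ^ (2 * n) :: real"
  let ?N = "\<lambda>t. L2_norm (2 * n) (\<lambda>x. \<eta> t x - torus_mean (2 * n) (\<eta> t))"
  let ?S = "modes (2 * n) - {0}"
  have V: "0 < ?V" by simp
  have N_nonneg: "0 \<le> ?N r" for r by (simp add: L2_norm_def integral_nonneg)
  have energy: "?V * (?N r)\<^sup>2 = energy_on (\<lambda>t. fourier_cos (2 * n) (\<eta> t)) ?S r + energy_on (\<lambda>t. fourier_sin (2 * n) (\<eta> t)) ?S r"
    if r: "0 \<le> r" for r
  proof -
    note ps = parseval_mean_zero[OF \<eta>_L2[OF r]]
    have "(\<lambda>m. (fourier_cos (2 * n) (\<eta> r) m)\<^sup>2) summable_on ?S" "(\<lambda>m. (fourier_sin (2 * n) (\<eta> r) m)\<^sup>2) summable_on ?S"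
      by (rule summable_on_comparison_test[OF has_sum_imp_summable[OF ps]]; simp)+
    from infsum_add[OF this] infsumI[OF ps] show ?thesis
      unfolding energy_on_def by (rule trans[OF sym, rotated])
  qed
  define q where "q = exp (- ln 2 * t / (6 * c.\<tau>))"
  have V_decay: "?V * (?N (s + t))\<^sup>2 \<le> 4 * q * (?V * (?N s)\<^sup>2)"
    unfolding energy[OF s] energy[OF add_nonneg_nonneg[OF s t]] distrib_left[of "4 * q"]
    using add_mono[OF c.energy_decay[OF s t] sn.energy_decay[OF s t]] unfolding q_def .
  have "4 * q * (?V * (?N s)\<^sup>2) = ?V * (4 * q * (?N s)\<^sup>2)" by (rule mult.left_commute)
  from ord_le_eq_trans[OF V_decay this] have "(?N (s + t))\<^sup>2 \<le> 4 * q * (?N s)\<^sup>2"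
    using V by (rule mult_left_le_imp_le)
  then show ?thesis
    unfolding q_def c.\<tau>_eq by (rule root_decay[OF \<nu>(1) N_nonneg])
qed

end

theorem theorem1p3:
  shows "\<exists>\<delta>ED CED \<delta>s :: real.
    0 < \<delta>ED \<and> \<delta>ED < 1 \<and> 1 \<le> CED \<and> 0 < \<delta>s \<and> \<delta>s < 1 \<and>
    (\<forall>n\<ge>1. \<forall>\<nu>. 0 < \<nu> \<and> \<nu> \<le> 1 \<longrightarrow>
      (\<exists>\<Phi>1 \<Phi>2. vary_on_time_scale \<delta>s \<nu> \<Phi>1 \<Phi>2 \<and>
        (\<forall>\<eta>0 \<in> L2 (2 * n). \<forall>\<eta>.
          passive_scalar_solution (2 * n) \<nu> (velocity n \<Phi>1 \<Phi>2) \<eta>0 \<eta> \<longrightarrow>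
          (\<forall>s\<ge>0. \<forall>t\<ge>0.
            L2_norm (2 * n) (\<lambda>x. \<eta> (s + t) x - torus_mean (2 * n) (\<eta> (s + t)))
            \<le> CED * L2_norm (2 * n) (\<lambda>x. \<eta> s x - torus_mean (2 * n) (\<eta> s))
                * exp (- \<delta>ED * sqrt \<nu> * t)))))"
\<comment> \<open>Squared norms are halved in each period 6 \<tau> = 6 * 10^16 / sqrt \<nu>; the
  root doubles the denominator to 12 * 10^16 and turns the factor 4 into 2.\<close>
proof (rule exI[of _ "ln 2 / (12 * 10 ^ 16)"], rule exI[of _ 2], rule exI[of _ "1 / 10 ^ 16"], intro conjI allI impI)
  show "0 < ln 2 / (12 * 10 ^ 16 :: real)" by simp
  show "ln 2 / (12 * 10 ^ 16 :: real) < 1" using ln_2_less_1 by simp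
  fix n :: nat and \<nu> :: real assume \<nu>: "0 < \<nu> \<and> \<nu> \<le> 1"
  \<comment> \<open>Only the schedule enters the estimate, so every pair satisfying it has the decay
    property.\<close>
  obtain \<Phi>1 \<Phi>2 where vary: "vary_on_time_scale (1 / 10 ^ 16) \<nu> \<Phi>1 \<Phi>2"
    using vary_on_time_scale_exists[of "1 / 10 ^ 16" \<nu>] \<nu> by auto
  show "\<exists>\<Phi>1 \<Phi>2. vary_on_time_scale (1 / 10 ^ 16) \<nu> \<Phi>1 \<Phi>2 \<and>
        (\<forall>\<eta>0 \<in> L2 (2 * n). \<forall>\<eta>.
          passive_scalar_solution (2 * n) \<nu> (velocity n \<Phi>1 \<Phi>2) \<eta>0 \<eta> \<longrightarrow>
          (\<forall>s\<ge>0. \<forall>t\<ge>0.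
            L2_norm (2 * n) (\<lambda>x. \<eta> (s + t) x - torus_mean (2 * n) (\<eta> (s + t)))
            \<le> 2 * L2_norm (2 * n) (\<lambda>x. \<eta> s x - torus_mean (2 * n) (\<eta> s))
                * exp (- (ln 2 / (12 * 10 ^ 16)) * sqrt \<nu> * t)))"
  proof (rule exI[of _ \<Phi>1], rule exI[of _ \<Phi>2], intro conjI vary ballI allI impI)
    fix \<eta>0 \<eta> and s t :: real
    assume "\<eta>0 \<in> L2 (2 * n)" "passive_scalar_solution (2 * n) \<nu> (velocity n \<Phi>1 \<Phi>2) \<eta>0 \<eta>" "0 \<le> s" "0 \<le> t"
    then interpret weak_solution n \<nu> \<Phi>1 \<Phi>2 \<eta>0 \<eta>
      using \<nu> vary by unfold_locales auto
    show "L2_norm (2 * n) (\<lambda>x. \<eta> (s + t) x - torus_mean (2 * n) (\<eta> (s + t)))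
            \<le> 2 * L2_norm (2 * n) (\<lambda>x. \<eta> s x - torus_mean (2 * n) (\<eta> s))
                * exp (- (ln 2 / (12 * 10 ^ 16)) * sqrt \<nu> * t)"
      by (rule enhanced_dissipation) fact+
  qed
qed auto

end
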